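(* Let $N\ge 2$, let $\Omega\subset\mathbb{R}^N$ be a smooth bounded domain with boundary $\partial\Omega$, and let $1<q<p$. Let $p\in I(q)$. Assume that there exist $M\subseteq\mathbb{R}$ and $m\in L^1(\Omega)$ with $\int_\Omega m(x)\varphi_p^q\,dx>0$ such that $$f_\mu(x,s,\xi)>\lambda_1(p)s^{p-1}+\beta_*^m\, m(x)s^{q-1}$$ for all $\mu\in M$, $s>0$, $\xi\in\mathbb{R}^N$, and a.e. $x\in\Omega$, where $$\beta_*^m=\frac{\int_\Omega|\nabla\varphi_p|^q\,dx}{\int_\Omega m(x)\varphi_p^q\,dx}.$$ If $\mu\in M$, then the problem $$-\Delta_p u-\Delta_q u=f_\mu(x,u,\nabla u)\ \text{ in }\Omega,\qquad u=0\ \text{ on }\partial\Omega,$$ has no solution in $\mathrm{int}\,C_0^1(\overline\Omega)_+$.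
   Context: For $q>1$, $$I(q):=\{p>1:\ (q-1)s^p+qs^{p-1}-(p-q)s+(q-p+1)\ge 0\ \text{ for all } s\ge 0\}.$$ $\Delta_r u=\mathrm{div}(|\nabla u|^{r-2}\nabla u)$ is the $r$-Laplacian. $\lambda_1(p)=\inf\left\{\frac{\int_\Omega|\nabla u|^p\,dx}{\int_\Omega|u|^p\,dx}:\ u\in W_0^{1,p}(\Omega)\setminus\{0\}\right\}$ is the first eigenvalue of the Dirichlet $p$-Laplacian in $\Omega$, and $\varphi_p$ is the corresponding first eigenfunction, chosen positive and normalized by $\|\nabla\varphi_p\|_p=1$ (where $\|\cdot\|_p$ is the $L^p(\Omega)$ norm); $\lambda_1(p)$ is simple and $\varphi_p\in\mathrm{int}\,C_0^1(\overline\Omega)_+$. $C_0^1(\overline\Omega)=\{u\in C^1(\overline\Omega): u=0\text{ on }\partial\Omega\}$ and $$\mathrm{int}\,C_0^1(\overline\Omega)_+=\left\{u\in C_0^1(\overline\Omega):\ u>0\text{ in }\Omega,\ \frac{\partial u}{\partial\nu}<0\text{ on }\partial\Omega\right\},$$ where $\nu$ is the unit exterior normal vector to $\partial\Omega$. For each real parameter $\mu$, the function $f_\mu:\Omega\times\mathbb{R}\times\mathbb{R}^N\to\mathbb{R}$ is assumed to be sufficiently regular that the problem possesses a weak formulation with respect to $W_0^{1,p}(\Omega)$: a solution is a function $u\in W_0^{1,p}(\Omega)$ such that $$\int_\Omega|\nabla u|^{p-2}\nabla u\nabla\varphi\,dx+\int_\Omega|\nabla u|^{q-2}\nabla u\nabla\varphi\,dx=\int_\Omega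 f_\mu(x,u,\nabla u)\varphi\,dx\quad\text{for all }\varphi\in W_0^{1,p}(\Omega),$$ all integrals being well-defined and finite. *)

theory Defs
  imports "HOL-Analysis.Analysis"
begin

section \<open>Smooth functions, gradients and smooth domains\<close>

text \<open>In finite dimension, \<open>C_k_on k S f\<close> for open \<open>S\<close> is the usual class \<open>C^k(S)\<close>: all iterated
  directional derivatives up to order \<open>k\<close> exist and are continuous on \<open>S\<close>.\<close>

primrec C_k_on :: "nat \<Rightarrow> 'a::euclidean_space set \<Rightarrow> ('a \<Rightarrow> real) \<Rightarrow> bool" where
  "C_k_on 0 S f \<longleftrightarrow> continuous_on S f"
| "C_k_on (Suc k) S f \<longleftrightarrow>
     (\<forall>x\<in>S. f differentiable (at x)) \<and> (\<forall>v. C_k_on k S (\<lambda>x. frechet_derivative f (at x) v))"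

definition smooth_on :: "'a::euclidean_space set \<Rightarrow> ('a \<Rightarrow> real) \<Rightarrow> bool" where
  "smooth_on S f \<longleftrightarrow> (\<forall>k. C_k_on k S f)"

definition grad :: "('a::euclidean_space \<Rightarrow> real) \<Rightarrow> 'a \<Rightarrow> 'a" where
  "grad f x = (THE D. GDERIV f x :> D)"

text \<open>A smooth local defining function of \<open>\<Omega>\<close> near the boundary point \<open>x\<close>. Since the gradient does
  not vanish, \<open>frontier \<Omega> \<inter> U = {y \<in> U. g y = 0}\<close> follows, and \<open>\<Omega>\<close> lies locally on one side of
  its boundary.\<close>

definition local_defining_function ::
  "'a::euclidean_space set \<Rightarrow> 'a \<Rightarrow> 'a set \<Rightarrow> ('a \<Rightarrow> real) \<Rightarrow> bool" where
  "local_defining_function \<Omega> x U g \<longleftrightarrow>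
     open U \<and> x \<in> U \<and> smooth_on U g \<and> (\<forall>y\<in>U. grad g y \<noteq> 0) \<and> \<Omega> \<inter> U = {y \<in> U. g y < 0}"

definition smooth_bounded_domain :: "'a::euclidean_space set \<Rightarrow> bool" where
  "smooth_bounded_domain \<Omega> \<longleftrightarrow>
     open \<Omega> \<and> connected \<Omega> \<and> \<Omega> \<noteq> {} \<and> bounded \<Omega> \<and>
     (\<forall>x\<in>frontier \<Omega>. \<exists>U g. local_defining_function \<Omega> x U g)"

text \<open>For \<open>x \<in> frontier \<Omega>\<close> of a smooth domain the vector \<open>\<nu>\<close> below exists and does not depend on the
  choice of the local defining function; \<open>sgn v = v /\<^sub>R norm v\<close>.\<close>

definition exterior_unit_normal :: "'a::euclidean_space set \<Rightarrow> 'a \<Rightarrow> 'a \<Rightarrow> bool" where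
  "exterior_unit_normal \<Omega> x \<nu> \<longleftrightarrow> (\<exists>U g. local_defining_function \<Omega> x U g \<and> \<nu> = sgn (grad g x))"

section \<open>The spaces of functions that are continuously differentiable up to the boundary\<close>

text \<open>\<open>u\<close> belongs to \<open>C^1\<close> of the closure of \<open>\<Omega>\<close>, and \<open>G\<close> is the continuous extension of its
  gradient to the closure. As \<open>\<Omega>\<close> is dense in its closure, \<open>G\<close> is unique there. Here and
  below, only the values of \<open>u\<close> on (the closure of) \<open>\<Omega>\<close> matter.\<close>

definition C1_closure_grad :: "'a::euclidean_space set \<Rightarrow> ('a \<Rightarrow> real) \<Rightarrow> ('a \<Rightarrow> 'a) \<Rightarrow> bool" where
  "C1_closure_grad \<Omega> u G \<longleftrightarrow>
     continuous_on (closure \<Omega>) u \<and> continuous_on (closure \<Omega>) G \<and> (\<forall>x\<in>\<Omega>. GDERIV u x :> G x)"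

definition C10 :: "'a::euclidean_space set \<Rightarrow> ('a \<Rightarrow> real) set" where
  "C10 \<Omega> = {u. (\<exists>G. C1_closure_grad \<Omega> u G) \<and> (\<forall>x\<in>frontier \<Omega>. u x = 0)}"

text \<open>The normal derivative at a boundary point is \<open>G x \<bullet> \<nu>\<close>.\<close>

definition int_C10_plus :: "'a::euclidean_space set \<Rightarrow> ('a \<Rightarrow> real) set" where
  "int_C10_plus \<Omega> = {u \<in> C10 \<Omega>. (\<forall>x\<in>\<Omega>. u x > 0) \<and>
     (\<forall>G. C1_closure_grad \<Omega> u G \<longrightarrow>
        (\<forall>x\<in>frontier \<Omega>. \<forall>\<nu>. exterior_unit_normal \<Omega> x \<nu> \<longrightarrow> G x \<bullet> \<nu> < 0))}"

section \<open>Sobolev spaces\<close>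

definition Lp :: "real \<Rightarrow> 'a::euclidean_space set \<Rightarrow> ('a \<Rightarrow> 'b::euclidean_space) set" where
  "Lp p \<Omega> = {f \<in> borel_measurable (lebesgue_on \<Omega>).
     integrable (lebesgue_on \<Omega>) (\<lambda>x. norm (f x) powr p)}"

definition Lp_norm :: "real \<Rightarrow> 'a::euclidean_space set \<Rightarrow> ('a \<Rightarrow> 'b::euclidean_space) \<Rightarrow> real" where
  "Lp_norm p \<Omega> f = (\<integral>x. norm (f x) powr p \<partial>lebesgue_on \<Omega>) powr (1 / p)"

definition test_functions :: "'a::euclidean_space set \<Rightarrow> ('a \<Rightarrow> real) set" where
  "test_functions \<Omega> = {\<phi>. smooth_on UNIV \<phi> \<and>
     compact (closure {x. \<phi> x \<noteq> 0}) \<and> closure {x. \<phi> x \<noteq> 0} \<subseteq> \<Omega>}"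

text \<open>The integration by parts formula, for all partial derivatives at once.\<close>

definition has_weak_grad :: "'a::euclidean_space set \<Rightarrow> ('a \<Rightarrow> real) \<Rightarrow> ('a \<Rightarrow> 'a) \<Rightarrow> bool" where
  "has_weak_grad \<Omega> u G \<longleftrightarrow>
     (\<forall>K. compact K \<and> K \<subseteq> \<Omega> \<longrightarrow> integrable (lebesgue_on K) u \<and> integrable (lebesgue_on K) G) \<and>
     (\<forall>\<phi>\<in>test_functions \<Omega>.
        (\<integral>x. u x *\<^sub>R grad \<phi> x \<partial>lebesgue_on \<Omega>) = - (\<integral>x. \<phi> x *\<^sub>R G x \<partial>lebesgue_on \<Omega>))"

text \<open>A representative of the weak gradient, which is unique up to a null set.\<close>

definition weak_grad :: "'a::euclidean_space set \<Rightarrow> ('a \<Rightarrow> real) \<Rightarrow> 'a \<Rightarrow> 'a" where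
  "weak_grad \<Omega> u = (SOME G. has_weak_grad \<Omega> u G)"

definition W1p :: "real \<Rightarrow> 'a::euclidean_space set \<Rightarrow> ('a \<Rightarrow> real) set" where
  "W1p p \<Omega> = {u \<in> Lp p \<Omega>. (\<exists>G. has_weak_grad \<Omega> u G) \<and> weak_grad \<Omega> u \<in> Lp p \<Omega>}"

text \<open>The closure of the test functions in \<open>W1p p \<Omega>\<close>.\<close>

definition W01p :: "real \<Rightarrow> 'a::euclidean_space set \<Rightarrow> ('a \<Rightarrow> real) set" where
  "W01p p \<Omega> = {u \<in> W1p p \<Omega>. \<exists>\<phi> :: nat \<Rightarrow> 'a \<Rightarrow> real. (\<forall>n. \<phi> n \<in> test_functions \<Omega>) \<and>
     (\<lambda>n. Lp_norm p \<Omega> (\<lambda>x. \<phi> n x - u x)) \<longlonglongrightarrow> 0 \<and>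
     (\<lambda>n. Lp_norm p \<Omega> (\<lambda>x. grad (\<phi> n) x - weak_grad \<Omega> u x)) \<longlonglongrightarrow> 0}"

section \<open>The p-Laplacian: first eigenvalue, eigenfunctions, weak solutions\<close>

text \<open>Since \<open>0 powr a = 0\<close>, the flux is \<open>0\<close> at \<open>v = 0\<close> also for \<open>r < 2\<close>.\<close>

definition flux :: "real \<Rightarrow> 'a::euclidean_space \<Rightarrow> 'a" where
  "flux r v = norm v powr (r - 2) *\<^sub>R v"

definition lambda1 :: "real \<Rightarrow> 'a::euclidean_space set \<Rightarrow> real" where
  "lambda1 p \<Omega> = Inf {(\<integral>x. norm (weak_grad \<Omega> u x) powr p \<partial>lebesgue_on \<Omega>) /
                       (\<integral>x. \<bar>u x\<bar> powr p \<partial>lebesgue_on \<Omega>) | u.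
                      u \<in> W01p p \<Omega> \<and> \<not> (AE x in lebesgue_on \<Omega>. u x = 0)}"

text \<open>A nontrivial weak solution of the eigenvalue problem
  \<open>- \<Delta>\<^sub>p u = \<lambda> \<bar>u\<bar>\<^sup>p\<^sup>-\<^sup>2 u\<close> with zero boundary values.\<close>

definition p_eigenfunction ::
  "real \<Rightarrow> 'a::euclidean_space set \<Rightarrow> real \<Rightarrow> ('a \<Rightarrow> real) \<Rightarrow> bool" where
  "p_eigenfunction p \<Omega> lam u \<longleftrightarrow>
     u \<in> W01p p \<Omega> \<and> \<not> (AE x in lebesgue_on \<Omega>. u x = 0) \<and>
     (\<forall>\<psi>\<in>W01p p \<Omega>.
        (\<integral>x. flux p (weak_grad \<Omega> u x) \<bullet> weak_grad \<Omega> \<psi> x \<partial>lebesgue_on \<Omega>) =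
        lam * (\<integral>x. \<bar>u x\<bar> powr (p - 2) * u x * \<psi> x \<partial>lebesgue_on \<Omega>))"

text \<open>The function \<open>\<phi>\<^sub>p\<close>. Being in \<open>int_C10_plus \<Omega>\<close> includes positivity in \<open>\<Omega>\<close>; by the regularity
  theory for the p-Laplacian it only selects the sign and the continuously differentiable
  representative.\<close>

definition normalized_first_eigenfunction ::
  "real \<Rightarrow> 'a::euclidean_space set \<Rightarrow> ('a \<Rightarrow> real) \<Rightarrow> bool" where
  "normalized_first_eigenfunction p \<Omega> \<phi> \<longleftrightarrow>
     p_eigenfunction p \<Omega> (lambda1 p \<Omega>) \<phi> \<and> \<phi> \<in> int_C10_plus \<Omega> \<and> Lp_norm p \<Omega> (weak_grad \<Omega> \<phi>) = 1"

definition is_solution ::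
  "real \<Rightarrow> real \<Rightarrow> 'a::euclidean_space set \<Rightarrow> ('a \<Rightarrow> real \<Rightarrow> 'a \<Rightarrow> real) \<Rightarrow> ('a \<Rightarrow> real) \<Rightarrow> bool" where
  "is_solution p q \<Omega> f u \<longleftrightarrow> u \<in> W01p p \<Omega> \<and>
     (\<forall>\<psi>\<in>W01p p \<Omega>.
        integrable (lebesgue_on \<Omega>) (\<lambda>x. flux p (weak_grad \<Omega> u x) \<bullet> weak_grad \<Omega> \<psi> x) \<and>
        integrable (lebesgue_on \<Omega>) (\<lambda>x. flux q (weak_grad \<Omega> u x) \<bullet> weak_grad \<Omega> \<psi> x) \<and>
        integrable (lebesgue_on \<Omega>) (\<lambda>x. f x (u x) (weak_grad \<Omega> u x) * \<psi> x) \<and>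
        (\<integral>x. flux p (weak_grad \<Omega> u x) \<bullet> weak_grad \<Omega> \<psi> x \<partial>lebesgue_on \<Omega>) +
        (\<integral>x. flux q (weak_grad \<Omega> u x) \<bullet> weak_grad \<Omega> \<psi> x \<partial>lebesgue_on \<Omega>) =
        (\<integral>x. f x (u x) (weak_grad \<Omega> u x) * \<psi> x \<partial>lebesgue_on \<Omega>))"

definition I_set :: "real \<Rightarrow> real set" where
  "I_set q = {p. p > 1 \<and>
     (\<forall>s\<ge>0. (q - 1) * s powr p + q * s powr (p - 1) - (p - q) * s + (q - p + 1) \<ge> 0)}"

definition beta_star ::
  "real \<Rightarrow> 'a::euclidean_space set \<Rightarrow> ('a \<Rightarrow> real) \<Rightarrow> ('a \<Rightarrow> real) \<Rightarrow> real" where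
  "beta_star q \<Omega> \<phi> m =
     (\<integral>x. norm (weak_grad \<Omega> \<phi> x) powr q \<partial>lebesgue_on \<Omega>) /
     (\<integral>x. m x * \<phi> x powr q \<partial>lebesgue_on \<Omega>)"

end

theory Submission
  imports Defs
begin

text \<open>Write \<open>\<phi>\<close> for the first eigenfunction and suppose that \<open>u\<close> is a solution. Testing the
  equation for \<open>u\<close> with \<open>\<phi>\<^sup>q u\<^sup>1\<^sup>-\<^sup>q\<close>, the classical Picone inequality bounds the \<open>q\<close>-part by
  \<open>\<integral> \<bar>\<nabla>\<phi>\<bar>\<^sup>q\<close>. The generalized Picone inequality, whose pointwise form reduces to the definition of
  \<open>I_set q\<close>, bounds the \<open>p\<close>-part by the eigenvalue equation of \<open>\<phi>\<close> tested with \<open>\<phi>\<^sup>q\<^sup>-\<^sup>p\<^sup>+\<^sup>1 u\<^sup>p\<^sup>-\<^sup>q\<close>. The sum of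
  both bounds is strictly smaller than what the lower bound on the right-hand side requires.

  Both test functions are weighted geometric means of \<open>\<phi>\<close> and \<open>u\<close>, whose quotients are bounded
  because the normal derivatives on the boundary are negative. They belong to the Sobolev
  space without any mollification: \<open>e * (exp (A * reg_ln e \<phi> + (1 - A) * reg_ln e u) - 1)\<close> is a
  smooth function of \<open>(\<phi>, u)\<close> vanishing at \<open>(0, 0)\<close>, so it maps test functions approximating \<open>\<phi>\<close>
  and \<open>u\<close> to test functions.\<close>

section \<open>Calculus of gradients and smooth functions\<close>

text \<open>The exponents of the two test functions are forced by the zero-order terms. Multiplying
  u^(q-1) by \<phi>^q u^(1-q) leaves \<phi>^q, so the term with \<open>m\<close> becomes the
  integral in the denominator of \<open>beta_star\<close>. Multiplying u^(p-1) by the first test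
  function, or \<phi>^(p-1) by the second, gives the same function \<phi>^q u^(p-q), so the two
  eigenvalue terms cancel. Both Picone inequalities are used in their non-strict form: the
  contradiction comes from the strict lower bound on the right-hand side and the positive measure of
  \<Omega>.

  The obstacle is admissibility. The exponent 1 - q is negative, which makes the boundary behaviour
  of the quotients decisive, and membership in \<open>W01p\<close> demands actual test functions as
  approximants. Their values may be zero or negative, where a power or a logarithm is not smooth;
  \<open>reg_ln e\<close> replaces the logarithm by a function that is smooth on the whole line. The
  approximation for fixed e and the limit e \<rightarrow> 0 are then combined by a diagonal
  choice.\<close>

lemma GDERIV_imp_differentiable: "GDERIV f x :> D \<Longrightarrow> f differentiable (at x)"
  unfolding gderiv_def differentiable_def by blast

lemma frechet_derivative_GDERIV: "GDERIV f x :> D \<Longrightarrow> frechet_derivative f (at x) v = D \<bullet> v"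
  unfolding gderiv_def by (metis frechet_derivative_at inner_commute)

lemma GDERIV_unique:
  fixes f :: "'a::euclidean_space \<Rightarrow> real"
  assumes "GDERIV f x :> D" "GDERIV f x :> D'"
  shows "D = D'"
  by (metis assms frechet_derivative_GDERIV vector_eq_rdot)

lemma grad_eqI:
  fixes f :: "'a::euclidean_space \<Rightarrow> real"
  shows "GDERIV f x :> D \<Longrightarrow> grad f x = D"
  unfolding grad_def by (rule the_equality) (auto intro: GDERIV_unique)

lemma GDERIV_grad:
  fixes f :: "'a::euclidean_space \<Rightarrow> real"
  assumes "f differentiable (at x)"
  shows "GDERIV f x :> grad f x"
proof -
  let ?D = "\<Sum>i\<in>Basis. frechet_derivative f (at x) i *\<^sub>R i"
  have lin: "linear (frechet_derivative f (at x))"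
    using assms by (rule linear_frechet_derivative)
  have "frechet_derivative f (at x) = (\<lambda>h. h \<bullet> ?D)"
  proof
    fix h
    have "frechet_derivative f (at x) h = frechet_derivative f (at x) (\<Sum>i\<in>Basis. (h \<bullet> i) *\<^sub>R i)"
      by (simp add: euclidean_representation)
    also have "\<dots> = (\<Sum>i\<in>Basis. (h \<bullet> i) * frechet_derivative f (at x) i)"
      using lin by (simp add: linear_sum linear_cmul)
    also have "\<dots> = h \<bullet> ?D"
      by (simp add: inner_sum_right mult.commute)
    finally show "frechet_derivative f (at x) h = h \<bullet> ?D" .
  qed
  then have "GDERIV f x :> ?D"
    using assms unfolding gderiv_def by (simp add: frechet_derivative_works)
  then show ?thesis
    using grad_eqI by metis
qed

lemma inner_grad_eq_frechet:
  fixes f :: "'a::euclidean_space \<Rightarrow> real"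
  assumes "f differentiable (at x)"
  shows "frechet_derivative f (at x) v = grad f x \<bullet> v"
  by (rule frechet_derivative_GDERIV) (rule GDERIV_grad[OF assms])

lemma GDERIV_isCont: "GDERIV f x :> D \<Longrightarrow> isCont f x"
  by (simp add: GDERIV_imp_differentiable differentiable_imp_continuous_within)

section \<open>Closure of the smoothness classes under sums, products and compositions\<close>

lemma C_k_on_SucD: "C_k_on (Suc k) S f \<Longrightarrow> C_k_on k S f"
proof (induction k arbitrary: f)
  case 0
  then show ?case
    by (simp add: continuous_at_imp_continuous_on differentiable_imp_continuous_within)
next
  case (Suc k)
  from Suc.prems have "\<forall>x\<in>S. f differentiable (at x)"
    "\<forall>v. C_k_on k S (\<lambda>x. frechet_derivative f (at x) v)"
    unfolding C_k_on.simps(2)[of "Suc k"] using Suc.IH by blast+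
  then show ?case
    by simp
qed

lemma C_k_on_const: "C_k_on k S (\<lambda>x. c)"
  by (induction k arbitrary: c) auto

lemma C_k_on_add:
  assumes "C_k_on k UNIV f" "C_k_on k UNIV g"
  shows "C_k_on k UNIV (\<lambda>x. f x + g x)"
  using assms
proof (induction k arbitrary: f g)
  case 0
  then show ?case by (auto intro: continuous_intros)
next
  case (Suc k)
  then have d: "((\<lambda>x. f x + g x) has_derivative
      (\<lambda>v. frechet_derivative f (at x) v + frechet_derivative g (at x) v)) (at x)" for x
    by (auto simp: frechet_derivative_works intro!: has_derivative_add)
  have "frechet_derivative (\<lambda>x. f x + g x) (at x) v =
    frechet_derivative f (at x) v + frechet_derivative g (at x) v" for x v
    using frechet_derivative_at[OF d, symmetric] by simp
  with Suc d show ?case by (auto simp: differentiable_def)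
qed

lemma C_k_on_mult:
  fixes f g :: "'a::euclidean_space \<Rightarrow> real"
  assumes "C_k_on k UNIV f" "C_k_on k UNIV g"
  shows "C_k_on k UNIV (\<lambda>x. f x * g x)"
  using assms
proof (induction k arbitrary: f g)
  case 0
  then show ?case by (auto intro: continuous_intros)
next
  case (Suc k)
  then have d: "((\<lambda>x. f x * g x) has_derivative
      (\<lambda>v. f x * frechet_derivative g (at x) v + frechet_derivative f (at x) v * g x)) (at x)" for x
    by (auto simp: frechet_derivative_works intro!: has_derivative_mult)
  have "frechet_derivative (\<lambda>x. f x * g x) (at x) v =
    f x * frechet_derivative g (at x) v + frechet_derivative f (at x) v * g x" for x v
    using frechet_derivative_at[OF d, symmetric] by simp
  \<comment> \<open>The product rule keeps an undifferentiated factor in each summand, so the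
    induction hypothesis is also applied to \<open>f\<close> and \<open>g\<close> themselves, at
    order \<open>k\<close>.\<close>
  moreover have "C_k_on k UNIV f" "C_k_on k UNIV g"
    using Suc.prems by (blast intro: C_k_on_SucD)+
  ultimately show ?case
    using Suc d unfolding differentiable_def C_k_on.simps
    by (intro conjI ballI allI) (blast, simp add: C_k_on_add)
qed

text \<open>The chain rule replaces \<open>h\<close> by its derivative, again composed with
  \<open>f\<close>. The induction therefore runs over a whole family \<open>\<H>\<close> that is
  closed under differentiation on \<open>T\<close>, a set containing the range of
  \<open>f\<close>.\<close>

lemma C_k_on_compose:
  fixes f :: "'a::euclidean_space \<Rightarrow> real" and \<H> :: "(real \<Rightarrow> real) set"
  assumes deriv: "\<And>h. h \<in> \<H> \<Longrightarrow> \<exists>h'\<in>\<H>. \<forall>y\<in>T. (h has_real_derivative h' y) (at y)"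
    and "h \<in> \<H>" "\<And>x. f x \<in> T" "C_k_on k UNIV f"
  shows "C_k_on k UNIV (\<lambda>x. h (f x))"
  using assms(2,4)
proof (induction k arbitrary: h)
  case 0
  obtain h' where "\<forall>y\<in>T. (h has_real_derivative h' y) (at y)"
    using deriv 0(1) by blast
  then have "isCont h (f x)" for x
    using assms(3) DERIV_isCont by blast
  then show ?case
    using 0(2) by (auto simp: continuous_on_eq_continuous_at intro: isCont_o2)
next
  case (Suc k)
  obtain h' where h': "h' \<in> \<H>" "\<And>y. y \<in> T \<Longrightarrow> (h has_real_derivative h' y) (at y)"
    using deriv Suc.prems(1) by metis
  have d: "((\<lambda>x. h (f x)) has_derivative (\<lambda>v. h' (f x) * frechet_derivative f (at x) v)) (at x)" for x
    using Suc.prems(2) h'(2)[OF assms(3)]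
    by (auto simp: frechet_derivative_works has_field_derivative_def
        intro: has_derivative_compose[of f _ x UNIV h])
  then have "frechet_derivative (\<lambda>x. h (f x)) (at x) v = h' (f x) * frechet_derivative f (at x) v" for x v
    using frechet_derivative_at by metis
  then show ?case
    using Suc.IH[OF h'(1)] C_k_on_SucD[OF Suc.prems(2)] Suc.prems(2) d
    by (auto simp: differentiable_def intro!: C_k_on_mult)
qed

lemma smooth_on_const: "smooth_on S (\<lambda>x. c)"
  by (simp add: smooth_on_def C_k_on_const)

lemma smooth_on_add:
  "smooth_on UNIV f \<Longrightarrow> smooth_on UNIV g \<Longrightarrow> smooth_on UNIV (\<lambda>x. f x + g x)"
  by (simp add: smooth_on_def C_k_on_add)

lemma smooth_on_mult:
  "smooth_on UNIV f \<Longrightarrow> smooth_on UNIV g \<Longrightarrow> smooth_on UNIV (\<lambda>x. f x * g x)"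
  by (simp add: smooth_on_def C_k_on_mult)

lemma smooth_on_prod:
  "finite A \<Longrightarrow> (\<And>i. i \<in> A \<Longrightarrow> smooth_on UNIV (f i)) \<Longrightarrow> smooth_on UNIV (\<lambda>x. \<Prod>i\<in>A. f i x)"
  by (induction A rule: finite_induct) (simp_all add: smooth_on_const smooth_on_mult)

lemma smooth_on_compose:
  assumes "\<And>h. h \<in> \<H> \<Longrightarrow> \<exists>h'\<in>\<H>. \<forall>y\<in>T. (h has_real_derivative h' y) (at y)"
    and "h \<in> \<H>" "\<And>x. f x \<in> T" "smooth_on UNIV f"
  shows "smooth_on UNIV (\<lambda>x. h (f x))"
  using assms(4) unfolding smooth_on_def
  by (auto intro: C_k_on_compose[where h = h and T = T and \<H> = \<H>, OF assms(1-3)])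

lemma smooth_on_exp: "smooth_on UNIV f \<Longrightarrow> smooth_on UNIV (\<lambda>x. exp (f x))"
  by (rule smooth_on_compose[where h = exp and \<H> = "{exp}" and T = UNIV]) auto

lemma smooth_on_ln:
  assumes "\<And>x. f x > 0" "smooth_on UNIV f"
  shows "smooth_on UNIV (\<lambda>x. ln (f x))"
\<comment> \<open>The logarithm together with all functions c * y^(-k) is closed under
  differentiation on the positive half-line.\<close>
proof (rule smooth_on_compose[where h = ln and f = f and \<H> = "insert ln {h. \<exists>c k. h = (\<lambda>y. c * inverse y ^ k)}" and T = "{0<..}"])
  fix h :: "real \<Rightarrow> real"
  assume "h \<in> insert ln {h. \<exists>c k. h = (\<lambda>y. c * inverse y ^ k)}"
  then consider "h = ln" | c k where "h = (\<lambda>y. c * inverse y ^ k)" by blast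
  then show "\<exists>h'\<in>insert ln {h. \<exists>c k. h = (\<lambda>y. c * inverse y ^ k)}.
      \<forall>y\<in>{0<..}. (h has_real_derivative h' y) (at y)"
  proof cases
    case 1
    have "\<forall>y\<in>{0<..}. (h has_real_derivative (1 * inverse y ^ 1)) (at y)"
      using 1 by (auto intro!: derivative_eq_intros simp: field_simps)
    then show ?thesis
      by (intro bexI[of _ "\<lambda>y. 1 * inverse y ^ 1"]) blast+
  next
    case 2
    have "\<forall>y\<in>{0<..}. (h has_real_derivative ((- c * real k) * inverse y ^ Suc k)) (at y)"
    proof (cases k)
      case 0
      then show ?thesis using 2 by simp
    next
      case (Suc n)
      have "(h has_real_derivative c * (real k * (inverse y ^ n * - (inverse y * inverse y)))) (at y)"
        if "y > 0" for y
        unfolding 2 Suc using DERIV_cmult[OF DERIV_power_Suc[OF DERIV_inverse[of y], of n], of c] that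
        by (simp add: power2_eq_square algebra_simps)
      then show ?thesis
        by (simp add: Suc algebra_simps)
    qed
    then show ?thesis
      by (intro bexI[of _ "\<lambda>y. (- c * real k) * inverse y ^ Suc k"]) blast+
  qed
qed (use assms in auto)

lemma smooth_on_inner: "smooth_on UNIV (\<lambda>x. x \<bullet> i)"
proof -
  have "C_k_on k UNIV (\<lambda>x::'a. x \<bullet> i)" for k
  proof (cases k)
    case 0
    then show ?thesis by (auto intro!: continuous_intros)
  next
    case (Suc n)
    have d: "((\<lambda>x::'a. x \<bullet> i) has_derivative (\<lambda>v. v \<bullet> i)) (at x)" for x
      by (auto intro!: derivative_eq_intros)
    then have "frechet_derivative (\<lambda>x::'a. x \<bullet> i) (at x) = (\<lambda>v. v \<bullet> i)" for x
      using frechet_derivative_at by metis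
    then show ?thesis
      using Suc d by (auto simp: C_k_on_const differentiable_def)
  qed
  then show ?thesis
    by (simp add: smooth_on_def)
qed

lemma smooth_on_imp_differentiable: "smooth_on S f \<Longrightarrow> x \<in> S \<Longrightarrow> f differentiable (at x)"
  unfolding smooth_on_def by (metis C_k_on.simps(2))

lemma smooth_on_imp_continuous_frechet:
  "smooth_on S f \<Longrightarrow> continuous_on S (\<lambda>x. frechet_derivative f (at x) v)"
  unfolding smooth_on_def by (metis C_k_on.simps)

lemma smooth_on_continuous_grad:
  fixes f :: "'a::euclidean_space \<Rightarrow> real"
  assumes "smooth_on S f"
  shows "continuous_on S (grad f)"
proof -
  have "continuous_on S (\<lambda>x. \<Sum>i\<in>Basis. frechet_derivative f (at x) i *\<^sub>R i)"
    by (intro continuous_intros smooth_on_imp_continuous_frechet assms)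
  moreover have "grad f x = (\<Sum>i\<in>Basis. frechet_derivative f (at x) i *\<^sub>R i)" if "x \<in> S" for x
    using inner_grad_eq_frechet[OF smooth_on_imp_differentiable[OF assms that]]
    by (simp add: euclidean_representation)
  ultimately show ?thesis
    by (simp cong: continuous_on_cong)
qed

section \<open>Bump functions and uniqueness of weak gradients\<close>

text \<open>For P = 1 this is the standard smooth function that is flat at 0. The polynomial in 1/t
  makes the family closed under differentiation.\<close>

definition flat_exp :: "real poly \<Rightarrow> real \<Rightarrow> real" where
  "flat_exp P t = (if t > 0 then poly P (inverse t) * exp (- inverse t) else 0)"

text \<open>With x = 1/t this is the domination of every polynomial in x by exp x at
  infinity.\<close>

lemma flat_exp_right_limit: "(flat_exp P \<longlongrightarrow> 0) (at_right 0)"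
proof -
  have "((\<lambda>x. \<Sum>i\<le>degree P. coeff P i * (x ^ i / exp x)) \<longlongrightarrow> (\<Sum>i\<le>degree P. coeff P i * 0)) at_top"
    by (intro tendsto_intros tendsto_power_div_exp_0)
  then have "((\<lambda>x. poly P x * exp (- x)) \<longlongrightarrow> 0) at_top"
    by (simp add: poly_altdef sum_distrib_right exp_minus divide_inverse mult.assoc)
  then have "((\<lambda>t. poly P (inverse t) * exp (- inverse t)) \<longlongrightarrow> 0) (at_right (0::real))"
    using filterlim_inverse_at_top_right by (rule filterlim_compose)
  then show ?thesis
    by (rule Lim_transform_eventually) (auto simp: flat_exp_def eventually_at_filter)
qed

text \<open>For t > 0 the derivative of P(1/t) exp(-1/t) is (1/t)^2 (P - P')(1/t) exp(-1/t); the
  factor \<open>monom 1 2\<close> is the square of the variable, evaluated at 1/t.\<close>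

lemma flat_exp_has_derivative:
  "(flat_exp P has_real_derivative flat_exp (monom 1 2 * (P - pderiv P)) t) (at t)"
proof -
  consider "t > 0" | "t < 0" | "t = 0" by linarith
  then show ?thesis
  proof cases
    case 1
    have "((\<lambda>t. poly P (inverse t) * exp (- inverse t)) has_real_derivative
        flat_exp (monom 1 2 * (P - pderiv P)) t) (at t)"
      using 1 by (auto intro!: derivative_eq_intros DERIV_chain2[OF poly_DERIV]
          simp: flat_exp_def poly_monom power2_eq_square algebra_simps)
    then show ?thesis
      by (rule has_field_derivative_transform_within_open[where S = "{0<..}"])
        (use 1 in \<open>auto simp: flat_exp_def\<close>)
  next
    case 2
    have "((\<lambda>t. 0) has_real_derivative flat_exp (monom 1 2 * (P - pderiv P)) t) (at t)"
      using 2 by (simp add: flat_exp_def)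
    then show ?thesis
      by (rule has_field_derivative_transform_within_open[where S = "{..<0}"])
        (use 2 in \<open>auto simp: flat_exp_def\<close>)
  next
    case 3
    \<comment> \<open>Division by \<open>h\<close> multiplies the polynomial by its variable
      \<open>[:0, 1:]\<close>, so the one-sided limit of \<open>flat_exp\<close> applies to the
      quotient as well.\<close>
    have "((\<lambda>h. (flat_exp P (0 + h) - flat_exp P 0) / h) \<longlongrightarrow> 0) (at_right 0)"
      by (rule Lim_transform_eventually[OF flat_exp_right_limit[of "[:0, 1:] * P"]])
        (auto simp: flat_exp_def eventually_at_filter divide_inverse)
    moreover have "((\<lambda>h. (flat_exp P (0 + h) - flat_exp P 0) / h) \<longlongrightarrow> 0) (at_left 0)"
      by (rule Lim_transform_eventually[OF tendsto_const])
        (auto simp: flat_exp_def eventually_at_filter)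
    ultimately show ?thesis
      using 3 by (simp add: DERIV_def filterlim_split_at flat_exp_def)
  qed
qed

lemma smooth_on_flat_exp: "smooth_on UNIV f \<Longrightarrow> smooth_on UNIV (\<lambda>x. flat_exp P (f x))"
  by (rule smooth_on_compose[where h = "flat_exp P" and \<H> = "range flat_exp" and T = UNIV])
    (auto intro: flat_exp_has_derivative)

text \<open>A smooth approximation of the indicator of the open box: a factor is positive exactly
  where the corresponding face inequality is strict, and \<open>Suc n\<close> drives all factors to
  1 inside.\<close>

definition box_bump :: "'a::euclidean_space \<Rightarrow> 'a \<Rightarrow> nat \<Rightarrow> 'a \<Rightarrow> real" where
  "box_bump a b n x = (\<Prod>i\<in>Basis. flat_exp 1 (real (Suc n) * (x \<bullet> i - a \<bullet> i)) *
                                  flat_exp 1 (real (Suc n) * (b \<bullet> i - x \<bullet> i)))"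

lemma box_bump_eq_0: "x \<notin> box a b \<Longrightarrow> box_bump a b n x = 0"
  unfolding box_bump_def flat_exp_def mem_box
  by (auto simp: zero_less_mult_iff intro!: bexI)

lemma flat_exp_1_bounds: "0 \<le> flat_exp 1 t" "flat_exp 1 t \<le> 1"
  by (auto simp: flat_exp_def)

lemma box_bump_bounds: "0 \<le> box_bump a b n x" "box_bump a b n x \<le> 1"
  unfolding box_bump_def
  by (intro prod_nonneg prod_le_1 mult_nonneg_nonneg mult_le_one conjI flat_exp_1_bounds)+

lemma smooth_on_box_bump: "smooth_on UNIV (box_bump a b n)"
proof -
  have "smooth_on UNIV (\<lambda>x. flat_exp 1 (real (Suc n) * (x \<bullet> i + (- (a \<bullet> i)))) *
                            flat_exp 1 (real (Suc n) * (b \<bullet> i + (-1) * (x \<bullet> i))))" for i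
    by (intro smooth_on_mult smooth_on_flat_exp smooth_on_add smooth_on_const smooth_on_inner)
  then have "smooth_on UNIV (\<lambda>x. \<Prod>i\<in>Basis. flat_exp 1 (real (Suc n) * (x \<bullet> i + (- (a \<bullet> i)))) *
                            flat_exp 1 (real (Suc n) * (b \<bullet> i + (-1) * (x \<bullet> i))))"
    by (intro smooth_on_prod) auto
  then show ?thesis
    by (simp add: box_bump_def[abs_def])
qed

lemma box_bump_in_test_functions:
  assumes "cbox a b \<subseteq> \<Omega>"
  shows "box_bump a b n \<in> test_functions \<Omega>"
proof -
  have "{x. box_bump a b n x \<noteq> 0} \<subseteq> cbox a b"
    using box_bump_eq_0 box_subset_cbox by blast
  then have "closure {x. box_bump a b n x \<noteq> 0} \<subseteq> cbox a b"
    by (rule closure_minimal) (rule closed_cbox)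
  moreover from this have "compact (closure {x. box_bump a b n x \<noteq> 0})"
    by (meson bounded_cbox bounded_subset closed_closure compact_eq_bounded_closed)
  ultimately show ?thesis
    using assms smooth_on_box_bump by (auto simp: test_functions_def)
qed

lemma box_bump_tendsto: "(\<lambda>n. box_bump a b n x) \<longlonglongrightarrow> indicator (box a b) x"
proof (cases "x \<in> box a b")
  case True
  have lim: "(\<lambda>n. flat_exp 1 (real (Suc n) * c)) \<longlonglongrightarrow> 1" if "c > 0" for c
  proof -
    have "(\<lambda>n. exp (- (inverse (real (Suc n)) * inverse c))) \<longlonglongrightarrow> exp (- (0 * inverse c))"
      by (intro tendsto_intros LIMSEQ_inverse_real_of_nat)
    then show ?thesis
      using that by (simp add: flat_exp_def)
  qed
  have "(\<lambda>n. box_bump a b n x) \<longlonglongrightarrow> (\<Prod>i\<in>(Basis::'a set). 1 * 1)"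
    unfolding box_bump_def using True
    by (intro tendsto_prod tendsto_mult lim) (auto simp: mem_box)
  then show ?thesis
    using True by simp
qed (simp add: box_bump_eq_0)

section \<open>The fundamental lemma of the calculus of variations\<close>

lemma sigma_finite_lebesgue: "sigma_finite_measure (lebesgue :: 'a::euclidean_space measure)"
proof
  obtain A :: "'a set set" where "countable A" "A \<subseteq> sets lborel" "\<Union>A = space lborel"
    "\<forall>a\<in>A. emeasure lborel a \<noteq> \<infinity>"
    using lborel.sigma_finite_countable by blast
  then show "\<exists>A::'a set set. countable A \<and> A \<subseteq> sets lebesgue \<and> \<Union>A = space lebesgue \<and>
      (\<forall>a\<in>A. emeasure lebesgue a \<noteq> \<infinity>)"
    by (intro exI[of _ A]) (auto simp: subset_eq)
qed

text \<open>The sets over which \<open>f\<close> integrates to 0 form a Dynkin system, where the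
  hypothesis on the whole space settles complements. It contains the intersection-stable boxes,
  hence all Borel sets; Lebesgue sets differ from these by null sets only.\<close>

lemma AE_zero_if_box_integrals_zero:
  fixes f :: "'a::euclidean_space \<Rightarrow> 'b::euclidean_space"
  assumes f: "integrable lebesgue f"
    and zero: "\<And>a b. (LINT x:box a b|lebesgue. f x) = 0" "(LINT x|lebesgue. f x) = 0"
  shows "AE x in lebesgue. f x = 0"
proof -
  have si: "set_integrable lebesgue A f" if "A \<in> sets lebesgue" for A
    using that f unfolding set_integrable_def by (rule integrable_mult_indicator)
  have borel: "(LINT x:A|lebesgue. f x) = 0" if "A \<in> sets borel" for A
  proof -
    let ?G = "range (\<lambda>(a, b). box a b :: 'a set)"
    have sets: "sigma_sets UNIV ?G = sets borel"
      by (simp add: borel_eq_box)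
    have "Int_stable ?G"
      by (auto simp: Int_stable_def box_Int_box)
    moreover have "?G \<subseteq> Pow UNIV" by simp
    moreover have "A \<in> sigma_sets UNIV ?G"
      using that sets by simp
    ultimately show ?thesis
    proof (induct rule: sigma_sets_induct_disjoint)
      case (basic A)
      then show ?case using zero by auto
    next
      case empty
      show ?case by (simp add: set_lebesgue_integral_def)
    next
      case (compl A)
      then have A: "A \<in> sets lebesgue"
        using sets by (metis sets_completionI_sets sets_lborel)
      have "(LINT x:(UNIV - A) \<union> A|lebesgue. f x) =
          (LINT x:UNIV - A|lebesgue. f x) + (LINT x:A|lebesgue. f x)"
        using A by (intro set_integral_Un si) (use sets.compl_sets[OF A] in auto)
      then show ?case
        using compl zero(2) by (simp add: set_lebesgue_integral_def)
    next
      case (union A)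
      then have A: "A i \<in> sets lebesgue" for i
        using sets by (metis range_subsetD sets_completionI_sets sets_lborel)
      have "(LINT x:(\<Union>i. A i)|lebesgue. f x) = (\<Sum>i. (LINT x:(A i)|lebesgue. f x))"
        using A union(1) by (intro lebesgue_integral_countable_add si) (auto simp: disjoint_family_on_def)
      then show ?case
        using union by simp
    qed
  qed
  show ?thesis
  proof (rule sigma_finite_measure.density_zero[OF sigma_finite_lebesgue f])
    fix A :: "'a set"
    assume "A \<in> sets lebesgue"
    then obtain S N N' where A: "A = S \<union> N" "N \<subseteq> N'" "N' \<in> null_sets lborel" "S \<in> sets lborel"
      by (rule sets_completionE)
    have "AE x in lebesgue. x \<notin> N'"
      using A(3) by (intro AE_not_in) (simp add: null_sets_completionI)
    then have "AE x in lebesgue. indicator A x *\<^sub>R f x = indicator S x *\<^sub>R f x"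
      by eventually_elim (use A in \<open>auto simp: indicator_def\<close>)
    then have "(LINT x:A|lebesgue. f x) = (LINT x:S|lebesgue. f x)"
      unfolding set_lebesgue_integral_def
      using f \<open>A \<in> sets lebesgue\<close> A(4)
      by (intro integral_cong_AE borel_measurable_integrable integrable_mult_indicator) auto
    then show "(LINT x:A|lebesgue. f x) = 0"
      using borel A(4) by simp
  qed
qed

text \<open>By dominated convergence along \<open>box_bump\<close>, \<open>H\<close> integrates to 0
  over every open box whose closed box lies in \<Omega>. Cutting \<open>H\<close> off to one such
  box makes the previous lemma applicable, and countably many closed boxes, with negligible
  boundaries, cover \<Omega>.\<close>

lemma AE_zero_if_orthogonal_to_test_functions:
  fixes H :: "'a::euclidean_space \<Rightarrow> 'b::euclidean_space"
  assumes "open \<Omega>"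
    and H: "\<And>K. compact K \<Longrightarrow> K \<subseteq> \<Omega> \<Longrightarrow> integrable (lebesgue_on K) H"
    and orth: "\<And>\<phi>. \<phi> \<in> test_functions \<Omega> \<Longrightarrow> (LINT x|lebesgue_on \<Omega>. \<phi> x *\<^sub>R H x) = 0"
  shows "AE x in lebesgue_on \<Omega>. H x = 0"
proof -
  have \<Omega>: "\<Omega> \<in> sets lebesgue"
    using \<open>open \<Omega>\<close> by (simp add: borel_open)
  have int: "integrable lebesgue (\<lambda>x. indicator (cbox a b) x *\<^sub>R H x)" if "cbox a b \<subseteq> \<Omega>" for a b
    using H[OF _ that] by (simp add: integrable_restrict_space)
  have int': "integrable lebesgue (\<lambda>x. indicator (box a b) x *\<^sub>R H x)" if "cbox a b \<subseteq> \<Omega>" for a b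
  proof -
    have "integrable lebesgue (\<lambda>x. indicator (box a b) x *\<^sub>R indicator (cbox a b) x *\<^sub>R H x)"
      using int[OF that] by (rule integrable_mult_indicator[rotated]) simp
    moreover have "indicator (box a b) x *\<^sub>R indicator (cbox a b) x *\<^sub>R H x = indicator (box a b) x *\<^sub>R H x" for x
      using box_subset_cbox[of a b] by (auto simp: indicator_def)
    ultimately show ?thesis by (simp only:)
  qed
  have box: "(LINT x|lebesgue. indicator (box a b) x *\<^sub>R H x) = 0" if sub: "cbox a b \<subseteq> \<Omega>" for a b
  proof -
    let ?s = "\<lambda>n x. box_bump a b n x *\<^sub>R (indicator (cbox a b) x *\<^sub>R H x)"
    have cont: "continuous_on UNIV (box_bump a b n)" for n
      using smooth_on_box_bump[of a b n] unfolding smooth_on_def by (metis C_k_on.simps(1))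
    have meas: "box_bump a b n \<in> borel_measurable lebesgue" for n
      using borel_measurable_continuous_onI[OF cont] by (intro measurable_completion) simp
    have "(LINT x|lebesgue. ?s n x) = 0" for n
    proof -
      have "indicator \<Omega> x *\<^sub>R box_bump a b n x *\<^sub>R H x = ?s n x" for x
        using sub box_subset_cbox[of a b] box_bump_eq_0[of x a b n]
        by (auto simp: indicator_def)
      moreover have "(LINT x|lebesgue. indicator \<Omega> x *\<^sub>R box_bump a b n x *\<^sub>R H x) = 0"
        using orth[OF box_bump_in_test_functions[OF sub]] \<Omega>
        by (subst integral_restrict_space[symmetric]) auto
      ultimately show ?thesis by (simp only:)
    qed
    moreover have "(\<lambda>n. LINT x|lebesgue. ?s n x) \<longlonglongrightarrow>
        (LINT x|lebesgue. indicator (box a b) x *\<^sub>R (indicator (cbox a b) x *\<^sub>R H x))"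
    proof (rule integral_dominated_convergence)
      show "integrable lebesgue (\<lambda>x. norm (indicator (cbox a b) x *\<^sub>R H x))"
        using int[OF sub] by (rule integrable_norm)
      show "(\<lambda>x. indicator (box a b) x *\<^sub>R indicator (cbox a b) x *\<^sub>R H x) \<in> borel_measurable lebesgue"
        by (intro borel_measurable_integrable integrable_mult_indicator[OF _ int[OF sub]]) simp
      show "?s n \<in> borel_measurable lebesgue" for n
        by (rule borel_measurable_scaleR[OF meas borel_measurable_integrable[OF int[OF sub]]])
      show "AE x in lebesgue. (\<lambda>n. ?s n x) \<longlonglongrightarrow> indicator (box a b) x *\<^sub>R indicator (cbox a b) x *\<^sub>R H x"
        by (intro AE_I2 tendsto_scaleR box_bump_tendsto tendsto_const)
      show "AE x in lebesgue. norm (?s n x) \<le> norm (indicator (cbox a b) x *\<^sub>R H x)" for n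
        unfolding norm_scaleR[of "box_bump _ _ _ _"]
        by (intro AE_I2 mult_left_le_one_le) (auto simp: box_bump_bounds)
    qed
    moreover have "indicator (box a b) x *\<^sub>R indicator (cbox a b) x *\<^sub>R H x = indicator (box a b) x *\<^sub>R H x" for x
      using box_subset_cbox[of a b] by (auto simp: indicator_def)
    ultimately show ?thesis
      by (simp only: LIMSEQ_const_iff)
  qed
  have zero_box: "AE x in lebesgue. indicator (box c d) x *\<^sub>R H x = 0" if sub: "cbox c d \<subseteq> \<Omega>" for c d
  proof (rule AE_zero_if_box_integrals_zero)
    show "integrable lebesgue (\<lambda>x. indicator (box c d) x *\<^sub>R H x)"
      using int'[OF sub] .
    show "(LINT x|lebesgue. indicator (box c d) x *\<^sub>R H x) = 0"
      using box[OF sub] .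
    fix a b
    obtain e g where eg: "box a b \<inter> box c d = box e g"
      by (simp add: box_Int_box)
    show "(LINT x:box a b|lebesgue. indicator (box c d) x *\<^sub>R H x) = 0"
    \<comment> \<open>Only a nonempty open box has \<open>cbox e g\<close> as its closure, and this
      is how \<open>cbox e g\<close> is placed inside \<Omega> below.\<close>
    proof (cases "box e g = {}")
      case True
      have "indicator (box a b) x *\<^sub>R indicator (box c d) x *\<^sub>R H x = 0" for x
        using eg True by (auto simp: indicator_def)
      then show ?thesis
        by (simp only: set_lebesgue_integral_def integral_zero)
    next
      case False
      have "cbox e g \<subseteq> cbox c d"
        using eg False by (metis Int_lower2 closure_box closure_mono closure_subset box_subset_cbox closed_cbox closure_minimal subset_trans)
      moreover have "indicator (box a b) x *\<^sub>R indicator (box c d) x *\<^sub>R H x = indicator (box e g) x *\<^sub>R H x" for x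
        unfolding eg[symmetric] by (auto simp: indicator_def)
      moreover note box[of e g]
      ultimately show ?thesis
        using sub by (simp only: set_lebesgue_integral_def subset_trans)
    qed
  qed
  obtain D where D: "countable D" "D \<subseteq> Pow \<Omega>" "\<And>X. X \<in> D \<Longrightarrow> \<exists>a b. X = cbox a b" "\<Union>D = \<Omega>"
    using open_countable_Union_open_cbox[OF \<open>open \<Omega>\<close>] by metis
  have "AE x in lebesgue. \<forall>X\<in>D. x \<in> X \<longrightarrow> H x = 0"
  proof (subst AE_ball_countable[OF D(1)], intro ballI)
    fix X assume "X \<in> D"
    then obtain a b where X: "X = cbox a b" "cbox a b \<subseteq> \<Omega>"
      using D(2,3) by blast
    have "AE x in lebesgue. x \<notin> cbox a b - box a b"
      using negligible_frontier_interval[of a b] by (intro AE_not_in) (simp add: negligible_iff_null_sets)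
    with zero_box[OF X(2)] show "AE x in lebesgue. x \<in> X \<longrightarrow> H x = 0"
      by eventually_elim (auto simp: X(1) indicator_def)
  qed
  then have "AE x in lebesgue. x \<in> \<Omega> \<longrightarrow> H x = 0"
    by eventually_elim (use D(4) in blast)
  then show ?thesis
    using \<Omega> by (simp add: AE_restrict_space_iff)
qed

section \<open>Classical gradients are weak gradients\<close>

lemma finite_measure_lebesgue_on_open:
  fixes \<Omega> :: "'a::euclidean_space set"
  assumes "open \<Omega>" "bounded \<Omega>"
  shows "finite_measure (lebesgue_on \<Omega>)"
  using assms by (intro finite_measure_lebesgue_on lmeasurable_open)

lemma borel_measurable_lebesgue_on_continuous:
  fixes h :: "'a::euclidean_space \<Rightarrow> 'b::euclidean_space"
  assumes "open \<Omega>" "continuous_on \<Omega> h"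
  shows "h \<in> borel_measurable (lebesgue_on \<Omega>)"
  using assms by (intro continuous_imp_measurable_on_sets_lebesgue) (auto simp: borel_open)

lemma integrable_lebesgue_on_bounded:
  fixes h :: "'a::euclidean_space \<Rightarrow> 'b::euclidean_space"
  assumes "open \<Omega>" "bounded \<Omega>" "h \<in> borel_measurable (lebesgue_on \<Omega>)"
    and "\<And>x. x \<in> \<Omega> \<Longrightarrow> norm (h x) \<le> B"
  shows "integrable (lebesgue_on \<Omega>) h"
proof -
  interpret finite_measure "lebesgue_on \<Omega>"
    using assms by (intro finite_measure_lebesgue_on_open)
  show ?thesis
    using assms by (intro integrable_const_bound[where B = B]) auto
qed

lemma integrable_lebesgue_on_compact:
  fixes h :: "'a::euclidean_space \<Rightarrow> 'b::euclidean_space"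
  assumes "compact K" "continuous_on K h"
  shows "integrable (lebesgue_on K) h"
proof -
  interpret finite_measure "lebesgue_on K"
    using assms by (intro finite_measure_lebesgue_on lmeasurable_compact)
  obtain B where "\<And>x. x \<in> K \<Longrightarrow> norm (h x) \<le> B"
    using compact_imp_bounded[OF compact_continuous_image[OF assms(2,1)]]
    unfolding bounded_iff by auto
  then show ?thesis
    using assms
    by (intro integrable_const_bound[where B = B] continuous_imp_measurable_on_sets_lebesgue)
      (auto simp: lmeasurable_compact fmeasurableD)
qed

lemma integrable_lebesgue_on_mono:
  fixes h :: "'a::euclidean_space \<Rightarrow> 'b::euclidean_space"
  assumes "integrable (lebesgue_on K) h" "compact K" "K \<subseteq> \<Omega>" "open \<Omega>"
    and "\<And>x. x \<in> \<Omega> - K \<Longrightarrow> h x = 0"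
  shows "integrable (lebesgue_on \<Omega>) h"
proof -
  have "integrable lebesgue (\<lambda>x. if x \<in> K then h x else 0)"
    by (rule Lebesgue_Measure.integrable_restrict_UNIV[THEN iffD2])
      (use assms in \<open>auto simp: lmeasurable_compact fmeasurableD\<close>)
  moreover have "(\<lambda>x. if x \<in> K then h x else 0) = (\<lambda>x. if x \<in> \<Omega> then h x else 0)"
    using assms(3,5) by (intro ext) auto
  ultimately show ?thesis
    using \<open>open \<Omega>\<close> by (subst Lebesgue_Measure.integrable_restrict_UNIV[symmetric]) (auto simp: borel_open)
qed

lemma GDERIV_line:
  fixes w :: "'a::euclidean_space \<Rightarrow> real"
  assumes "GDERIV w (x + t *\<^sub>R v) :> D"
  shows "((\<lambda>t. w (x + t *\<^sub>R v)) has_real_derivative D \<bullet> v) (at t)"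
proof -
  have "((\<lambda>t. x + t *\<^sub>R v) has_derivative (\<lambda>t. t *\<^sub>R v)) (at t)"
    by (auto intro!: derivative_eq_intros)
  then have "((\<lambda>t. w (x + t *\<^sub>R v)) has_derivative (\<lambda>t. (t *\<^sub>R v) \<bullet> D)) (at t)"
    using assms unfolding gderiv_def by (rule has_derivative_compose)
  then show ?thesis
    by (simp add: has_field_derivative_def inner_commute mult.commute[of _ "D \<bullet> v"])
qed

lemma GDERIV_transform_within_open:
  assumes "GDERIV f x :> D" "open S" "x \<in> S" "\<And>y. y \<in> S \<Longrightarrow> f y = g y"
  shows "GDERIV g x :> D"
  using assms unfolding gderiv_def by (rule has_derivative_transform_within_open) auto

text \<open>By translation invariance the difference quotients have integral zero.\<close>

lemma integral_GDERIV_compact_support: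
  fixes w :: "'a::euclidean_space \<Rightarrow> real"
  assumes w: "\<And>x. GDERIV w x :> W x" and W: "continuous_on UNIV W"
    and K: "compact K" "\<And>x. x \<notin> K \<Longrightarrow> w x = 0"
  shows "(LINT x|lebesgue. W x) = 0"
proof -
  have W0: "W x = 0" if "x \<notin> K" for x
  proof -
    have "GDERIV w x :> 0"
      by (rule GDERIV_transform_within_open[of "\<lambda>x. 0" _ _ "- K"])
        (use that K in \<open>auto simp: GDERIV_const compact_imp_closed open_Compl\<close>)
    then show ?thesis
      using w GDERIV_unique by blast
  qed
  have "bounded (W ` K)"
    using K W by (intro compact_imp_bounded compact_continuous_image) (auto intro: continuous_on_subset)
  then obtain B where "\<And>x. x \<in> K \<Longrightarrow> norm (W x) \<le> B"
    unfolding bounded_iff by auto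
  then have "norm (W x) \<le> max B 0" for x
    using W0[of x] by (cases "x \<in> K") (auto simp: le_max_iff_disj)
  then obtain B where B: "\<And>x. norm (W x) \<le> B" "B \<ge> 0" by (metis max.cobounded2)
  obtain R where R: "\<And>x. x \<in> K \<Longrightarrow> norm x \<le> R"
    using compact_imp_bounded[OF K(1)] unfolding bounded_iff by auto
  have wc: "continuous_on UNIV w"
    using w GDERIV_isCont by (auto simp: continuous_on_eq_continuous_at)
  have w_int: "integrable lborel w"
  proof -
    have "integrable lborel (\<lambda>x. indicator K x *\<^sub>R w x)"
      by (rule borel_integrable_compact[OF K(1) continuous_on_subset[OF wc]]) simp
    moreover have "indicator K x *\<^sub>R w x = w x" for x
      using K(2) by (auto simp: indicator_def)
    ultimately show ?thesis by (simp only:)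
  qed
  have dir: "(LINT x|lborel. W x \<bullet> v) = 0" for v
  proof -
    define s where "s n x = (w (x + inverse (real (Suc n)) *\<^sub>R v) - w x) / inverse (real (Suc n))" for n x
    have shift: "integrable lborel (\<lambda>x. w (x + c))" "(LINT x|lborel. w (x + c)) = (LINT x|lborel. w x)" for c
    proof -
      have "integrable (distr lborel borel ((+) c)) w"
        using w_int by (simp add: lborel_distr_plus)
      then show "integrable lborel (\<lambda>x. w (x + c))"
        by (subst (asm) integrable_distr_eq) (use wc in \<open>auto simp: borel_measurable_continuous_onI add.commute\<close>)
      have "(LINT x|distr lborel borel ((+) c). w x) = (LINT x|lborel. w (c + x))"
        by (rule integral_distr) (use wc in \<open>auto simp: borel_measurable_continuous_onI\<close>)
      then show "(LINT x|lborel. w (x + c)) = (LINT x|lborel. w x)"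
        by (simp add: lborel_distr_plus add.commute)
    qed
    have "(LINT x|lborel. s n x) = 0" for n
      unfolding s_def using w_int shift by simp
    moreover have "(\<lambda>n. LINT x|lborel. s n x) \<longlonglongrightarrow> (LINT x|lborel. W x \<bullet> v)"
    proof (rule integral_dominated_convergence)
      \<comment> \<open>The step of the difference quotient is at most 1, so the quotient vanishes
        outside the ball of radius R + |v|. Inside, the mean value theorem bounds it by B
        |v|.\<close>
      show "integrable lborel (\<lambda>x. indicator (cball 0 (R + norm v)) x *\<^sub>R (B * norm v) :: real)"
        by (rule borel_integrable_compact) auto
      show "(\<lambda>x. W x \<bullet> v) \<in> borel_measurable lborel"
        using W by (auto intro!: borel_measurable_continuous_onI continuous_intros)
      show "s n \<in> borel_measurable lborel" for n
        unfolding s_def using w_int shift by (auto intro!: borel_measurable_divide borel_measurable_diff)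
      show "AE x in lborel. (\<lambda>n. s n x) \<longlonglongrightarrow> W x \<bullet> v"
      proof (rule AE_I2)
        fix x
        have "((\<lambda>t. w (x + t *\<^sub>R v)) has_real_derivative W x \<bullet> v) (at 0)"
          using w[of x] by (intro GDERIV_line) simp
        then have "((\<lambda>h. (w (x + h *\<^sub>R v) - w x) / h) \<longlongrightarrow> W x \<bullet> v) (at 0)"
          by (simp add: DERIV_def)
        moreover have "filterlim (\<lambda>n. inverse (real (Suc n))) (at 0) sequentially"
          using LIMSEQ_inverse_real_of_nat by (auto simp: filterlim_at)
        ultimately show "(\<lambda>n. s n x) \<longlonglongrightarrow> W x \<bullet> v"
          unfolding s_def by (rule filterlim_compose)
      qed
      show "AE x in lborel. norm (s n x) \<le> indicator (cball 0 (R + norm v)) x *\<^sub>R (B * norm v)" for n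
      proof (rule AE_I2)
        fix x
        define t where "t = inverse (real (Suc n))"
        have t: "0 < t" "t \<le> 1"
          by (auto simp: t_def field_simps)
        show "norm (s n x) \<le> indicator (cball 0 (R + norm v)) x *\<^sub>R (B * norm v)"
        proof (cases "x \<in> cball 0 (R + norm v)")
          case True
          obtain z where "w (x + t *\<^sub>R v) - w (x + 0 *\<^sub>R v) = (t - 0) * (W (x + z *\<^sub>R v) \<bullet> v)"
            using MVT2[OF t(1), of "\<lambda>t. w (x + t *\<^sub>R v)" "\<lambda>t. W (x + t *\<^sub>R v) \<bullet> v"] GDERIV_line[OF w]
            by blast
          then have "s n x = W (x + z *\<^sub>R v) \<bullet> v"
            using t unfolding s_def t_def[symmetric] by simp
          moreover have "\<bar>W (x + z *\<^sub>R v) \<bullet> v\<bar> \<le> B * norm v"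
            using Cauchy_Schwarz_ineq2[of "W (x + z *\<^sub>R v)" v] B(1)[of "x + z *\<^sub>R v"]
              mult_right_mono[of "norm (W (x + z *\<^sub>R v))" B "norm v"]
            by simp
          ultimately show ?thesis
            using True by simp
        next
          case False
          then have x: "norm x > R + norm v" by simp
          moreover have "norm (x + t *\<^sub>R v) \<ge> norm x - norm v"
          proof -
            have "norm (t *\<^sub>R v) \<le> norm v"
              using t by (simp add: mult_left_le_one_le)
            then show ?thesis
              using norm_diff_ineq[of x "t *\<^sub>R v"] by linarith
          qed
          ultimately have "x + t *\<^sub>R v \<notin> K" "x \<notin> K"
            using R[of "x + t *\<^sub>R v"] R[of x] norm_ge_zero[of v] by linarith+
          then have "s n x = 0"
            using K(2) by (simp add: s_def t_def)
          then show ?thesis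
            using False by simp
        qed
      qed
    qed
    ultimately show ?thesis
      by (simp add: LIMSEQ_const_iff)
  qed
  have "integrable lborel (\<lambda>x. indicator K x *\<^sub>R W x)"
    by (rule borel_integrable_compact[OF K(1) continuous_on_subset[OF W]]) simp
  moreover have "indicator K x *\<^sub>R W x = W x" for x
    using W0 by (auto simp: indicator_def)
  ultimately have "integrable lborel W"
    by (simp only:)
  \<comment> \<open>The integral vector itself is taken as the direction \<open>v\<close> in
    \<open>dir\<close>.\<close>
  then have "(LINT x|lborel. W x) \<bullet> (LINT x|lborel. W x) = 0"
    using dir by simp
  moreover have "(LINT x|lebesgue. W x) = (LINT x|lborel. W x)"
    using W by (intro integral_completion) (simp add: borel_measurable_continuous_onI)
  ultimately show ?thesis
    by simp
qed

lemma test_functionsD: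
  assumes "\<eta> \<in> test_functions \<Omega>"
  shows "smooth_on UNIV \<eta>" "compact (closure {x. \<eta> x \<noteq> 0})" "closure {x. \<eta> x \<noteq> 0} \<subseteq> \<Omega>"
    "GDERIV \<eta> x :> grad \<eta> x" "continuous_on S \<eta>" "continuous_on S (grad \<eta>)"
    "x \<notin> closure {x. \<eta> x \<noteq> 0} \<Longrightarrow> \<eta> x = 0" "x \<notin> closure {x. \<eta> x \<noteq> 0} \<Longrightarrow> grad \<eta> x = 0"
proof -
  show s: "smooth_on UNIV \<eta>" "compact (closure {x. \<eta> x \<noteq> 0})" "closure {x. \<eta> x \<noteq> 0} \<subseteq> \<Omega>"
    using assms by (auto simp: test_functions_def)
  show "continuous_on S (grad \<eta>)"
    using smooth_on_continuous_grad[OF s(1)] continuous_on_subset by blast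
  show g: "GDERIV \<eta> x :> grad \<eta> x" for x
    by (intro GDERIV_grad smooth_on_imp_differentiable[OF s(1)]) simp
  show "continuous_on S \<eta>"
    using g GDERIV_isCont by (blast intro: continuous_at_imp_continuous_on)
  show z: "\<eta> x = 0" if "x \<notin> closure {x. \<eta> x \<noteq> 0}" for x
    using that closure_subset[of "{x. \<eta> x \<noteq> 0}"] by blast
  show "grad \<eta> x = 0" if x: "x \<notin> closure {x. \<eta> x \<noteq> 0}"
  proof (rule grad_eqI, rule GDERIV_transform_within_open)
    show "GDERIV (\<lambda>x. 0) x :> 0"
      by (rule GDERIV_const)
    show "open (- closure {x. \<eta> x \<noteq> 0})" "x \<in> - closure {x. \<eta> x \<noteq> 0}"
      using x by auto
    show "0 = \<eta> y" if "y \<in> - closure {x. \<eta> x \<noteq> 0}" for y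
      using that z[of y] by simp
  qed
qed

text \<open>The product of \<open>\<psi>\<close> with a test function, extended by 0, is
  continuously differentiable on the whole space and has compact support. That its gradient
  integrates to 0 is the formula of integration by parts.\<close>

lemma has_weak_grad_classical:
  fixes \<psi> :: "'a::euclidean_space \<Rightarrow> real"
  assumes "open \<Omega>" and G: "\<And>x. x \<in> \<Omega> \<Longrightarrow> GDERIV \<psi> x :> G x" "continuous_on \<Omega> G"
  shows "has_weak_grad \<Omega> \<psi> G"
  unfolding has_weak_grad_def
proof (intro conjI allI impI ballI)
  have \<psi>c: "continuous_on \<Omega> \<psi>"
    using G(1) GDERIV_isCont by (blast intro: continuous_at_imp_continuous_on)
  show "integrable (lebesgue_on K) \<psi>" "integrable (lebesgue_on K) G" if "compact K \<and> K \<subseteq> \<Omega>" for K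
    using that G(2) \<psi>c by (auto intro!: integrable_lebesgue_on_compact intro: continuous_on_subset)
  fix \<eta> assume \<eta>: "\<eta> \<in> test_functions \<Omega>"
  define K where "K = closure {x. \<eta> x \<noteq> 0}"
  note t = test_functionsD[OF \<eta>, folded K_def]
  let ?w = "\<lambda>x. if x \<in> \<Omega> then \<psi> x * \<eta> x else 0"
  let ?h = "\<lambda>x. \<psi> x *\<^sub>R grad \<eta> x + \<eta> x *\<^sub>R G x"
  let ?W = "\<lambda>x. if x \<in> \<Omega> then ?h x else 0"
  have "closed K"
    by (simp add: K_def)
  have cov: "\<Omega> \<union> - K = UNIV"
    using t(3) by blast
  have "(LINT x|lebesgue. ?W x) = 0"
  proof (rule integral_GDERIV_compact_support[where w = ?w and K = K])
    show "GDERIV ?w x :> ?W x" for x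
    proof (cases "x \<in> \<Omega>")
      case True
      then have "GDERIV (\<lambda>x. \<psi> x * \<eta> x) x :> ?h x"
        by (intro GDERIV_mult G(1) t(4))
      then show ?thesis
        using True \<open>open \<Omega>\<close> by (auto intro: GDERIV_transform_within_open)
    next
      case False
      then have x: "x \<in> - K"
        using t(3) by blast
      have "GDERIV ?w x :> 0"
        by (rule GDERIV_transform_within_open[of "\<lambda>x. 0" _ _ "- K"])
          (use x \<open>closed K\<close> t(7) in \<open>auto simp: GDERIV_const\<close>)
      then show ?thesis
        using False by simp
    qed
    have "continuous_on \<Omega> ?h"
      using \<psi>c G(2) t(5,6) by (intro continuous_intros)
    then have "continuous_on \<Omega> ?W"
      by (subst continuous_on_cong[OF refl, where g = ?h]) auto
    moreover have "continuous_on (- K) ?W"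
      using t(7,8) by (subst continuous_on_cong[OF refl, where g = "\<lambda>x. 0"]) auto
    ultimately show "continuous_on UNIV ?W"
      using continuous_on_open_Un[of \<Omega> "- K" ?W] \<open>open \<Omega>\<close> \<open>closed K\<close> by (simp add: cov open_Compl)
    show "compact K" by (fact t(2))
    show "?w x = 0" if "x \<notin> K" for x
      using t(7) that by simp
  qed
  then have "(LINT x|lebesgue_on \<Omega>. ?h x) = 0"
    using \<open>open \<Omega>\<close> by (subst Lebesgue_Measure.integral_restrict_UNIV[symmetric]) (auto simp: borel_open)
  moreover have "integrable (lebesgue_on \<Omega>) (\<lambda>x. \<psi> x *\<^sub>R grad \<eta> x)"
    "integrable (lebesgue_on \<Omega>) (\<lambda>x. \<eta> x *\<^sub>R G x)"
    by (rule integrable_lebesgue_on_mono[OF integrable_lebesgue_on_compact[OF t(2)] t(2,3) \<open>open \<Omega>\<close>];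
        use t \<psi>c G(2) in \<open>auto intro!: continuous_intros intro: continuous_on_subset\<close>)+
  ultimately show "(LINT x|lebesgue_on \<Omega>. \<psi> x *\<^sub>R grad \<eta> x) = - (LINT x|lebesgue_on \<Omega>. \<eta> x *\<^sub>R G x)"
    by (simp add: eq_neg_iff_add_eq_0)
qed

text \<open>The difference of two weak gradients is orthogonal to all test functions. The work lies
  in splitting the integral of that difference: test functions are bounded with compact support, and
  weak gradients are integrable on compact sets.\<close>

lemma has_weak_grad_unique:
  fixes u :: "'a::euclidean_space \<Rightarrow> real"
  assumes "open \<Omega>" and G: "has_weak_grad \<Omega> u G" "has_weak_grad \<Omega> u G'"
  shows "AE x in lebesgue_on \<Omega>. G x = G' x"
proof -
  have "AE x in lebesgue_on \<Omega>. G x - G' x = 0"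
  proof (rule AE_zero_if_orthogonal_to_test_functions[OF \<open>open \<Omega>\<close>])
    show "integrable (lebesgue_on K) (\<lambda>x. G x - G' x)" if "compact K" "K \<subseteq> \<Omega>" for K
      using G that by (auto simp: has_weak_grad_def)
    fix \<eta> assume \<eta>: "\<eta> \<in> test_functions \<Omega>"
    define K where "K = closure {x. \<eta> x \<noteq> 0}"
    note t = test_functionsD[OF \<eta>, folded K_def]
    have "integrable (lebesgue_on \<Omega>) (\<lambda>x. \<eta> x *\<^sub>R F x)" if F: "has_weak_grad \<Omega> u F" for F
    proof (rule integrable_lebesgue_on_mono[of K])
      have FK: "integrable (lebesgue_on K) F"
        using F t by (auto simp: has_weak_grad_def)
      obtain B where B: "\<And>x. x \<in> K \<Longrightarrow> norm (\<eta> x) \<le> B"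
        using compact_imp_bounded[OF compact_continuous_image[OF t(5,2)]]
        unfolding bounded_iff by auto
      have \<eta>m: "\<eta> \<in> borel_measurable (lebesgue_on K)"
        using t by (intro continuous_imp_measurable_on_sets_lebesgue) (auto simp: lmeasurable_compact fmeasurableD)
      show "integrable (lebesgue_on K) (\<lambda>x. \<eta> x *\<^sub>R F x)"
      proof (rule Bochner_Integration.integrable_bound)
        show "integrable (lebesgue_on K) (\<lambda>x. B *\<^sub>R F x)"
          using FK by (intro integrable_scaleR_right)
        show "(\<lambda>x. \<eta> x *\<^sub>R F x) \<in> borel_measurable (lebesgue_on K)"
          by (rule borel_measurable_scaleR[OF \<eta>m borel_measurable_integrable[OF FK]])
        show "AE x in lebesgue_on K. norm (\<eta> x *\<^sub>R F x) \<le> norm (B *\<^sub>R F x)"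
        proof (rule AE_I2)
          fix x assume "x \<in> space (lebesgue_on K)"
          then have "norm (\<eta> x) \<le> \<bar>B\<bar>"
            using B[of x] by simp
          then show "norm (\<eta> x *\<^sub>R F x) \<le> norm (B *\<^sub>R F x)"
            by (simp add: mult_right_mono)
        qed
      qed
    qed (use t(2,3,7) \<open>open \<Omega>\<close> in auto)
    then have "(LINT x|lebesgue_on \<Omega>. \<eta> x *\<^sub>R (G x - G' x)) =
        (LINT x|lebesgue_on \<Omega>. \<eta> x *\<^sub>R G x) - (LINT x|lebesgue_on \<Omega>. \<eta> x *\<^sub>R G' x)"
      using G by (simp add: scaleR_diff_right)
    also have "\<dots> = 0"
      using G[unfolded has_weak_grad_def, THEN conjunct2, THEN bspec, OF \<eta>] by simp
    finally show "(LINT x|lebesgue_on \<Omega>. \<eta> x *\<^sub>R (G x - G' x)) = 0" .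
  qed
  then show ?thesis by simp
qed

text \<open>\<open>weak_grad\<close> is an unspecified choice. The classical gradient shows that
  there is something to choose, and uniqueness identifies the choice up to a null set.\<close>

lemma weak_grad_classical:
  fixes \<psi> :: "'a::euclidean_space \<Rightarrow> real"
  assumes "open \<Omega>" "\<And>x. x \<in> \<Omega> \<Longrightarrow> GDERIV \<psi> x :> G x" "continuous_on \<Omega> G"
  shows "has_weak_grad \<Omega> \<psi> (weak_grad \<Omega> \<psi>)" "AE x in lebesgue_on \<Omega>. weak_grad \<Omega> \<psi> x = G x"
proof -
  have G: "has_weak_grad \<Omega> \<psi> G"
    using assms by (rule has_weak_grad_classical)
  then show w: "has_weak_grad \<Omega> \<psi> (weak_grad \<Omega> \<psi>)"
    unfolding weak_grad_def using someI[of "has_weak_grad \<Omega> \<psi>"] by blast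
  show "AE x in lebesgue_on \<Omega>. weak_grad \<Omega> \<psi> x = G x"
    using has_weak_grad_unique[OF \<open>open \<Omega>\<close> w G] .
qed

section \<open>Comparison of functions in the interior of the positive cone\<close>

text \<open>From a point x of \<Omega> near x0, the line in direction \<nu> reaches the boundary
  after some distance s. Both functions vanish there, so the mean value theorem on this segment
  gives u x \<ge> s * c and v x \<le> s * max L 0. The unknown s cancels in the comparison.\<close>

lemma boundary_ratio_bounded:
  fixes \<Omega> :: "'a::euclidean_space set"
  assumes \<Omega>: "open \<Omega>" and x0: "x0 \<in> frontier \<Omega>"
    and g: "local_defining_function \<Omega> x0 U g"
    and u: "C1_closure_grad \<Omega> u Gu" "\<And>x. x \<in> frontier \<Omega> \<Longrightarrow> u x = 0"
    and v: "C1_closure_grad \<Omega> v Gv" "\<And>x. x \<in> frontier \<Omega> \<Longrightarrow> v x = 0"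
      "\<And>x. x \<in> closure \<Omega> \<Longrightarrow> norm (Gv x) \<le> L"
    and neg: "Gu x0 \<bullet> sgn (grad g x0) < 0"
  shows "\<exists>e>0. \<exists>C. \<forall>x\<in>\<Omega> \<inter> ball x0 e. v x \<le> C * u x"
proof -
  define \<nu> where "\<nu> = sgn (grad g x0)"
  \<comment> \<open>Both constants are half of the corresponding value at x0, so that strict bounds
    persist in a neighbourhood of x0.\<close>
  define c where "c = - (Gu x0 \<bullet> \<nu>) / 2"
  define a where "a = norm (grad g x0) / 2"
  have U: "open U" "x0 \<in> U" "smooth_on U g" "grad g x0 \<noteq> 0" and \<Omega>U: "\<Omega> \<inter> U = {y \<in> U. g y < 0}"
    using g by (auto simp: local_defining_function_def)
  have neg_g: "g y < 0" if "y \<in> \<Omega>" "y \<in> U" for y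
    using \<Omega>U that by blast
  have cl: "x0 \<in> closure \<Omega>" "x0 \<notin> \<Omega>"
    using x0 \<Omega> by (auto simp: frontier_def interior_open)
  have \<nu>: "norm \<nu> = 1" and c: "c > 0" and a: "a > 0"
    using U(4) neg by (auto simp: \<nu>_def norm_sgn c_def a_def)
  have "grad g x0 \<bullet> \<nu> = 2 * a"
    by (simp add: \<nu>_def a_def sgn_div_norm norm_eq_sqrt_inner)
      (metis inner_ge_zero real_div_sqrt divide_inverse mult.commute)
  then have "grad g x0 \<bullet> \<nu> > a"
    using a by simp
  have dg: "GDERIV g y :> grad g y" if "y \<in> U" for y
    by (intro GDERIV_grad smooth_on_imp_differentiable[OF U(3)] that)
  have "continuous_on U (\<lambda>y. grad g y \<bullet> \<nu>)"
    by (intro continuous_intros smooth_on_continuous_grad U)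
  then have "\<forall>\<^sub>F y in at x0 within U. grad g y \<bullet> \<nu> > a"
    using U(2) \<open>grad g x0 \<bullet> \<nu> > a\<close>
    by (auto simp: continuous_on_def intro: order_tendstoD)
  then obtain r0 where r0: "r0 > 0" "\<And>y. y \<in> U \<Longrightarrow> y \<noteq> x0 \<Longrightarrow> dist y x0 < r0 \<Longrightarrow> grad g y \<bullet> \<nu> > a"
    by (auto simp: eventually_at)
  obtain r1 where r1: "r1 > 0" "ball x0 r1 \<subseteq> U"
    using U by (meson open_contains_ball)
  have "continuous_on (closure \<Omega>) (\<lambda>y. Gu y \<bullet> \<nu>)"
    using u(1) unfolding C1_closure_grad_def by (auto intro: continuous_intros)
  moreover have "Gu x0 \<bullet> \<nu> < - c"
    using c by (simp add: c_def)
  ultimately have "\<forall>\<^sub>F y in at x0 within closure \<Omega>. Gu y \<bullet> \<nu> < - c"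
    using cl by (auto simp: continuous_on_def intro: order_tendstoD)
  then obtain r2 where r2: "r2 > 0"
      "\<And>y. y \<in> closure \<Omega> \<Longrightarrow> y \<noteq> x0 \<Longrightarrow> dist y x0 < r2 \<Longrightarrow> Gu y \<bullet> \<nu> < - c"
    by (auto simp: eventually_at)
  define r where "r = min r0 (min r1 r2)"
  define T where "T = r / 2"
  have r: "r > 0" "T > 0"
    using r0 r1 r2 by (auto simp: r_def T_def)
  have rU: "y \<in> U" if "dist y x0 < r" for y
    using r1 that by (auto simp: r_def dist_commute)
  have rg: "grad g y \<bullet> \<nu> > a" if "dist y x0 < r" for y
    using r0(2)[OF rU[OF that]] that \<open>grad g x0 \<bullet> \<nu> > a\<close> by (cases "y = x0") (auto simp: r_def)
  have ru: "Gu y \<bullet> \<nu> < - c" if "y \<in> closure \<Omega>" "dist y x0 < r" for y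
    using r2(2)[OF that(1)] that \<open>Gu x0 \<bullet> \<nu> < - c\<close> by (cases "y = x0") (auto simp: r_def)
  \<comment> \<open>The slope of \<open>g\<close> along \<nu> exceeds a, so over the length T the
    function gains more than a * T. If it starts above - (a * T), it becomes positive on the way;
    this dictates how close to x0 the point x must be.\<close>
  have "g x0 \<ge> 0"
    using cl(2) U(2) \<Omega>U by force
  then have "g x0 > - (a * T)"
    using mult_pos_pos[OF a r(2)] by linarith
  moreover have "isCont g x0"
    using dg[OF U(2)] by (rule GDERIV_isCont)
  ultimately have "\<forall>\<^sub>F y in at x0. g y > - (a * T)"
    by (auto simp: isCont_def intro: order_tendstoD)
  then obtain \<delta> where \<delta>: "\<delta> > 0" "\<And>y. y \<noteq> x0 \<Longrightarrow> dist y x0 < \<delta> \<Longrightarrow> g y > - (a * T)"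
    by (auto simp: eventually_at)
  \<comment> \<open>A point within T of x0 that moves by at most T stays in the ball of radius r = 2
    * T, where the derivative bounds hold.\<close>
  define e where "e = min \<delta> T"
  have "v x \<le> (max L 0 / c) * u x" if x: "x \<in> \<Omega>" "dist x x0 < e" for x
  proof -
    have near: "dist (x + t *\<^sub>R \<nu>) x0 < r" if "0 \<le> t" "t \<le> T" for t
    proof -
      have "dist (x + t *\<^sub>R \<nu>) x0 \<le> dist (x + t *\<^sub>R \<nu>) x + dist x x0"
        by (rule dist_triangle)
      also have "\<dots> < T + T"
        using that x(2) \<nu> by (simp add: dist_norm e_def)
      finally show ?thesis by (simp add: T_def)
    qed
    have dh: "((\<lambda>t. g (x + t *\<^sub>R \<nu>)) has_real_derivative grad g (x + t *\<^sub>R \<nu>) \<bullet> \<nu>) (at t)"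
      if "0 \<le> t" "t \<le> T" for t
      by (intro GDERIV_line dg rU near that)
    have "x \<noteq> x0"
      using x(1) cl(2) by blast
    then have "g x > - (a * T)"
      using \<delta>(2)[of x] x(2) by (simp add: e_def)
    moreover obtain z where z: "0 < z" "z < T"
        "g (x + T *\<^sub>R \<nu>) - g (x + 0 *\<^sub>R \<nu>) = (T - 0) * (grad g (x + z *\<^sub>R \<nu>) \<bullet> \<nu>)"
      using MVT2[OF r(2), of "\<lambda>t. g (x + t *\<^sub>R \<nu>)" "\<lambda>t. grad g (x + t *\<^sub>R \<nu>) \<bullet> \<nu>"] dh by blast
    moreover have "a * T < (grad g (x + z *\<^sub>R \<nu>) \<bullet> \<nu>) * T"
      using z by (intro mult_strict_right_mono rg near r) auto
    moreover have "g (x + T *\<^sub>R \<nu>) = g x + (grad g (x + z *\<^sub>R \<nu>) \<bullet> \<nu>) * T"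
      using z(3) by (simp add: mult.commute)
    ultimately have "g (x + T *\<^sub>R \<nu>) > 0"
      by linarith
    moreover have "g x < 0"
      using x(1) \<Omega>U rU[of x] near[of 0] r(2) by auto
    moreover have "isCont (\<lambda>t. g (x + t *\<^sub>R \<nu>)) t" if "0 \<le> t" "t \<le> T" for t
      using dh[OF that] by (rule DERIV_isCont)
    ultimately obtain s where s: "0 \<le> s" "s \<le> T" "g (x + s *\<^sub>R \<nu>) = 0"
      using IVT[of "\<lambda>t. g (x + t *\<^sub>R \<nu>)" 0 0 T] r(2) by auto
    with \<open>g x < 0\<close> have "s > 0"
      by (cases "s = 0") auto
    \<comment> \<open>\<open>g\<close> increases strictly along the segment and vanishes at its end,
      so it is negative before.\<close>
    have inside: "x + t *\<^sub>R \<nu> \<in> \<Omega>" if t: "0 \<le> t" "t < s" for t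
    proof -
      have "g (x + t *\<^sub>R \<nu>) < g (x + s *\<^sub>R \<nu>)"
      proof (rule DERIV_pos_imp_increasing[OF t(2), of "\<lambda>t. g (x + t *\<^sub>R \<nu>)"])
        fix y assume "t \<le> y" "y \<le> s"
        then have y: "0 \<le> y" "y \<le> T"
          using t s by auto
        show "\<exists>d. ((\<lambda>t. g (x + t *\<^sub>R \<nu>)) has_real_derivative d) (at y) \<and> 0 < d"
          using dh[OF y] rg[OF near[OF y]] a by (meson less_trans)
      qed
      then show ?thesis
        using s \<Omega>U rU[OF near[of t]] t by auto
    qed
    have "(\<lambda>t. x + t *\<^sub>R \<nu>) ` closure {0..<s} \<subseteq> closure \<Omega>"
      using inside by (intro image_closure_subset) (auto intro!: continuous_intros closure_subset[THEN subsetD])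
    then have line: "(\<lambda>t. x + t *\<^sub>R \<nu>) ` {0..s} \<subseteq> closure \<Omega>"
      using \<open>s > 0\<close> by simp
    have lineD: "x + t *\<^sub>R \<nu> \<in> closure \<Omega>" if "0 \<le> t" "t \<le> s" for t
      using subsetD[OF line imageI[of t "{0..s}"]] that by simp
    have "x + s *\<^sub>R \<nu> \<notin> \<Omega>"
      using s(3) neg_g[OF _ rU[OF near[OF s(1,2)]]] by auto
    then have fr: "x + s *\<^sub>R \<nu> \<in> frontier \<Omega>"
      using lineD[of s] \<open>s > 0\<close> \<Omega> by (simp add: frontier_def interior_open)
    \<comment> \<open>The exit point lies on the boundary, where \<open>w\<close> is only known to
      be continuous from within the closure; the mean value theorem asks for no more at an
      endpoint.\<close>
    have mv: "\<exists>z. 0 < z \<and> z < s \<and> w x = - (s * (Gw (x + z *\<^sub>R \<nu>) \<bullet> \<nu>))"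
      if w: "C1_closure_grad \<Omega> w Gw" "w (x + s *\<^sub>R \<nu>) = 0" for w Gw
    proof -
      have "continuous_on (closure \<Omega>) w"
        using w(1) by (simp add: C1_closure_grad_def)
      moreover have "continuous_on {0..s} (\<lambda>t. x + t *\<^sub>R \<nu>)"
        by (intro continuous_intros)
      ultimately have "continuous_on {0..s} (\<lambda>t. w (x + t *\<^sub>R \<nu>))"
        using line by (rule continuous_on_compose2)
      moreover have "((\<lambda>t. w (x + t *\<^sub>R \<nu>)) has_derivative (*) (Gw (x + t *\<^sub>R \<nu>) \<bullet> \<nu>)) (at t)"
        if "0 < t" "t < s" for t
        using GDERIV_line[of w x t \<nu>] w(1) inside[of t] that
        unfolding C1_closure_grad_def has_field_derivative_def by auto
      ultimately obtain z where "0 < z" "z < s"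
        "w (x + s *\<^sub>R \<nu>) - w (x + 0 *\<^sub>R \<nu>) = (Gw (x + z *\<^sub>R \<nu>) \<bullet> \<nu>) * (s - 0)"
        using mvt[OF \<open>s > 0\<close>, of "\<lambda>t. w (x + t *\<^sub>R \<nu>)" "\<lambda>t. (*) (Gw (x + t *\<^sub>R \<nu>) \<bullet> \<nu>)"] by auto
      then show ?thesis
        using w(2) by (intro exI[of _ z]) (simp add: mult.commute)
    qed
    obtain z where z: "0 < z" "z < s" "u x = - (s * (Gu (x + z *\<^sub>R \<nu>) \<bullet> \<nu>))"
      using mv[OF u(1) u(2)[OF fr]] by blast
    have "Gu (x + z *\<^sub>R \<nu>) \<bullet> \<nu> < - c"
      using z s by (intro ru near lineD) auto
    then have "s * c \<le> s * (- (Gu (x + z *\<^sub>R \<nu>) \<bullet> \<nu>))"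
      using \<open>s > 0\<close> by (intro mult_left_mono) auto
    then have ux: "u x \<ge> s * c"
      using z(3) by simp
    obtain z' where z': "0 < z'" "z' < s" "v x = - (s * (Gv (x + z' *\<^sub>R \<nu>) \<bullet> \<nu>))"
      using mv[OF v(1) v(2)[OF fr]] by blast
    have "- (Gv (x + z' *\<^sub>R \<nu>) \<bullet> \<nu>) \<le> norm (Gv (x + z' *\<^sub>R \<nu>)) * norm \<nu>"
      using Cauchy_Schwarz_ineq2[of "Gv (x + z' *\<^sub>R \<nu>)" \<nu>] by linarith
    also have "\<dots> \<le> max L 0"
      using v(3)[OF lineD[of z']] z' \<nu> by (simp add: le_max_iff_disj)
    finally have "s * (- (Gv (x + z' *\<^sub>R \<nu>) \<bullet> \<nu>)) \<le> s * max L 0"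
      using \<open>s > 0\<close> by (intro mult_left_mono) auto
    then have "v x \<le> s * max L 0"
      using z'(3) by simp
    also have "\<dots> = (max L 0 / c) * (s * c)"
      using c by simp
    also have "\<dots> \<le> (max L 0 / c) * u x"
      using ux c by (intro mult_left_mono) auto
    finally show ?thesis .
  qed
  moreover have "e > 0"
    using \<delta> r by (simp add: e_def)
  ultimately show ?thesis
    by (intro exI[of _ e] conjI exI[of _ "max L 0 / c"]) (auto simp: dist_commute)
qed

lemma C1_closure_grad_bounded:
  assumes "bounded \<Omega>" "C1_closure_grad \<Omega> v G"
  obtains K where "K > 0" "\<And>x. x \<in> closure \<Omega> \<Longrightarrow> \<bar>v x\<bar> \<le> K" "\<And>x. x \<in> closure \<Omega> \<Longrightarrow> norm (G x) \<le> K"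
proof -
  have "compact (closure \<Omega>)"
    using assms(1) by (simp add: compact_closure)
  then have "bounded (v ` closure \<Omega>)" "bounded (G ` closure \<Omega>)"
    using assms(2) unfolding C1_closure_grad_def
    by (auto intro!: compact_imp_bounded compact_continuous_image)
  then obtain A B where "\<And>x. x \<in> closure \<Omega> \<Longrightarrow> \<bar>v x\<bar> \<le> A" "\<And>x. x \<in> closure \<Omega> \<Longrightarrow> norm (G x) \<le> B"
    unfolding bounded_iff by auto
  then show ?thesis
    by (intro that[of "max 1 (max A B)"]) (auto simp: le_max_iff_disj)
qed

text \<open>Each point of the closure has a neighbourhood with its own constant: inside \<Omega> by
  continuity and positivity, at the boundary by the previous lemma. Compactness leaves finitely many
  constants.\<close>

lemma int_C10_plus_ratio_bounded:
  fixes \<Omega> :: "'a::euclidean_space set"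
  assumes \<Omega>: "smooth_bounded_domain \<Omega>" and u: "u \<in> int_C10_plus \<Omega>" and v: "v \<in> int_C10_plus \<Omega>"
  obtains C where "C \<ge> 1" "\<And>x. x \<in> \<Omega> \<Longrightarrow> v x \<le> C * u x"
proof -
  have o: "open \<Omega>" "bounded \<Omega>"
    and ld: "\<And>x. x \<in> frontier \<Omega> \<Longrightarrow> \<exists>U g. local_defining_function \<Omega> x U g"
    using \<Omega> by (auto simp: smooth_bounded_domain_def)
  have pos: "\<And>x. x \<in> \<Omega> \<Longrightarrow> u x > 0"
    and u0: "\<And>x. x \<in> frontier \<Omega> \<Longrightarrow> u x = 0" and v0: "\<And>x. x \<in> frontier \<Omega> \<Longrightarrow> v x = 0"
    using u v by (auto simp: int_C10_plus_def C10_def)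
  obtain Gu Gv where Gu: "C1_closure_grad \<Omega> u Gu" and Gv: "C1_closure_grad \<Omega> v Gv"
    using u v by (auto simp: int_C10_plus_def C10_def)
  obtain L where L: "\<And>x. x \<in> closure \<Omega> \<Longrightarrow> norm (Gv x) \<le> L"
    using C1_closure_grad_bounded[OF o(2) Gv] by metis
  have loc: "\<exists>e>0. \<exists>C. \<forall>x\<in>\<Omega> \<inter> ball x0 e. v x \<le> C * u x" if x0: "x0 \<in> closure \<Omega>" for x0
  proof (cases "x0 \<in> \<Omega>")
    case True
    \<comment> \<open>The summand 1 makes C * u x0 > v x0 strict, so the inequality survives near
      x0.\<close>
    define C where "C = (\<bar>v x0\<bar> + 1) / u x0"
    have "isCont u x0" "isCont v x0"
      using Gu Gv True GDERIV_isCont unfolding C1_closure_grad_def by blast+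
    then have "((\<lambda>x. C * u x - v x) \<longlongrightarrow> C * u x0 - v x0) (at x0)"
      by (auto simp: isCont_def intro!: tendsto_intros)
    moreover have pos0: "C * u x0 - v x0 > 0"
      using pos[OF True] by (simp add: C_def)
    ultimately have "\<forall>\<^sub>F x in at x0. C * u x - v x > 0"
      by (rule order_tendstoD)
    then obtain d where "d > 0" "\<And>x. x \<noteq> x0 \<Longrightarrow> dist x x0 < d \<Longrightarrow> C * u x - v x > 0"
      by (auto simp: eventually_at)
    then show ?thesis
      using pos0 by (intro exI[of _ d] conjI exI[of _ C]) (force simp: dist_commute)+
  next
    case False
    then have fr: "x0 \<in> frontier \<Omega>"
      using x0 o by (simp add: frontier_def interior_open)
    then obtain U g where g: "local_defining_function \<Omega> x0 U g"
      using ld by blast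
    then have "exterior_unit_normal \<Omega> x0 (sgn (grad g x0))"
      by (auto simp: exterior_unit_normal_def)
    then have "Gu x0 \<bullet> sgn (grad g x0) < 0"
      using u Gu fr by (auto simp: int_C10_plus_def)
    then show ?thesis
      using boundary_ratio_bounded[OF o(1) fr g Gu u0 Gv v0 L] by blast
  qed
  then obtain e C where eC: "\<And>x. x \<in> closure \<Omega> \<Longrightarrow> e x > 0"
    "\<And>x0 x. x0 \<in> closure \<Omega> \<Longrightarrow> x \<in> \<Omega> \<inter> ball x0 (e x0) \<Longrightarrow> v x \<le> C x0 * u x"
    by metis
  have cpt: "compact (closure \<Omega>)"
    using o by (simp add: compact_closure)
  have cov: "closure \<Omega> \<subseteq> (\<Union>x\<in>closure \<Omega>. ball x (e x))"
    using eC(1) by force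
  obtain D where D: "D \<subseteq> closure \<Omega>" "finite D" "closure \<Omega> \<subseteq> (\<Union>x\<in>D. ball x (e x))"
    by (rule compactE_image[OF cpt open_ball cov])
  \<comment> \<open>The sum dominates each local constant, whatever its sign, and the summand 1
    gives the lower bound \<open>C \<ge> 1\<close> that later makes ln C nonnegative.\<close>
  define C' where "C' = 1 + (\<Sum>x\<in>D. \<bar>C x\<bar>)"
  have "v x \<le> C' * u x" if x: "x \<in> \<Omega>" for x
  proof -
    obtain d where d: "d \<in> D" "x \<in> ball d (e d)"
      using x D(3) closure_subset[of \<Omega>] by blast
    have "C d \<le> C'"
      using member_le_sum[OF d(1), of "\<lambda>x. \<bar>C x\<bar>"] D(2) by (simp add: C'_def)
    then have "C d * u x \<le> C' * u x"
      using pos[OF x] by (intro mult_right_mono) auto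
    then show ?thesis
      using eC(2)[of d x] D(1) d x by (auto simp: subset_iff)
  qed
  moreover have "C' \<ge> 1"
    by (simp add: C'_def sum_nonneg)
  ultimately show ?thesis
    using that by blast
qed

section \<open>Pointwise Picone inequalities\<close>

text \<open>This is exp y \<ge> 1 + y for y = (a - b) ln s, the factor by which
  \<open>s powr a\<close> and \<open>s powr b\<close> differ being exp y.\<close>

lemma powr_tangent:
  fixes s :: real
  assumes "s > 0"
  shows "s powr a \<ge> s powr b * (1 + (a - b) * ln s)"
proof -
  have "s powr a = s powr b * exp ((a - b) * ln s)"
    using assms by (simp add: powr_def exp_add[symmetric] algebra_simps)
  then show ?thesis
    using exp_ge_add_one_self[of "(a - b) * ln s"] assms by simp
qed

lemma I_setD:
  assumes "p \<in> I_set q" "s \<ge> 0"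
  shows "(q - 1) * s powr p + q * s powr (p - 1) - (p - q) * s + (q - p + 1) \<ge> 0"
  using assms unfolding I_set_def by blast

text \<open>At s = 0 the powers vanish, since \<open>0 powr a = 0\<close>, and only the constant
  term q - p + 1 remains.\<close>

lemma I_set_le: "p \<in> I_set q \<Longrightarrow> p \<le> q + 1"
  using I_setD[of p q 0] by simp

text \<open>For p = q all coefficients in the defining inequality are nonnegative. With this lemma
  the classical Picone inequality becomes an instance of the generalized one.\<close>

lemma self_in_I_set: "q > 1 \<Longrightarrow> q \<in> I_set q"
  by (auto simp: I_set_def intro!: add_nonneg_nonneg)

text \<open>Weighted arithmetic-geometric mean inequality: the weights \<open>q - 1\<close>, \<open>p - q\<close>, \<open>q - p + 1\<close> add up to
  \<open>q\<close>, and the exponents \<open>p\<close>, \<open>1\<close>, \<open>0\<close> average to \<open>p - 1\<close>.\<close>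

lemma picone_scalar_aligned:
  fixes s :: real
  assumes "s > 0" "1 < q" "q \<le> p" "p \<le> q + 1"
  shows "(q - 1) * s powr p - q * s powr (p - 1) + (p - q) * s + (q - p + 1) \<ge> 0"
proof -
  define S l where "S = s powr (p - 1)" and "l = ln s"
  have 1: "(q - 1) * (S * (1 + l)) \<le> (q - 1) * s powr p"
    using powr_tangent[OF assms(1), of "p - 1" p] assms by (intro mult_left_mono) (auto simp: S_def l_def)
  have 2: "(p - q) * (S * (1 + (1 - (p - 1)) * l)) \<le> (p - q) * s"
    using powr_tangent[OF assms(1), of "p - 1" 1] assms by (intro mult_left_mono) (auto simp: S_def l_def)
  have 3: "(q - p + 1) * (S * (1 + (0 - (p - 1)) * l)) \<le> (q - p + 1) * 1"
    using powr_tangent[OF assms(1), of "p - 1" 0] assms by (intro mult_left_mono) (auto simp: S_def l_def)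
  \<comment> \<open>The logarithmic terms cancel because (q - 1) * p + (p - q) * 1 = q * (p -
    1).\<close>
  have "q * S = (q - 1) * (S * (1 + l)) + (p - q) * (S * (1 + (1 - (p - 1)) * l)) +
      (q - p + 1) * (S * (1 + (0 - (p - 1)) * l))"
    by (simp add: algebra_simps)
  also have "\<dots> \<le> (q - 1) * s powr p + (p - q) * s + (q - p + 1) * 1"
    by (intro add_mono 1 2 3)
  finally show ?thesis
    unfolding S_def by simp
qed

text \<open>The expression is affine in the cosine \<open>t\<close>. For \<open>t = 1\<close> it is the previous lemma, and for \<open>t = -1\<close>
  the condition defining \<open>I_set\<close>.\<close>

lemma picone_scalar:
  fixes s t :: real
  assumes "s > 0" "\<bar>t\<bar> \<le> 1" "1 < q" "q \<le> p" "p \<in> I_set q"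
  shows "(q - 1) * s powr p - q * s powr (p - 1) * t + (p - q) * s * t + (q - p + 1) \<ge> 0"
proof -
  define A B where "A = (q - 1) * s powr p + (q - p + 1)" and "B = q * s powr (p - 1) - (p - q) * s"
  have "A - B \<ge> 0"
    using picone_scalar_aligned[OF assms(1,3,4) I_set_le[OF assms(5)]] unfolding A_def B_def by linarith
  moreover have "A + B \<ge> 0"
    using I_setD[OF assms(5), of s] assms(1) unfolding A_def B_def by linarith
  moreover have "A - B * t = (1 + t) / 2 * (A - B) + (1 - t) / 2 * (A + B)"
    by (simp add: field_simps)
  ultimately have "A - B * t \<ge> 0"
    using assms(2) by simp
  then show ?thesis
    unfolding A_def B_def left_diff_distrib by linarith
qed

section \<open>From scalar to vector inequalities\<close>

lemma flux_inner_self: "flux r v \<bullet> v = norm v powr r"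
proof (cases "v = 0")
  case False
  then have "norm v powr (r - 2) * norm v ^ 2 = norm v powr r"
    using powr_add[of "norm v" "r - 2" 2] by (simp add: powr_numeral)
  then show ?thesis
    by (simp add: flux_def power2_norm_eq_inner)
qed (simp add: flux_def)

lemma flux_scaleR:
  assumes "z > 0"
  shows "flux r (z *\<^sub>R v) = z powr (r - 1) *\<^sub>R flux r v"
proof -
  have "z powr (r - 2) * z = z powr (r - 1)"
    using powr_add[of z "r - 2" 1] assms by simp
  then show ?thesis
    using assms by (simp add: flux_def powr_mult mult.commute mult.left_commute)
qed

text \<open>With s = |b| / |a| and t the cosine of the angle between the vectors, right-hand side
  minus left-hand side is |a|^p times the expression in \<open>picone_scalar\<close>. If a or b is
  0, the signs of q - 1 and q - p + 1 decide.\<close>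

lemma picone_vector:
  fixes a b :: "'a::euclidean_space"
  assumes "1 < q" "q \<le> p" "p \<in> I_set q"
  shows "flux p b \<bullet> (q *\<^sub>R a - (q - 1) *\<^sub>R b) \<le> flux p a \<bullet> ((q - p + 1) *\<^sub>R a + (p - q) *\<^sub>R b)"
proof (cases "a = 0 \<or> b = 0")
  case True
  then show ?thesis
    using assms I_set_le[OF assms(3)]
    by (auto simp: flux_inner_self inner_diff_right inner_add_right flux_def)
next
  case False
  then have nz: "norm a > 0" "norm b > 0" by auto
  define s t where "s = norm b / norm a" and "t = a \<bullet> b / (norm a * norm b)"
  have s: "s > 0"
    using nz by (simp add: s_def)
  have "\<bar>t\<bar> \<le> 1"
    using nz Cauchy_Schwarz_ineq2[of a b] by (simp add: t_def abs_mult)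
  have ab: "a \<bullet> b = norm a * norm b * t"
    using nz by (simp add: t_def)
  have b: "norm b = s * norm a"
    using nz by (simp add: s_def)
  have e1: "norm b powr p = norm a powr p * s powr p"
    using nz s by (simp add: b powr_mult)
  have np: "norm a powr p = norm a powr (p - 2) * norm a * norm a"
    using powr_add[of "norm a" "p - 2" 2] nz by (simp add: powr_numeral power2_eq_square)
  have sp: "s powr (p - 1) = s powr (p - 2) * s"
    using powr_add[of s "p - 2" 1] s by simp
  have e2: "norm b powr (p - 2) * (a \<bullet> b) = norm a powr p * (s powr (p - 1) * t)"
    using nz s unfolding ab b np sp by (simp add: powr_mult)
  have e3: "norm a powr (p - 2) * (a \<bullet> b) = norm a powr p * (s * t)"
    unfolding ab b np by simp
  have "flux p a \<bullet> ((q - p + 1) *\<^sub>R a + (p - q) *\<^sub>R b) - flux p b \<bullet> (q *\<^sub>R a - (q - 1) *\<^sub>R b) =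
      (q - p + 1) * norm a powr p + (p - q) * (norm a powr (p - 2) * (a \<bullet> b)) -
      q * (norm b powr (p - 2) * (a \<bullet> b)) + (q - 1) * norm b powr p"
  proof -
    have "flux p a \<bullet> b = norm a powr (p - 2) * (a \<bullet> b)" "flux p b \<bullet> a = norm b powr (p - 2) * (a \<bullet> b)"
      by (simp_all add: flux_def inner_commute)
    then show ?thesis
      by (simp add: inner_add_right inner_diff_right flux_inner_self)
  qed
  also have "\<dots> = norm a powr p *
      ((q - 1) * s powr p - q * s powr (p - 1) * t + (p - q) * s * t + (q - p + 1))"
    unfolding e1 e2 e3 by (simp add: algebra_simps)
  also have "\<dots> \<ge> 0"
    using picone_scalar[OF s \<open>\<bar>t\<bar> \<le> 1\<close> assms] by simp
  finally show ?thesis by simp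
qed

text \<open>This is \<open>picone_vector\<close> with \<open>z *\<^sub>R b\<close> in place of
  \<open>b\<close>, multiplied by z^(q-p), as the flux is homogeneous of degree p - 1. In the
  application z = \<phi> / u, a and b are the gradients of \<phi> and u, and the vectors paired with
  the fluxes are the gradients of the two test functions. For p = q the right-hand side is
  |a|^q.\<close>

lemma picone:
  fixes a b :: "'a::euclidean_space"
  assumes "1 < q" "q \<le> p" "p \<in> I_set q" "z > 0"
  shows "flux p b \<bullet> (q *\<^sub>R (z powr (q - 1) *\<^sub>R a) + (1 - q) *\<^sub>R (z powr q *\<^sub>R b)) \<le>
    flux p a \<bullet> ((q - p + 1) *\<^sub>R (z powr (q - p) *\<^sub>R a) + (p - q) *\<^sub>R (z powr (q - p + 1) *\<^sub>R b))"
proof -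
  have le: "z powr (q - p) * (flux p (z *\<^sub>R b) \<bullet> (q *\<^sub>R a - (q - 1) *\<^sub>R (z *\<^sub>R b))) \<le>
      z powr (q - p) * (flux p a \<bullet> ((q - p + 1) *\<^sub>R a + (p - q) *\<^sub>R (z *\<^sub>R b)))"
    using picone_vector[OF assms(1-3), of "z *\<^sub>R b" a] by (intro mult_left_mono) auto
  have lhs: "z powr (q - p) * (flux p (z *\<^sub>R b) \<bullet> (q *\<^sub>R a - (q - 1) *\<^sub>R (z *\<^sub>R b))) =
      flux p b \<bullet> (q *\<^sub>R (z powr (q - 1) *\<^sub>R a) + (1 - q) *\<^sub>R (z powr q *\<^sub>R b))"
  proof -
    have z1: "z powr (q - p) * z powr (p - 1) = z powr (q - 1)"
      using assms(4) by (simp flip: powr_add)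
    have z2: "z powr q = z powr (q - 1) * z"
      using powr_add[of z "q - 1" 1] assms(4) by simp
    have "z powr (q - p) * (flux p (z *\<^sub>R b) \<bullet> (q *\<^sub>R a - (q - 1) *\<^sub>R (z *\<^sub>R b))) =
        z powr (q - 1) * (flux p b \<bullet> (q *\<^sub>R a - (q - 1) *\<^sub>R (z *\<^sub>R b)))"
      by (simp only: flux_scaleR[OF assms(4)] inner_scaleR_left mult.assoc[symmetric] z1)
    then show ?thesis
      unfolding z2 by (simp add: inner_diff_right inner_add_right algebra_simps)
  qed
  have "z powr (q - p + 1) = z powr (q - p) * z"
    using powr_add[of z "q - p" 1] assms(4) by simp
  then have "z powr (q - p) * (flux p a \<bullet> ((q - p + 1) *\<^sub>R a + (p - q) *\<^sub>R (z *\<^sub>R b))) =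
      flux p a \<bullet> ((q - p + 1) *\<^sub>R (z powr (q - p) *\<^sub>R a) + (p - q) *\<^sub>R (z powr (q - p + 1) *\<^sub>R b))"
    by (simp add: inner_add_right algebra_simps)
  then show ?thesis
    using le unfolding lhs by simp
qed

section \<open>Composition with test functions in Sobolev spaces\<close>

text \<open>Membership in \<open>Lp\<close> is part of the notion because a nonintegrable function
  has integral 0 by default, so that the limit alone would carry no information.\<close>

definition Lp_null :: "real \<Rightarrow> 'a::euclidean_space set \<Rightarrow> (nat \<Rightarrow> 'a \<Rightarrow> 'b::euclidean_space) \<Rightarrow> bool" where
  "Lp_null p \<Omega> F \<longleftrightarrow> (\<forall>n. F n \<in> Lp p \<Omega>) \<and>
     (\<lambda>n. \<integral>x. norm (F n x) powr p \<partial>lebesgue_on \<Omega>) \<longlonglongrightarrow> 0"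

text \<open>A quasi-triangle inequality from x + y \<le> 2 max x y; its constant is harmless where
  only convergence to 0 matters.\<close>

lemma add_powr_le:
  fixes x y :: real
  assumes "0 \<le> x" "0 \<le> y" "0 < p"
  shows "(x + y) powr p \<le> 2 powr p * (x powr p + y powr p)"
proof -
  have "(x + y) powr p \<le> (2 * max x y) powr p"
    using assms by (intro powr_mono2) auto
  also have "\<dots> = 2 powr p * max x y powr p"
    using assms by (simp add: powr_mult)
  also have "\<dots> \<le> 2 powr p * (x powr p + y powr p)"
    using assms by (intro mult_left_mono) (auto simp: max_def)
  finally show ?thesis .
qed

lemma Lp_bounded:
  fixes h :: "'a::euclidean_space \<Rightarrow> 'b::euclidean_space"
  assumes "open \<Omega>" "bounded \<Omega>" "0 < p" "h \<in> borel_measurable (lebesgue_on \<Omega>)"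
    and "\<And>x. x \<in> \<Omega> \<Longrightarrow> norm (h x) \<le> B"
  shows "h \<in> Lp p \<Omega>"
proof -
  have "integrable (lebesgue_on \<Omega>) (\<lambda>x. norm (h x) powr p)"
    using assms(3-5)
    by (intro integrable_lebesgue_on_bounded[OF assms(1,2), where B = "B powr p"]) (auto intro!: powr_mono2)
  then show ?thesis
    using assms(4) by (simp add: Lp_def)
qed

lemma Lp_null_dominated:
  fixes F :: "nat \<Rightarrow> 'a::euclidean_space \<Rightarrow> 'b::euclidean_space"
    and G :: "nat \<Rightarrow> 'a \<Rightarrow> 'c::euclidean_space" and h :: "nat \<Rightarrow> 'a \<Rightarrow> 'd::euclidean_space"
  assumes F: "Lp_null p \<Omega> F" and G: "Lp_null p \<Omega> G" and "0 < p" "0 \<le> C"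
    and h: "\<And>n. h n \<in> borel_measurable (lebesgue_on \<Omega>)"
    and le: "\<And>n x. x \<in> \<Omega> \<Longrightarrow> norm (h n x) \<le> C * (norm (F n x) + norm (G n x))"
  shows "Lp_null p \<Omega> h"
proof -
  define D where "D = C powr p * 2 powr p"
  have pw: "norm (h n x) powr p \<le> D * (norm (F n x) powr p + norm (G n x) powr p)" if "x \<in> \<Omega>" for n x
  proof -
    have "norm (h n x) powr p \<le> (C * (norm (F n x) + norm (G n x))) powr p"
      using le[OF that] \<open>0 < p\<close> by (intro powr_mono2) auto
    also have "\<dots> = C powr p * (norm (F n x) + norm (G n x)) powr p"
      using \<open>0 \<le> C\<close> by (simp add: powr_mult)
    also have "\<dots> \<le> C powr p * (2 powr p * (norm (F n x) powr p + norm (G n x) powr p))"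
      using \<open>0 < p\<close> by (intro mult_left_mono add_powr_le) auto
    finally show ?thesis by (simp add: D_def mult.assoc)
  qed
  have FG: "integrable (lebesgue_on \<Omega>) (\<lambda>x. norm (F n x) powr p)"
    "integrable (lebesgue_on \<Omega>) (\<lambda>x. norm (G n x) powr p)" for n
    using F G by (auto simp: Lp_null_def Lp_def)
  then have int: "integrable (lebesgue_on \<Omega>) (\<lambda>x. D * (norm (F n x) powr p + norm (G n x) powr p))" for n
    by (intro integrable_mult_right Bochner_Integration.integrable_add)
  have hp: "integrable (lebesgue_on \<Omega>) (\<lambda>x. norm (h n x) powr p)" for n
    using order_trans[OF pw abs_ge_self] h[of n]
    by (intro Bochner_Integration.integrable_bound[OF int[of n]] AE_I2) auto
  have up: "(LINT x|lebesgue_on \<Omega>. norm (h n x) powr p) \<le>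
      D * ((LINT x|lebesgue_on \<Omega>. norm (F n x) powr p) + (LINT x|lebesgue_on \<Omega>. norm (G n x) powr p))" for n
  proof -
    have "(LINT x|lebesgue_on \<Omega>. norm (h n x) powr p) \<le>
        (LINT x|lebesgue_on \<Omega>. D * (norm (F n x) powr p + norm (G n x) powr p))"
      using pw by (intro integral_mono hp int) auto
    then show ?thesis
      using FG by simp
  qed
  have "(\<lambda>n. D * ((LINT x|lebesgue_on \<Omega>. norm (F n x) powr p) +
      (LINT x|lebesgue_on \<Omega>. norm (G n x) powr p))) \<longlonglongrightarrow> 0"
    using F G by (intro tendsto_mult_right_zero tendsto_add_zero) (auto simp: Lp_null_def)
  then have "(\<lambda>n. LINT x|lebesgue_on \<Omega>. norm (h n x) powr p) \<longlonglongrightarrow> 0"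
    by (rule tendsto_sandwich[OF _ _ tendsto_const, rotated 2])
      (use up in \<open>auto intro!: always_eventually\<close>)
  then show ?thesis
    using h hp by (simp add: Lp_null_def Lp_def)
qed

text \<open>Dominated convergence with a constant majorant, integrable because \<Omega> has finite
  measure.\<close>

lemma Lp_null_bounded:
  fixes h :: "nat \<Rightarrow> 'a::euclidean_space \<Rightarrow> 'b::euclidean_space"
  assumes "open \<Omega>" "bounded \<Omega>" "0 < p" "\<And>n. h n \<in> borel_measurable (lebesgue_on \<Omega>)"
    and B: "\<And>n x. x \<in> \<Omega> \<Longrightarrow> norm (h n x) \<le> B"
    and lim: "\<And>x. x \<in> \<Omega> \<Longrightarrow> (\<lambda>n. h n x) \<longlonglongrightarrow> 0"
  shows "Lp_null p \<Omega> h"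
proof -
  have "(\<lambda>n. LINT x|lebesgue_on \<Omega>. norm (h n x) powr p) \<longlonglongrightarrow> (LINT x|lebesgue_on \<Omega>. 0)"
  proof (rule integral_dominated_convergence)
    show "integrable (lebesgue_on \<Omega>) (\<lambda>x. B powr p)"
      using assms(1,2) by (intro integrable_lebesgue_on_bounded[where B = "B powr p"]) auto
    show "(\<lambda>x. norm (h n x) powr p) \<in> borel_measurable (lebesgue_on \<Omega>)" for n
      using assms(4)[of n] by measurable
    show "AE x in lebesgue_on \<Omega>. (\<lambda>n. norm (h n x) powr p) \<longlonglongrightarrow> 0"
      using lim \<open>0 < p\<close> by (intro AE_I2 tendsto_zero_powrI[where b = p] tendsto_norm_zero) auto
    show "AE x in lebesgue_on \<Omega>. norm (norm (h n x) powr p) \<le> B powr p" for n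
      using B \<open>0 < p\<close> by (intro AE_I2) (auto intro!: powr_mono2)
  qed simp
  then show ?thesis
    using assms Lp_bounded[OF assms(1-4) B] by (simp add: Lp_null_def)
qed

lemma Lp_null_iff_Lp_norm:
  assumes "0 < p" "\<And>n. F n \<in> Lp p \<Omega>"
  shows "Lp_null p \<Omega> F \<longleftrightarrow> (\<lambda>n. Lp_norm p \<Omega> (F n)) \<longlonglongrightarrow> 0"
proof -
  let ?I = "\<lambda>n. LINT x|lebesgue_on \<Omega>. norm (F n x) powr p"
  have "?I \<longlonglongrightarrow> 0 \<longleftrightarrow> (\<lambda>n. ?I n powr (1 / p)) \<longlonglongrightarrow> 0"
  proof
    assume "?I \<longlonglongrightarrow> 0"
    then show "(\<lambda>n. ?I n powr (1 / p)) \<longlonglongrightarrow> 0"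
      using assms(1) by (intro tendsto_zero_powrI[where b = "1 / p"]) auto
  next
    assume "(\<lambda>n. ?I n powr (1 / p)) \<longlonglongrightarrow> 0"
    then have "(\<lambda>n. (?I n powr (1 / p)) powr p) \<longlonglongrightarrow> 0"
      by (rule tendsto_zero_powrI[OF _ tendsto_const]) (use assms(1) in auto)
    then show "?I \<longlonglongrightarrow> 0"
      using assms(1) by (simp add: powr_powr)
  qed
  then show ?thesis
    using assms(2) by (simp add: Lp_null_def Lp_norm_def)
qed

text \<open>The values of the approximating test functions are confined to \<open>R\<close>, so that they may be composed
  with functions whose derivatives are bounded on \<open>R\<close> only.\<close>

definition test_approx ::
  "real \<Rightarrow> 'a::euclidean_space set \<Rightarrow> real set \<Rightarrow> ('a \<Rightarrow> real) \<Rightarrow> ('a \<Rightarrow> 'a) \<Rightarrow> bool" where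
  "test_approx p \<Omega> R v G \<longleftrightarrow> (\<exists>\<eta>. (\<forall>n. \<eta> n \<in> test_functions \<Omega> \<and> range (\<eta> n) \<subseteq> R) \<and>
     Lp_null p \<Omega> (\<lambda>n x. \<eta> n x - v x) \<and> Lp_null p \<Omega> (\<lambda>n x. grad (\<eta> n) x - G x))"

section \<open>Operations on functions approximated by test functions\<close>

lemma test_functionsI:
  assumes "smooth_on UNIV \<psi>" "compact K" "K \<subseteq> \<Omega>" "\<And>x. x \<notin> K \<Longrightarrow> \<psi> x = 0"
  shows "\<psi> \<in> test_functions \<Omega>"
proof -
  have "{x. \<psi> x \<noteq> 0} \<subseteq> K"
    using assms(4) by blast
  then have "closure {x. \<psi> x \<noteq> 0} \<subseteq> K"
    by (rule closure_minimal) (rule compact_imp_closed[OF assms(2)])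
  moreover from this have "compact (closure {x. \<psi> x \<noteq> 0})"
    using compact_Int_closed[OF assms(2) closed_closure[of "{x. \<psi> x \<noteq> 0}"]]
    by (simp add: Int_absorb1)
  ultimately show ?thesis
    using assms by (auto simp: test_functions_def)
qed

lemma test_functions_measurable:
  fixes \<eta> :: "'a::euclidean_space \<Rightarrow> real"
  assumes "\<eta> \<in> test_functions \<Omega>"
  shows "\<eta> \<in> borel_measurable (lebesgue_on S)" "grad \<eta> \<in> borel_measurable (lebesgue_on S)"
  using borel_measurable_continuous_onI[OF test_functionsD(5)[OF assms]]
    borel_measurable_continuous_onI[OF test_functionsD(6)[OF assms]]
  by (auto intro!: measurable_restrict_space1 measurable_completion)

lemma test_functions_bounded:
  fixes \<eta> :: "'a::euclidean_space \<Rightarrow> real"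
  assumes "\<eta> \<in> test_functions \<Omega>"
  obtains B where "\<And>x. \<bar>\<eta> x\<bar> \<le> B" "\<And>x. norm (grad \<eta> x) \<le> B"
proof -
  define K where "K = closure {x. \<eta> x \<noteq> 0}"
  note t = test_functionsD[OF assms, folded K_def]
  have "bounded (\<eta> ` K)" "bounded (grad \<eta> ` K)"
    by (intro compact_imp_bounded compact_continuous_image t)+
  then obtain A B where AB: "\<And>x. x \<in> K \<Longrightarrow> \<bar>\<eta> x\<bar> \<le> A" "\<And>x. x \<in> K \<Longrightarrow> norm (grad \<eta> x) \<le> B"
    unfolding bounded_iff by auto
  have "\<bar>\<eta> x\<bar> \<le> max 0 (max A B)" "norm (grad \<eta> x) \<le> max 0 (max A B)" for x
    using AB[of x] t(7,8)[of x] by (cases "x \<in> K"; auto simp: le_max_iff_disj)+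
  then show ?thesis
    using that by blast
qed

text \<open>Composing the approximants with \<open>H\<close> keeps their supports compact, as
  \<open>H 0 = 0\<close>. The gradient error is \<open>H1 (\<eta> n x)\<close> times the old
  gradient error plus \<open>H1 (\<eta> n x) - H1 (v x)\<close> times \<open>G x\<close>: the bound
  on \<open>H1\<close> controls the first part, and the bounds on \<open>H2\<close> and
  \<open>G\<close> control the second.\<close>

lemma test_approx_compose:
  fixes v :: "'a::euclidean_space \<Rightarrow> real"
  assumes "open \<Omega>" "0 < p" and v: "test_approx p \<Omega> R v G" "\<And>x. x \<in> \<Omega> \<Longrightarrow> v x \<in> R"
    and R: "convex R"
    and H: "\<And>s. (H has_real_derivative H1 s) (at s)" "\<And>s. (H1 has_real_derivative H2 s) (at s)"
      "\<And>s. s \<in> R \<Longrightarrow> \<bar>H1 s\<bar> \<le> B" "\<And>s. s \<in> R \<Longrightarrow> \<bar>H2 s\<bar> \<le> B" "H 0 = 0"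
    and sm: "\<And>\<eta>::'a \<Rightarrow> real. smooth_on UNIV \<eta> \<Longrightarrow> smooth_on UNIV (\<lambda>x. H (\<eta> x))"
    and vG: "v \<in> borel_measurable (lebesgue_on \<Omega>)" "G \<in> borel_measurable (lebesgue_on \<Omega>)"
      "\<And>x. x \<in> \<Omega> \<Longrightarrow> norm (G x) \<le> K"
  shows "test_approx p \<Omega> (H ` R) (\<lambda>x. H (v x)) (\<lambda>x. H1 (v x) *\<^sub>R G x)"
proof -
  obtain \<eta> where \<eta>: "\<And>n. \<eta> n \<in> test_functions \<Omega>" "\<And>n x. \<eta> n x \<in> R"
    and lim: "Lp_null p \<Omega> (\<lambda>n x. \<eta> n x - v x)" "Lp_null p \<Omega> (\<lambda>n x. grad (\<eta> n) x - G x)"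
    using v(1) by (auto simp: test_approx_def image_subset_iff)
  have "B \<ge> 0"
    using H(3)[OF \<eta>(2)[of 0 undefined]] by linarith
  have lip: "\<bar>H s - H t\<bar> \<le> B * \<bar>s - t\<bar>" "\<bar>H1 s - H1 t\<bar> \<le> B * \<bar>s - t\<bar>" if "s \<in> R" "t \<in> R" for s t
    using field_differentiable_bound[OF R, of H H1 B s t] field_differentiable_bound[OF R, of H1 H2 B s t]
      H that by (auto intro: has_field_derivative_at_within)
  have mH: "H \<in> borel_measurable borel" "H1 \<in> borel_measurable borel"
    by (intro borel_measurable_continuous_onI continuous_at_imp_continuous_on ballI
        DERIV_isCont[OF H(1)] DERIV_isCont[OF H(2)])+
  let ?\<psi> = "\<lambda>n x. H (\<eta> n x)"
  have grad: "grad (?\<psi> n) x = H1 (\<eta> n x) *\<^sub>R grad (\<eta> n) x" for n x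
    by (intro grad_eqI GDERIV_DERIV_compose test_functionsD(4)[OF \<eta>(1)] H(1))
  have "?\<psi> n \<in> test_functions \<Omega>" for n
  proof (rule test_functionsI[OF sm[OF test_functionsD(1)[OF \<eta>(1)]] test_functionsD(2,3)[OF \<eta>(1)]])
    show "H (\<eta> n x) = 0" if "x \<notin> closure {x. \<eta> n x \<noteq> 0}" for x
      using test_functionsD(7)[OF \<eta>(1) that] H(5) by simp
  qed
  moreover have "Lp_null p \<Omega> (\<lambda>n x. ?\<psi> n x - H (v x))"
  proof (rule Lp_null_dominated[OF lim(1) lim(1) \<open>0 < p\<close> \<open>B \<ge> 0\<close>])
    show "(\<lambda>x. ?\<psi> n x - H (v x)) \<in> borel_measurable (lebesgue_on \<Omega>)" for n
      using test_functions_measurable(1)[OF \<eta>(1), of n \<Omega>] vG(1)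
      by (intro borel_measurable_diff) (auto intro: measurable_compose[OF _ mH(1)])
    show "norm (?\<psi> n x - H (v x)) \<le> B * (norm (\<eta> n x - v x) + norm (\<eta> n x - v x))" if "x \<in> \<Omega>" for n x
    proof -
      have "B * \<bar>\<eta> n x - v x\<bar> \<le> B * (norm (\<eta> n x - v x) + norm (\<eta> n x - v x))"
        using \<open>B \<ge> 0\<close> by (intro mult_left_mono) auto
      then show ?thesis
        using lip(1)[OF \<eta>(2) v(2)[OF that], of n x] by simp
    qed
  qed
  moreover have "Lp_null p \<Omega> (\<lambda>n x. grad (?\<psi> n) x - H1 (v x) *\<^sub>R G x)"
  proof (rule Lp_null_dominated[OF lim \<open>0 < p\<close>])
    show "B * max 1 K \<ge> 0"
      using \<open>B \<ge> 0\<close> by simp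
    show "(\<lambda>x. grad (?\<psi> n) x - H1 (v x) *\<^sub>R G x) \<in> borel_measurable (lebesgue_on \<Omega>)" for n
      unfolding grad using test_functions_measurable[OF \<eta>(1), of n \<Omega>] vG(1,2)
      by (intro borel_measurable_diff borel_measurable_scaleR) (auto intro: measurable_compose[OF _ mH(2)])
    show "norm (grad (?\<psi> n) x - H1 (v x) *\<^sub>R G x) \<le>
        B * max 1 K * (norm (\<eta> n x - v x) + norm (grad (\<eta> n) x - G x))" if "x \<in> \<Omega>" for n x
    proof -
      have "grad (?\<psi> n) x - H1 (v x) *\<^sub>R G x =
          H1 (\<eta> n x) *\<^sub>R (grad (\<eta> n) x - G x) + (H1 (\<eta> n x) - H1 (v x)) *\<^sub>R G x"
        by (simp add: grad algebra_simps)
      also have "norm \<dots> \<le> \<bar>H1 (\<eta> n x)\<bar> * norm (grad (\<eta> n) x - G x) + \<bar>H1 (\<eta> n x) - H1 (v x)\<bar> * norm (G x)"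
        by (rule order_trans[OF norm_triangle_ineq]) simp
      also have "\<dots> \<le> (B * max 1 K) * norm (grad (\<eta> n) x - G x) + (B * \<bar>\<eta> n x - v x\<bar>) * max 1 K"
      proof (intro add_mono mult_mono)
        have "\<bar>H1 (\<eta> n x)\<bar> \<le> B * 1"
          using H(3)[OF \<eta>(2)] by simp
        also have "\<dots> \<le> B * max 1 K"
          using \<open>B \<ge> 0\<close> by (intro mult_left_mono) auto
        finally show "\<bar>H1 (\<eta> n x)\<bar> \<le> B * max 1 K" .
        show "\<bar>H1 (\<eta> n x) - H1 (v x)\<bar> \<le> B * \<bar>\<eta> n x - v x\<bar>"
          using lip(2)[OF \<eta>(2) v(2)[OF that]] .
        show "norm (G x) \<le> max 1 K"
          using vG(3)[OF that] by simp
      qed (use \<open>B \<ge> 0\<close> in auto)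
      also have "\<dots> = B * max 1 K * (norm (\<eta> n x - v x) + norm (grad (\<eta> n) x - G x))"
        by (simp add: algebra_simps)
      finally show ?thesis .
    qed
  qed
  ultimately show ?thesis
    unfolding test_approx_def using \<eta>(2) by (intro exI[of _ ?\<psi>]) auto
qed

text \<open>The set \<open>T\<close> only has to contain the combined values. In this way the
  bounded range of \<open>reg_ln\<close> confines the exponent to an interval before the exponential
  is applied.\<close>

lemma test_approx_add:
  fixes v w :: "'a::euclidean_space \<Rightarrow> real"
  assumes "0 < p" and v: "test_approx p \<Omega> R v G" and w: "test_approx p \<Omega> S w G'"
    and RS: "\<And>s t. s \<in> R \<Longrightarrow> t \<in> S \<Longrightarrow> a * s + b * t \<in> T"
    and m: "v \<in> borel_measurable (lebesgue_on \<Omega>)" "w \<in> borel_measurable (lebesgue_on \<Omega>)"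
      "G \<in> borel_measurable (lebesgue_on \<Omega>)" "G' \<in> borel_measurable (lebesgue_on \<Omega>)"
  shows "test_approx p \<Omega> T (\<lambda>x. a * v x + b * w x) (\<lambda>x. a *\<^sub>R G x + b *\<^sub>R G' x)"
proof -
  obtain \<eta> where \<eta>: "\<And>n. \<eta> n \<in> test_functions \<Omega>" "\<And>n x. \<eta> n x \<in> R"
    and lim: "Lp_null p \<Omega> (\<lambda>n x. \<eta> n x - v x)" "Lp_null p \<Omega> (\<lambda>n x. grad (\<eta> n) x - G x)"
    using v by (auto simp: test_approx_def image_subset_iff)
  obtain \<zeta> where \<zeta>: "\<And>n. \<zeta> n \<in> test_functions \<Omega>" "\<And>n x. \<zeta> n x \<in> S"
    and lim': "Lp_null p \<Omega> (\<lambda>n x. \<zeta> n x - w x)" "Lp_null p \<Omega> (\<lambda>n x. grad (\<zeta> n) x - G' x)"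
    using w by (auto simp: test_approx_def image_subset_iff)
  let ?\<psi> = "\<lambda>n x. a * \<eta> n x + b * \<zeta> n x"
  have grad: "grad (?\<psi> n) x = a *\<^sub>R grad (\<eta> n) x + b *\<^sub>R grad (\<zeta> n) x" for n x
  proof (rule grad_eqI)
    have "GDERIV (\<lambda>x. a * \<eta> n x + b * \<zeta> n x) x :>
        (a *\<^sub>R grad (\<eta> n) x + \<eta> n x *\<^sub>R 0) + (b *\<^sub>R grad (\<zeta> n) x + \<zeta> n x *\<^sub>R 0)"
      by (intro GDERIV_add GDERIV_mult GDERIV_const test_functionsD(4)[OF \<eta>(1)] test_functionsD(4)[OF \<zeta>(1)])
    then show "GDERIV (\<lambda>x. a * \<eta> n x + b * \<zeta> n x) x :> a *\<^sub>R grad (\<eta> n) x + b *\<^sub>R grad (\<zeta> n) x"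
      by simp
  qed
  have "?\<psi> n \<in> test_functions \<Omega>" for n
  proof (rule test_functionsI[of _ "closure {x. \<eta> n x \<noteq> 0} \<union> closure {x. \<zeta> n x \<noteq> 0}"])
    show "smooth_on UNIV (?\<psi> n)"
      by (intro smooth_on_add smooth_on_mult smooth_on_const test_functionsD(1)[OF \<eta>(1)] test_functionsD(1)[OF \<zeta>(1)])
    show "compact (closure {x. \<eta> n x \<noteq> 0} \<union> closure {x. \<zeta> n x \<noteq> 0})"
      by (intro compact_Un test_functionsD(2)[OF \<eta>(1)] test_functionsD(2)[OF \<zeta>(1)])
    show "closure {x. \<eta> n x \<noteq> 0} \<union> closure {x. \<zeta> n x \<noteq> 0} \<subseteq> \<Omega>"
      by (intro Un_least test_functionsD(3)[OF \<eta>(1)] test_functionsD(3)[OF \<zeta>(1)])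
    show "?\<psi> n x = 0" if "x \<notin> closure {x. \<eta> n x \<noteq> 0} \<union> closure {x. \<zeta> n x \<noteq> 0}" for x
      using that test_functionsD(7)[OF \<eta>(1)[of n], of x] test_functionsD(7)[OF \<zeta>(1)[of n], of x] by simp
  qed
  moreover have "Lp_null p \<Omega> (\<lambda>n x. ?\<psi> n x - (a * v x + b * w x))"
  proof (rule Lp_null_dominated[OF lim(1) lim'(1) \<open>0 < p\<close>])
    show "\<bar>a\<bar> + \<bar>b\<bar> \<ge> 0" by simp
    show "(\<lambda>x. ?\<psi> n x - (a * v x + b * w x)) \<in> borel_measurable (lebesgue_on \<Omega>)" for n
      using test_functions_measurable(1)[OF \<eta>(1), of n \<Omega>] test_functions_measurable(1)[OF \<zeta>(1), of n \<Omega>] m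
      by measurable
    show "norm (?\<psi> n x - (a * v x + b * w x)) \<le> (\<bar>a\<bar> + \<bar>b\<bar>) * (norm (\<eta> n x - v x) + norm (\<zeta> n x - w x))" for n x
    proof -
      have "?\<psi> n x - (a * v x + b * w x) = a * (\<eta> n x - v x) + b * (\<zeta> n x - w x)"
        by (simp add: algebra_simps)
      also have "norm \<dots> \<le> \<bar>a\<bar> * norm (\<eta> n x - v x) + \<bar>b\<bar> * norm (\<zeta> n x - w x)"
        by (rule order_trans[OF norm_triangle_ineq]) (simp add: abs_mult)
      also have "\<dots> \<le> (\<bar>a\<bar> + \<bar>b\<bar>) * norm (\<eta> n x - v x) + (\<bar>a\<bar> + \<bar>b\<bar>) * norm (\<zeta> n x - w x)"
        by (intro add_mono mult_right_mono) auto
      finally show ?thesis by (simp only: distrib_left)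
    qed
  qed
  moreover have "Lp_null p \<Omega> (\<lambda>n x. grad (?\<psi> n) x - (a *\<^sub>R G x + b *\<^sub>R G' x))"
  proof (rule Lp_null_dominated[OF lim(2) lim'(2) \<open>0 < p\<close>])
    show "\<bar>a\<bar> + \<bar>b\<bar> \<ge> 0" by simp
    show "(\<lambda>x. grad (?\<psi> n) x - (a *\<^sub>R G x + b *\<^sub>R G' x)) \<in> borel_measurable (lebesgue_on \<Omega>)" for n
      unfolding grad
      using test_functions_measurable(2)[OF \<eta>(1), of n \<Omega>] test_functions_measurable(2)[OF \<zeta>(1), of n \<Omega>] m
      by measurable
    show "norm (grad (?\<psi> n) x - (a *\<^sub>R G x + b *\<^sub>R G' x)) \<le>
        (\<bar>a\<bar> + \<bar>b\<bar>) * (norm (grad (\<eta> n) x - G x) + norm (grad (\<zeta> n) x - G' x))" for n x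
    proof -
      have "grad (?\<psi> n) x - (a *\<^sub>R G x + b *\<^sub>R G' x) = a *\<^sub>R (grad (\<eta> n) x - G x) + b *\<^sub>R (grad (\<zeta> n) x - G' x)"
        by (simp add: grad algebra_simps)
      also have "norm \<dots> \<le> \<bar>a\<bar> * norm (grad (\<eta> n) x - G x) + \<bar>b\<bar> * norm (grad (\<zeta> n) x - G' x)"
        by (rule order_trans[OF norm_triangle_ineq]) simp
      also have "\<dots> \<le> (\<bar>a\<bar> + \<bar>b\<bar>) * norm (grad (\<eta> n) x - G x) + (\<bar>a\<bar> + \<bar>b\<bar>) * norm (grad (\<zeta> n) x - G' x)"
        by (intro add_mono mult_right_mono) auto
      finally show ?thesis by (simp only: distrib_left)
    qed
  qed
  ultimately show ?thesis
    unfolding test_approx_def using RS \<eta>(2) \<zeta>(2)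
    by (intro exI[of _ ?\<psi>]) (auto simp: image_subset_iff)
qed

text \<open>The chosen weak gradient equals a continuous function almost everywhere, and Lebesgue
  measure is complete.\<close>

lemma weak_grad_classical_measurable:
  fixes \<psi> :: "'a::euclidean_space \<Rightarrow> real"
  assumes "open \<Omega>" "\<And>x. x \<in> \<Omega> \<Longrightarrow> GDERIV \<psi> x :> G x" "continuous_on \<Omega> G"
  shows "weak_grad \<Omega> \<psi> \<in> borel_measurable (lebesgue_on \<Omega>)"
proof -
  have \<Omega>: "\<Omega> \<in> sets lebesgue"
    using \<open>open \<Omega>\<close> by (simp add: borel_open)
  have "AE x in lebesgue_on \<Omega>. weak_grad \<Omega> \<psi> x = G x"
    using assms by (rule weak_grad_classical(2))
  then have "AE x in lebesgue. x \<in> \<Omega> \<longrightarrow> weak_grad \<Omega> \<psi> x = G x"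
    using \<Omega> by (simp add: AE_restrict_space_iff)
  then have ae: "AE x in lebesgue. (if x \<in> \<Omega> then G x else 0) = (if x \<in> \<Omega> then weak_grad \<Omega> \<psi> x else 0)"
    by eventually_elim auto
  have "G \<in> borel_measurable (lebesgue_on \<Omega>)"
    using assms by (intro borel_measurable_lebesgue_on_continuous)
  then have "(\<lambda>x. if x \<in> \<Omega> then G x else 0) \<in> borel_measurable lebesgue"
    using \<Omega> by (simp add: borel_measurable_if)
  then have "(\<lambda>x. if x \<in> \<Omega> then weak_grad \<Omega> \<psi> x else 0) \<in> borel_measurable lebesgue"
    using ae by (rule borel_measurable_AE)
  then show ?thesis
    using \<Omega> by (simp add: borel_measurable_if)
qed

lemma Lp_null_cong_AE:
  fixes F F' :: "nat \<Rightarrow> 'a::euclidean_space \<Rightarrow> 'b::euclidean_space"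
  assumes "Lp_null p \<Omega> F" and m: "\<And>n. F' n \<in> borel_measurable (lebesgue_on \<Omega>)"
    and ae: "\<And>n. AE x in lebesgue_on \<Omega>. F n x = F' n x"
  shows "Lp_null p \<Omega> F'"
proof -
  have Fm: "F n \<in> borel_measurable (lebesgue_on \<Omega>)" and Fi: "integrable (lebesgue_on \<Omega>) (\<lambda>x. norm (F n x) powr p)" for n
    using assms(1) by (auto simp: Lp_null_def Lp_def)
  have ae': "AE x in lebesgue_on \<Omega>. norm (F n x) powr p = norm (F' n x) powr p" for n
    using ae[of n] by eventually_elim simp
  have m': "(\<lambda>x. norm (F n x) powr p) \<in> borel_measurable (lebesgue_on \<Omega>)"
    "(\<lambda>x. norm (F' n x) powr p) \<in> borel_measurable (lebesgue_on \<Omega>)" for n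
    using Fm[of n] m[of n] by measurable
  have "integrable (lebesgue_on \<Omega>) (\<lambda>x. norm (F' n x) powr p)" for n
    using Fi[of n] integrable_cong_AE[OF m'[of n] ae'[of n]] by simp
  moreover have "(LINT x|lebesgue_on \<Omega>. norm (F n x) powr p) = (LINT x|lebesgue_on \<Omega>. norm (F' n x) powr p)" for n
    by (rule integral_cong_AE[OF m'[of n] ae'[of n]])
  ultimately show ?thesis
    using assms(1) m by (simp add: Lp_null_def Lp_def)
qed

text \<open>Together with \<open>test_approx_imp_W01p\<close> this allows all approximation
  arguments to use the continuous gradient \<open>G\<close> instead of the chosen representative
  \<open>weak_grad \<Omega> u\<close>.\<close>

lemma W01p_imp_test_approx:
  fixes u :: "'a::euclidean_space \<Rightarrow> real"
  assumes \<Omega>: "open \<Omega>" "bounded \<Omega>" and "0 < p" and u: "u \<in> W01p p \<Omega>"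
    and G: "\<And>x. x \<in> \<Omega> \<Longrightarrow> GDERIV u x :> G x" "continuous_on \<Omega> G"
    and B: "\<And>x. x \<in> \<Omega> \<Longrightarrow> \<bar>u x\<bar> \<le> K" "\<And>x. x \<in> \<Omega> \<Longrightarrow> norm (G x) \<le> K"
  shows "test_approx p \<Omega> UNIV u G"
proof -
  obtain \<eta> where \<eta>: "\<And>n. \<eta> n \<in> test_functions \<Omega>"
    and lim: "(\<lambda>n. Lp_norm p \<Omega> (\<lambda>x. \<eta> n x - u x)) \<longlonglongrightarrow> 0"
      "(\<lambda>n. Lp_norm p \<Omega> (\<lambda>x. grad (\<eta> n) x - weak_grad \<Omega> u x)) \<longlonglongrightarrow> 0"
    using u by (auto simp: W01p_def)
  have "continuous_on \<Omega> u"
    using G(1) GDERIV_isCont by (blast intro: continuous_at_imp_continuous_on)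
  then have um: "u \<in> borel_measurable (lebesgue_on \<Omega>)" and Gm: "G \<in> borel_measurable (lebesgue_on \<Omega>)"
    using \<Omega>(1) G(2) by (auto intro: borel_measurable_lebesgue_on_continuous)
  have wm: "weak_grad \<Omega> u \<in> borel_measurable (lebesgue_on \<Omega>)"
    using \<Omega>(1) G by (rule weak_grad_classical_measurable)
  have ae: "AE x in lebesgue_on \<Omega>. weak_grad \<Omega> u x = G x"
    using \<Omega>(1) G by (rule weak_grad_classical(2))
  note \<eta>m = test_functions_measurable[OF \<eta>, of _ \<Omega>]
  \<comment> \<open>The limits in \<open>W01p\<close> speak of norms only, so integrability of the
    differences is established separately, from boundedness.\<close>
  have "(\<lambda>x. \<eta> n x - u x) \<in> Lp p \<Omega>" for n
  proof -
    obtain A where A: "\<And>x. \<bar>\<eta> n x\<bar> \<le> A"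
      using test_functions_bounded[OF \<eta>[of n]] by metis
    have le: "norm (\<eta> n x - u x) \<le> A + K" if "x \<in> \<Omega>" for x
      using A[of x] B(1)[OF that] by simp
    have "(\<lambda>x. \<eta> n x - u x) \<in> borel_measurable (lebesgue_on \<Omega>)"
      by (rule borel_measurable_diff[OF \<eta>m(1) um])
    then show ?thesis
      using le by (rule Lp_bounded[OF \<Omega> \<open>0 < p\<close>])
  qed
  then have "Lp_null p \<Omega> (\<lambda>n x. \<eta> n x - u x)"
    using Lp_null_iff_Lp_norm[OF \<open>0 < p\<close>, of "\<lambda>n x. \<eta> n x - u x"] lim(1) by simp
  moreover have gL: "(\<lambda>x. grad (\<eta> n) x - G x) \<in> Lp p \<Omega>" for n
  proof -
    obtain A where A: "\<And>x. norm (grad (\<eta> n) x) \<le> A"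
      using test_functions_bounded[OF \<eta>[of n]] by metis
    have le: "norm (grad (\<eta> n) x - G x) \<le> A + K" if "x \<in> \<Omega>" for x
      using norm_triangle_ineq4[of "grad (\<eta> n) x" "G x"] A[of x] B(2)[OF that] by linarith
    have "(\<lambda>x. grad (\<eta> n) x - G x) \<in> borel_measurable (lebesgue_on \<Omega>)"
      by (rule borel_measurable_diff[OF \<eta>m(2) Gm])
    then show ?thesis
      using le by (rule Lp_bounded[OF \<Omega> \<open>0 < p\<close>])
  qed
  have "Lp_norm p \<Omega> (\<lambda>x. grad (\<eta> n) x - weak_grad \<Omega> u x) = Lp_norm p \<Omega> (\<lambda>x. grad (\<eta> n) x - G x)" for n
  proof -
    have "(\<lambda>x. norm (grad (\<eta> n) x - weak_grad \<Omega> u x) powr p) \<in> borel_measurable (lebesgue_on \<Omega>)"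
      "(\<lambda>x. norm (grad (\<eta> n) x - G x) powr p) \<in> borel_measurable (lebesgue_on \<Omega>)"
      using \<eta>m(2)[of n] wm Gm by measurable
    then have "(LINT x|lebesgue_on \<Omega>. norm (grad (\<eta> n) x - weak_grad \<Omega> u x) powr p) =
        (LINT x|lebesgue_on \<Omega>. norm (grad (\<eta> n) x - G x) powr p)"
    proof (rule integral_cong_AE)
      show "AE x in lebesgue_on \<Omega>. norm (grad (\<eta> n) x - weak_grad \<Omega> u x) powr p = norm (grad (\<eta> n) x - G x) powr p"
        using ae by eventually_elim simp
    qed
    then show ?thesis
      by (simp only: Lp_norm_def)
  qed
  then have "Lp_null p \<Omega> (\<lambda>n x. grad (\<eta> n) x - G x)"
    using Lp_null_iff_Lp_norm[OF \<open>0 < p\<close>, of "\<lambda>n x. grad (\<eta> n) x - G x"] gL lim(2) by simp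
  ultimately show ?thesis
    unfolding test_approx_def using \<eta> by blast
qed

lemma test_approx_imp_W01p:
  fixes u :: "'a::euclidean_space \<Rightarrow> real"
  assumes \<Omega>: "open \<Omega>" "bounded \<Omega>" and "0 < p" and ap: "test_approx p \<Omega> R u G"
    and G: "\<And>x. x \<in> \<Omega> \<Longrightarrow> GDERIV u x :> G x" "continuous_on \<Omega> G"
    and B: "\<And>x. x \<in> \<Omega> \<Longrightarrow> \<bar>u x\<bar> \<le> K" "\<And>x. x \<in> \<Omega> \<Longrightarrow> norm (G x) \<le> K"
  shows "u \<in> W01p p \<Omega>"
proof -
  obtain \<eta> where \<eta>: "\<And>n. \<eta> n \<in> test_functions \<Omega>"
    and lim: "Lp_null p \<Omega> (\<lambda>n x. \<eta> n x - u x)" "Lp_null p \<Omega> (\<lambda>n x. grad (\<eta> n) x - G x)"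
    using ap by (auto simp: test_approx_def)
  have "continuous_on \<Omega> u"
    using G(1) GDERIV_isCont by (blast intro: continuous_at_imp_continuous_on)
  then have um: "u \<in> borel_measurable (lebesgue_on \<Omega>)" and Gm: "G \<in> borel_measurable (lebesgue_on \<Omega>)"
    using \<Omega>(1) G(2) by (auto intro: borel_measurable_lebesgue_on_continuous)
  have wm: "weak_grad \<Omega> u \<in> borel_measurable (lebesgue_on \<Omega>)"
    using \<Omega>(1) G by (rule weak_grad_classical_measurable)
  have ae: "AE x in lebesgue_on \<Omega>. weak_grad \<Omega> u x = G x"
    using \<Omega>(1) G by (rule weak_grad_classical(2))
  have "(\<lambda>n x. grad (\<eta> n) x - weak_grad \<Omega> u x) n \<in> borel_measurable (lebesgue_on \<Omega>)" for n
    by (rule borel_measurable_diff[OF test_functions_measurable(2)[OF \<eta>] wm])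
  moreover have "AE x in lebesgue_on \<Omega>. grad (\<eta> n) x - G x = grad (\<eta> n) x - weak_grad \<Omega> u x" for n
    using ae by eventually_elim simp
  ultimately have lim2: "Lp_null p \<Omega> (\<lambda>n x. grad (\<eta> n) x - weak_grad \<Omega> u x)"
    by (rule Lp_null_cong_AE[OF lim(2)])
  have uL: "u \<in> Lp p \<Omega>"
    using \<Omega> \<open>0 < p\<close> um B(1) by (intro Lp_bounded) auto
  have GL: "G \<in> Lp p \<Omega>"
    using \<Omega> \<open>0 < p\<close> Gm B(2) by (intro Lp_bounded) auto
  have "AE x in lebesgue_on \<Omega>. norm (G x) powr p = norm (weak_grad \<Omega> u x) powr p"
    using ae by eventually_elim simp
  moreover have "(\<lambda>x. norm (G x) powr p) \<in> borel_measurable (lebesgue_on \<Omega>)"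
    "(\<lambda>x. norm (weak_grad \<Omega> u x) powr p) \<in> borel_measurable (lebesgue_on \<Omega>)"
    using wm Gm by measurable
  ultimately have "integrable (lebesgue_on \<Omega>) (\<lambda>x. norm (weak_grad \<Omega> u x) powr p)"
    using GL integrable_cong_AE[of "\<lambda>x. norm (G x) powr p" _ "\<lambda>x. norm (weak_grad \<Omega> u x) powr p"]
    by (simp add: Lp_def)
  then have wL: "weak_grad \<Omega> u \<in> Lp p \<Omega>"
    using wm by (simp add: Lp_def)
  have "has_weak_grad \<Omega> u (weak_grad \<Omega> u)"
    using \<Omega>(1) G by (rule weak_grad_classical(1))
  then have "u \<in> W1p p \<Omega>"
    using uL wL by (auto simp: W1p_def)
  moreover have "(\<lambda>n. Lp_norm p \<Omega> (\<lambda>x. \<eta> n x - u x)) \<longlonglongrightarrow> 0"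
    "(\<lambda>n. Lp_norm p \<Omega> (\<lambda>x. grad (\<eta> n) x - weak_grad \<Omega> u x)) \<longlonglongrightarrow> 0"
    using Lp_null_iff_Lp_norm[OF \<open>0 < p\<close>, of "\<lambda>n x. \<eta> n x - u x"] lim(1)
      Lp_null_iff_Lp_norm[OF \<open>0 < p\<close>, of "\<lambda>n x. grad (\<eta> n) x - weak_grad \<Omega> u x"] lim2
    by (auto simp: Lp_null_def)
  ultimately show ?thesis
    using \<eta> by (auto simp: W01p_def)
qed

text \<open>For each k one test function is picked whose p-th power errors with respect to
  \<open>v k\<close> and \<open>G k\<close> are below 1 / (k + 1); the remaining errors are those of
  \<open>v k\<close> and \<open>G k\<close> themselves.\<close>

lemma test_approx_diagonal:
  fixes v :: "nat \<Rightarrow> 'a::euclidean_space \<Rightarrow> real"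
  assumes "0 < p" and ap: "\<And>k. test_approx p \<Omega> (R k) (v k) (G k)"
    and lim: "Lp_null p \<Omega> (\<lambda>k x. v k x - w x)" "Lp_null p \<Omega> (\<lambda>k x. G k x - H x)"
    and m: "w \<in> borel_measurable (lebesgue_on \<Omega>)" "H \<in> borel_measurable (lebesgue_on \<Omega>)"
  shows "test_approx p \<Omega> UNIV w H"
proof -
  define P where "P k \<eta> \<longleftrightarrow> \<eta> \<in> test_functions \<Omega> \<and>
      (\<lambda>x. \<eta> x - v k x) \<in> Lp p \<Omega> \<and> (LINT x|lebesgue_on \<Omega>. norm (\<eta> x - v k x) powr p) < inverse (real (Suc k)) \<and>
      (\<lambda>x. grad \<eta> x - G k x) \<in> Lp p \<Omega> \<and> (LINT x|lebesgue_on \<Omega>. norm (grad \<eta> x - G k x) powr p) < inverse (real (Suc k))"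
    for k \<eta>
  have "\<exists>\<eta>. P k \<eta>" for k
  proof -
    obtain \<eta> where \<eta>: "\<And>n. \<eta> n \<in> test_functions \<Omega>"
      and l: "Lp_null p \<Omega> (\<lambda>n x. \<eta> n x - v k x)" "Lp_null p \<Omega> (\<lambda>n x. grad (\<eta> n) x - G k x)"
      using ap[of k] by (auto simp: test_approx_def)
    have "\<forall>\<^sub>F n in sequentially. (LINT x|lebesgue_on \<Omega>. norm (\<eta> n x - v k x) powr p) < inverse (real (Suc k))"
      "\<forall>\<^sub>F n in sequentially. (LINT x|lebesgue_on \<Omega>. norm (grad (\<eta> n) x - G k x) powr p) < inverse (real (Suc k))"
      using l unfolding Lp_null_def by (auto elim!: order_tendstoD)
    then have "\<forall>\<^sub>F n in sequentially. (LINT x|lebesgue_on \<Omega>. norm (\<eta> n x - v k x) powr p) < inverse (real (Suc k)) \<and>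
      (LINT x|lebesgue_on \<Omega>. norm (grad (\<eta> n) x - G k x) powr p) < inverse (real (Suc k))"
      by (rule eventually_conj)
    then obtain n where "(LINT x|lebesgue_on \<Omega>. norm (\<eta> n x - v k x) powr p) < inverse (real (Suc k)) \<and>
      (LINT x|lebesgue_on \<Omega>. norm (grad (\<eta> n) x - G k x) powr p) < inverse (real (Suc k))"
      using eventually_happens'[OF sequentially_bot] by blast
    then show ?thesis
      using \<eta>[of n] l by (intro exI[of _ "\<eta> n"]) (simp add: Lp_null_def P_def)
  qed
  then obtain \<eta> where "\<And>k. P k (\<eta> k)"
    by metis
  then have \<eta>: "\<And>k. \<eta> k \<in> test_functions \<Omega>"
    and L: "\<And>k. (\<lambda>x. \<eta> k x - v k x) \<in> Lp p \<Omega>" "\<And>k. (\<lambda>x. grad (\<eta> k) x - G k x) \<in> Lp p \<Omega>"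
    and I: "\<And>k. (LINT x|lebesgue_on \<Omega>. norm (\<eta> k x - v k x) powr p) < inverse (real (Suc k))"
      "\<And>k. (LINT x|lebesgue_on \<Omega>. norm (grad (\<eta> k) x - G k x) powr p) < inverse (real (Suc k))"
    unfolding P_def by blast+
  have "(\<lambda>k. LINT x|lebesgue_on \<Omega>. norm (\<eta> k x - v k x) powr p) \<longlonglongrightarrow> 0"
    by (rule tendsto_sandwich[OF _ _ tendsto_const LIMSEQ_inverse_real_of_nat])
      (use I(1) in \<open>auto intro!: always_eventually less_imp_le\<close>)
  then have n1: "Lp_null p \<Omega> (\<lambda>k x. \<eta> k x - v k x)"
    using L by (simp add: Lp_null_def)
  have "(\<lambda>k. LINT x|lebesgue_on \<Omega>. norm (grad (\<eta> k) x - G k x) powr p) \<longlonglongrightarrow> 0"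
    by (rule tendsto_sandwich[OF _ _ tendsto_const LIMSEQ_inverse_real_of_nat])
      (use I(2) in \<open>auto intro!: always_eventually less_imp_le\<close>)
  then have n2: "Lp_null p \<Omega> (\<lambda>k x. grad (\<eta> k) x - G k x)"
    using L by (simp add: Lp_null_def)
  have "Lp_null p \<Omega> (\<lambda>k x. \<eta> k x - w x)"
  proof (rule Lp_null_dominated[OF n1 lim(1) \<open>0 < p\<close> zero_le_one])
    show "(\<lambda>x. \<eta> k x - w x) \<in> borel_measurable (lebesgue_on \<Omega>)" for k
      by (rule borel_measurable_diff[OF test_functions_measurable(1)[OF \<eta>] m(1)])
    show "norm (\<eta> k x - w x) \<le> 1 * (norm (\<eta> k x - v k x) + norm (v k x - w x))" for k x
      using norm_triangle_ineq[of "\<eta> k x - v k x" "v k x - w x"] by simp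
  qed
  moreover have "Lp_null p \<Omega> (\<lambda>k x. grad (\<eta> k) x - H x)"
  proof (rule Lp_null_dominated[OF n2 lim(2) \<open>0 < p\<close> zero_le_one])
    show "(\<lambda>x. grad (\<eta> k) x - H x) \<in> borel_measurable (lebesgue_on \<Omega>)" for k
      by (rule borel_measurable_diff[OF test_functions_measurable(2)[OF \<eta>] m(2)])
    show "norm (grad (\<eta> k) x - H x) \<le> 1 * (norm (grad (\<eta> k) x - G k x) + norm (G k x - H x))" for k x
      using norm_triangle_ineq[of "grad (\<eta> k) x - G k x" "G k x - H x"] by simp
  qed
  ultimately show ?thesis
    unfolding test_approx_def using \<eta> by (intro exI[of _ \<eta>]) auto
qed

section \<open>Regularized powers\<close>

text \<open>A smooth version of \<open>ln s - ln e\<close>, vanishing at \<open>0\<close>, which is bounded together with its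
  first two derivatives: \<open>e * exp (reg_ln e s)\<close> is the square root of
  \<open>(s\<^sup>2 + e\<^sup>2) / (1 + e\<^sup>2 * s\<^sup>2)\<close>, hence tends to \<open>\<bar>s\<bar>\<close> as \<open>e\<close> tends to \<open>0\<close>.\<close>

definition reg_ln :: "real \<Rightarrow> real \<Rightarrow> real" where
  "reg_ln e s = 1/2 * ln (s * s + e\<^sup>2) + (- (1/2) * ln (s * s + (1/e)\<^sup>2) + - 2 * ln e)"

text \<open>The derivative of \<open>reg_ln e\<close>, which tends to 1 / s for s > 0. The
  subtracted quotient stems from the denominator that keeps \<open>reg_ln e\<close> bounded for
  large arguments.\<close>

definition reg_inverse :: "real \<Rightarrow> real \<Rightarrow> real" where
  "reg_inverse e s = s / (s * s + e\<^sup>2) - s / (s * s + (1/e)\<^sup>2)"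

definition reg_inverse_deriv :: "real \<Rightarrow> real \<Rightarrow> real" where
  "reg_inverse_deriv e s = (e\<^sup>2 - s * s) / (s * s + e\<^sup>2)\<^sup>2 - ((1/e)\<^sup>2 - s * s) / (s * s + (1/e)\<^sup>2)\<^sup>2"

lemma square_plus_pos: "c > 0 \<Longrightarrow> s * s + c\<^sup>2 > (0::real)"
  by (simp add: add_nonneg_pos)

lemma reg_ln_deriv:
  assumes "e > 0"
  shows "(reg_ln e has_real_derivative reg_inverse e s) (at s)"
proof -
  have d: "((\<lambda>s. ln (s * s + c\<^sup>2)) has_real_derivative (s + s) / (s * s + c\<^sup>2)) (at s)" if "c > 0" for c
    using square_plus_pos[OF that, of s] by (auto intro!: derivative_eq_intros)
  have "((\<lambda>s. 1/2 * ln (s * s + e\<^sup>2) + (- (1/2) * ln (s * s + (1/e)\<^sup>2) + - 2 * ln e)) has_real_derivative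
      1/2 * ((s + s) / (s * s + e\<^sup>2)) + (- (1/2) * ((s + s) / (s * s + (1/e)\<^sup>2)) + 0)) (at s)"
    using assms by (intro DERIV_add DERIV_cmult DERIV_const d) auto
  then show ?thesis
    by (simp add: reg_ln_def[abs_def] reg_inverse_def add_divide_distrib)
qed

lemma quotient_deriv:
  assumes "c > 0"
  shows "((\<lambda>s. s / (s * s + c\<^sup>2)) has_real_derivative (c\<^sup>2 - s * s) / (s * s + c\<^sup>2)\<^sup>2) (at s)"
proof -
  have "((\<lambda>s. s / (s * s + c\<^sup>2)) has_real_derivative
      (1 * (s * s + c\<^sup>2) - s * (s + s)) / ((s * s + c\<^sup>2) * (s * s + c\<^sup>2))) (at s)"
    using square_plus_pos[OF assms, of s]
    by (intro DERIV_divide) (auto intro!: derivative_eq_intros)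
  then show ?thesis
    by (simp add: power2_eq_square algebra_simps)
qed

lemma reg_inverse_has_deriv:
  assumes "e > 0"
  shows "(reg_inverse e has_real_derivative reg_inverse_deriv e s) (at s)"
  unfolding reg_inverse_def[abs_def] reg_inverse_deriv_def
  using assms by (intro DERIV_diff quotient_deriv) auto

lemma quotient_bounds:
  fixes s c :: real
  assumes "c > 0"
  shows "\<bar>s / (s * s + c\<^sup>2)\<bar> \<le> 1 / c" "\<bar>(c\<^sup>2 - s * s) / (s * s + c\<^sup>2)\<^sup>2\<bar> \<le> 1 / c\<^sup>2"
proof -
  note pos = square_plus_pos[OF assms, of s]
  have "c * \<bar>s\<bar> \<le> s * s + c\<^sup>2"
  proof -
    have "0 \<le> (\<bar>s\<bar> - c)\<^sup>2 + \<bar>s\<bar> * c"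
      using assms by simp
    then show ?thesis
      by (simp add: power2_eq_square algebra_simps)
  qed
  then show "\<bar>s / (s * s + c\<^sup>2)\<bar> \<le> 1 / c"
    using pos assms by (simp add: abs_divide field_simps)
  have "\<bar>c\<^sup>2 - s * s\<bar> / (s * s + c\<^sup>2)\<^sup>2 \<le> (s * s + c\<^sup>2) / (s * s + c\<^sup>2)\<^sup>2"
    by (intro divide_right_mono) (auto simp: abs_le_iff)
  also have "\<dots> = 1 / (s * s + c\<^sup>2)"
    using pos by (simp add: power2_eq_square)
  also have "\<dots> \<le> 1 / c\<^sup>2"
    using assms by (intro divide_left_mono mult_pos_pos pos) auto
  finally show "\<bar>(c\<^sup>2 - s * s) / (s * s + c\<^sup>2)\<^sup>2\<bar> \<le> 1 / c\<^sup>2"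
    by (simp add: abs_divide)
qed

text \<open>These bounds serve \<open>test_approx_compose\<close> at a fixed e and blow up as e
  tends to 0. Control uniform in e comes from \<open>exp_reg_ln_mult_reg_inverse_le\<close> and
  \<open>reg_ln_diff_le\<close>.\<close>

lemma reg_bounded:
  assumes "e > 0"
  obtains B where "\<And>s. \<bar>reg_inverse e s\<bar> \<le> B" "\<And>s. \<bar>reg_inverse_deriv e s\<bar> \<le> B"
proof -
  define B where "B = (1 / e + 1 / (1 / e)) + (1 / e\<^sup>2 + 1 / (1 / e)\<^sup>2)"
  have e': "1 / e > 0"
    using assms by simp
  have "\<bar>reg_inverse e s\<bar> \<le> 1 / e + 1 / (1 / e)" for s
    unfolding reg_inverse_def
    using quotient_bounds(1)[OF assms, of s] quotient_bounds(1)[OF e', of s] by linarith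
  moreover have "\<bar>reg_inverse_deriv e s\<bar> \<le> 1 / e\<^sup>2 + 1 / (1 / e)\<^sup>2" for s
    unfolding reg_inverse_deriv_def
    using quotient_bounds(2)[OF assms, of s] quotient_bounds(2)[OF e', of s] by linarith
  moreover have "1 / e + 1 / (1 / e) \<le> B" "1 / e\<^sup>2 + 1 / (1 / e)\<^sup>2 \<le> B"
    using assms by (auto simp: B_def)
  ultimately show ?thesis
    by (meson order_trans that)
qed

lemma reg_ln_0: "e > 0 \<Longrightarrow> reg_ln e 0 = 0"
  by (simp add: reg_ln_def ln_realpow ln_div)

lemma smooth_on_reg_ln:
  fixes \<eta> :: "'a::euclidean_space \<Rightarrow> real"
  assumes "e > 0" "smooth_on UNIV \<eta>"
  shows "smooth_on UNIV (\<lambda>x. reg_ln e (\<eta> x))"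
  unfolding reg_ln_def
  using assms(1) square_plus_pos[OF assms(1)] square_plus_pos[of "1/e"]
  by (intro smooth_on_add smooth_on_mult smooth_on_const smooth_on_ln assms(2)) auto

text \<open>The quotient of s^2 + e^2 by s^2 + 1/e^2 lies between e^4 and 1; half its logarithm,
  shifted by - 2 ln e, gives the two bounds.\<close>

lemma reg_ln_range:
  assumes "0 < e" "e \<le> 1"
  shows "0 \<le> reg_ln e s" "reg_ln e s \<le> - 2 * ln e"
proof -
  have pos: "s * s + e\<^sup>2 > 0" "s * s + (1/e)\<^sup>2 > 0"
    using assms by (auto intro!: square_plus_pos)
  have "e ^ 4 * (s * s + (1/e)\<^sup>2) \<le> s * s + e\<^sup>2"
  proof -
    have "e ^ 4 * (s * s) \<le> 1 * (s * s)"
      using assms by (intro mult_right_mono power_le_one) auto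
    moreover have "e ^ 4 * (1/e)\<^sup>2 = e\<^sup>2"
      using assms by (simp add: power2_eq_square power4_eq_xxxx)
    ultimately show ?thesis
      by (simp add: distrib_left)
  qed
  then have "ln (e ^ 4 * (s * s + (1/e)\<^sup>2)) \<le> ln (s * s + e\<^sup>2)"
    using pos assms by (subst ln_le_cancel_iff) (auto intro!: mult_pos_pos)
  then have "4 * ln e + ln (s * s + (1/e)\<^sup>2) \<le> ln (s * s + e\<^sup>2)"
    using pos assms by (simp add: ln_mult ln_realpow)
  then show "0 \<le> reg_ln e s"
    unfolding reg_ln_def by linarith
  have "e \<le> 1 / e"
    using assms by (simp add: field_simps mult_le_one)
  then have "e\<^sup>2 \<le> (1/e)\<^sup>2"
    using assms by (intro power_mono) auto
  then have "ln (s * s + e\<^sup>2) \<le> ln (s * s + (1/e)\<^sup>2)"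
    using pos by (subst ln_le_cancel_iff) auto
  then show "reg_ln e s \<le> - 2 * ln e"
    unfolding reg_ln_def by linarith
qed

lemma exp_reg_ln:
  assumes "e > 0"
  shows "e * exp (reg_ln e s) = sqrt ((s * s + e\<^sup>2) / (e\<^sup>2 * (s * s) + 1))"
proof (rule real_sqrt_unique[symmetric])
  have pos: "s * s + e\<^sup>2 > 0" "s * s + (1/e)\<^sup>2 > 0"
    using assms by (auto intro!: square_plus_pos)
  have "(exp (reg_ln e s))\<^sup>2 = exp (2 * reg_ln e s)"
    by (simp add: power2_eq_square flip: exp_add)
  also have "2 * reg_ln e s = ln (s * s + e\<^sup>2) - (ln (s * s + (1/e)\<^sup>2) + ln (e ^ 4))"
    using assms by (simp add: reg_ln_def ln_realpow)
  also have "exp \<dots> = (s * s + e\<^sup>2) / ((s * s + (1/e)\<^sup>2) * e ^ 4)"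
    using pos assms by (simp add: exp_diff exp_add)
  finally have "(e * exp (reg_ln e s))\<^sup>2 = e\<^sup>2 * ((s * s + e\<^sup>2) / ((s * s + (1/e)\<^sup>2) * e ^ 4))"
    by (simp add: power_mult_distrib)
  also have "(s * s + (1/e)\<^sup>2) * e ^ 4 = e\<^sup>2 * (e\<^sup>2 * (s * s) + 1)"
    using assms by (simp add: power2_eq_square power4_eq_xxxx field_simps)
  also have "e\<^sup>2 * ((s * s + e\<^sup>2) / (e\<^sup>2 * (e\<^sup>2 * (s * s) + 1))) = (s * s + e\<^sup>2) / (e\<^sup>2 * (s * s) + 1)"
    using assms by simp
  finally show "(e * exp (reg_ln e s))\<^sup>2 = (s * s + e\<^sup>2) / (e\<^sup>2 * (s * s) + 1)" .
qed (use assms in auto)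

lemma exp_reg_ln_le:
  assumes "e > 0"
  shows "e * exp (reg_ln e s) \<le> sqrt (s * s + e\<^sup>2)"
proof -
  have "(s * s + e\<^sup>2) / (e\<^sup>2 * (s * s) + 1) \<le> (s * s + e\<^sup>2) / 1"
    using assms by (intro divide_left_mono) (auto intro!: add_nonneg_pos)
  then show ?thesis
    unfolding exp_reg_ln[OF assms] by simp
qed

text \<open>The regularized form of s * (1 / s) = 1: for e \<le> 1 the product is at most s / sqrt
  (s^2 + e^2). The bound does not depend on e, as domination in the limit e \<rightarrow> 0
  requires.\<close>

lemma exp_reg_ln_mult_reg_inverse_le:
  assumes "0 < e" "e \<le> 1" "0 \<le> s"
  shows "e * exp (reg_ln e s) * \<bar>reg_inverse e s\<bar> \<le> 1"
proof -
  have pos: "s * s + e\<^sup>2 > 0"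
    using assms by (auto intro!: square_plus_pos)
  have "e \<le> 1 / e"
    using assms by (simp add: field_simps mult_le_one)
  then have "e\<^sup>2 \<le> (1/e)\<^sup>2"
    using assms by (intro power_mono) auto
  then have "s / (s * s + (1/e)\<^sup>2) \<le> s / (s * s + e\<^sup>2)"
    using pos square_plus_pos[of "1/e" s] assms by (intro divide_left_mono mult_pos_pos) auto
  moreover have "0 \<le> s / (s * s + (1/e)\<^sup>2)"
    using assms by simp
  ultimately have "\<bar>reg_inverse e s\<bar> \<le> s / (s * s + e\<^sup>2)"
    unfolding reg_inverse_def by linarith
  then have "e * exp (reg_ln e s) * \<bar>reg_inverse e s\<bar> \<le> sqrt (s * s + e\<^sup>2) * (s / (s * s + e\<^sup>2))"
    using assms by (intro mult_mono exp_reg_ln_le) auto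
  also have "\<dots> = s / sqrt (s * s + e\<^sup>2)"
  proof -
    define r where "r = sqrt (s * s + e\<^sup>2)"
    have r: "s * s + e\<^sup>2 = r * r" "r > 0"
      using pos by (simp_all add: r_def)
    show ?thesis
      unfolding r_def[symmetric] r(1) using r(2) by simp
  qed
  also have "\<dots> \<le> 1"
  proof -
    have "s \<le> sqrt (s * s + e\<^sup>2)"
      by (rule real_le_rsqrt) (simp add: power2_eq_square)
    then show ?thesis
      using assms pos by (simp add: divide_le_eq del: real_sqrt_mult_self)
  qed
  finally show ?thesis .
qed

text \<open>In the quotient under the root of \<open>exp_reg_ln\<close>, numerator and denominator
  each cost a factor C^2 when s is exchanged for t. The root leaves C^2, again uniformly in
  e.\<close>

lemma reg_ln_diff_le:
  assumes "0 < e" "0 < s" "0 < t" "1 \<le> C" "t \<le> C * s" "s \<le> C * t"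
  shows "reg_ln e t - reg_ln e s \<le> 2 * ln C"
proof -
  have sq: "t * t \<le> C\<^sup>2 * (s * s)" "s * s \<le> C\<^sup>2 * (t * t)"
    using mult_mono[OF assms(5,5)] mult_mono[OF assms(6,6)] assms
    by (auto simp: power2_eq_square ac_simps)
  have C: "C\<^sup>2 \<ge> 1"
    using assms by simp
  have "(t * t + e\<^sup>2) / (e\<^sup>2 * (t * t) + 1) \<le> (C\<^sup>2 * (s * s + e\<^sup>2)) / ((e\<^sup>2 * (s * s) + 1) / C\<^sup>2)"
  proof (rule frac_le)
    have "1 * e\<^sup>2 \<le> C\<^sup>2 * e\<^sup>2"
      using C by (intro mult_right_mono) auto
    then show "t * t + e\<^sup>2 \<le> C\<^sup>2 * (s * s + e\<^sup>2)"
      using sq by (simp add: distrib_left)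
    have "e\<^sup>2 * (s * s) \<le> e\<^sup>2 * (C\<^sup>2 * (t * t))"
      using sq by (intro mult_left_mono) auto
    then have "e\<^sup>2 * (s * s) + 1 \<le> C\<^sup>2 * (e\<^sup>2 * (t * t) + 1)"
      using C by (simp add: algebra_simps)
    then show "(e\<^sup>2 * (s * s) + 1) / C\<^sup>2 \<le> e\<^sup>2 * (t * t) + 1"
      using C by (simp add: divide_le_eq mult.commute)
    show "0 < (e\<^sup>2 * (s * s) + 1) / C\<^sup>2"
      using assms by (intro divide_pos_pos add_nonneg_pos) auto
  qed (use C in auto)
  also have "\<dots> = (C\<^sup>2)\<^sup>2 * ((s * s + e\<^sup>2) / (e\<^sup>2 * (s * s) + 1))"
    by (simp add: power2_eq_square)
  finally have "sqrt ((t * t + e\<^sup>2) / (e\<^sup>2 * (t * t) + 1)) \<le> sqrt ((C\<^sup>2)\<^sup>2 * ((s * s + e\<^sup>2) / (e\<^sup>2 * (s * s) + 1)))"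
    by (rule real_sqrt_le_mono)
  then have "e * exp (reg_ln e t) \<le> C\<^sup>2 * (e * exp (reg_ln e s))"
    unfolding exp_reg_ln[OF assms(1)] real_sqrt_mult real_sqrt_abs by simp
  then have "exp (reg_ln e t) \<le> C\<^sup>2 * exp (reg_ln e s)"
    using assms(1) by (simp add: mult.left_commute)
  also have "\<dots> = exp (2 * ln C + reg_ln e s)"
    using assms by (simp add: exp_add exp_double power2_eq_square mult_exp_exp)
  finally show ?thesis
    by simp
qed

lemma reg_limits:
  assumes s: "s > 0" and e: "e \<longlonglongrightarrow> 0" "\<And>k. e k > 0"
  shows "(\<lambda>k. e k * exp (reg_ln (e k) s)) \<longlonglongrightarrow> s" "(\<lambda>k. reg_inverse (e k) s) \<longlonglongrightarrow> 1 / s"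
proof -
  have "(\<lambda>k. sqrt ((s * s + (e k)\<^sup>2) / ((e k)\<^sup>2 * (s * s) + 1))) \<longlonglongrightarrow> sqrt ((s * s + 0\<^sup>2) / (0\<^sup>2 * (s * s) + 1))"
    by (intro tendsto_intros e) simp
  then show "(\<lambda>k. e k * exp (reg_ln (e k) s)) \<longlonglongrightarrow> s"
    using s e(2) by (simp add: exp_reg_ln)
  have "(\<lambda>k. s / (s * s + (e k)\<^sup>2) - s * (e k)\<^sup>2 / (s * s * (e k)\<^sup>2 + 1)) \<longlonglongrightarrow>
      s / (s * s + 0\<^sup>2) - s * 0\<^sup>2 / (s * s * 0\<^sup>2 + 1)"
    using s by (intro tendsto_intros e) auto
  \<comment> \<open>Expanding the second quotient by the square of \<open>e k\<close> removes 1 /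
    \<open>e k\<close>, so that the expression is continuous at e = 0.\<close>
  moreover have "reg_inverse (e k) s = s / (s * s + (e k)\<^sup>2) - s * (e k)\<^sup>2 / (s * s * (e k)\<^sup>2 + 1)" for k
  proof -
    have "s / (s * s + (1 / e k)\<^sup>2) = (s * (e k)\<^sup>2) / ((s * s + (1 / e k)\<^sup>2) * (e k)\<^sup>2)"
      using e(2)[of k] by simp
    also have "(s * s + (1 / e k)\<^sup>2) * (e k)\<^sup>2 = s * s * (e k)\<^sup>2 + 1"
      using e(2)[of k] by (simp add: power_divide distrib_right)
    finally show ?thesis
      by (simp add: reg_inverse_def)
  qed
  ultimately show "(\<lambda>k. reg_inverse (e k) s) \<longlonglongrightarrow> 1 / s"
    using s by simp
qed

section \<open>Weighted geometric means of two comparable functions\<close>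

text \<open>What the eigenfunction and a hypothetical solution have in common. The two-sided ratio
  bound carries the boundary behaviour and keeps powers of the quotient bounded for exponents of
  either sign.\<close>

locale comparable_pair =
  fixes \<Omega> :: "'a::euclidean_space set" and \<phi> u :: "'a \<Rightarrow> real" and G\<phi> Gu :: "'a \<Rightarrow> 'a" and K C :: real
  assumes open_dom: "open \<Omega>" and bounded_dom: "bounded \<Omega>"
    and deriv: "\<And>x. x \<in> \<Omega> \<Longrightarrow> GDERIV \<phi> x :> G\<phi> x" "\<And>x. x \<in> \<Omega> \<Longrightarrow> GDERIV u x :> Gu x"
    and grad_cont: "continuous_on \<Omega> G\<phi>" "continuous_on \<Omega> Gu"
    and pos: "\<And>x. x \<in> \<Omega> \<Longrightarrow> 0 < \<phi> x" "\<And>x. x \<in> \<Omega> \<Longrightarrow> 0 < u x"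
    and bnd: "\<And>x. x \<in> \<Omega> \<Longrightarrow> \<phi> x \<le> K" "\<And>x. x \<in> \<Omega> \<Longrightarrow> u x \<le> K"
    and grad_bnd: "\<And>x. x \<in> \<Omega> \<Longrightarrow> norm (G\<phi> x) \<le> K" "\<And>x. x \<in> \<Omega> \<Longrightarrow> norm (Gu x) \<le> K"
    and K_pos: "0 < K" and C_ge_1: "1 \<le> C"
    and ratio: "\<And>x. x \<in> \<Omega> \<Longrightarrow> \<phi> x \<le> C * u x" "\<And>x. x \<in> \<Omega> \<Longrightarrow> u x \<le> C * \<phi> x"
begin

text \<open>The weights add up to 1 but may be negative; the theorem uses A = q and A = q - p + 1.
  Since \<open>gm A\<close> is homogeneous of degree 1 in the pair, the coefficients of its gradient
  depend on the quotient of the two functions alone.\<close>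

definition gm :: "real \<Rightarrow> 'a \<Rightarrow> real" where
  "gm A x = \<phi> x powr A * u x powr (1 - A)"

definition gm_grad :: "real \<Rightarrow> 'a \<Rightarrow> 'a" where
  "gm_grad A x = A *\<^sub>R ((\<phi> x / u x) powr (A - 1) *\<^sub>R G\<phi> x) + (1 - A) *\<^sub>R ((\<phi> x / u x) powr A *\<^sub>R Gu x)"

lemma cont: "continuous_on \<Omega> \<phi>" "continuous_on \<Omega> u"
  using deriv GDERIV_isCont by (blast intro: continuous_at_imp_continuous_on)+

text \<open>These quotients are the coefficients in \<open>gm_grad\<close>, and also the limits of
  the regularized coefficients in \<open>gm_W01p\<close>.\<close>

lemma gm_div:
  assumes "x \<in> \<Omega>"
  shows "gm A x * (1 / \<phi> x) = (\<phi> x / u x) powr (A - 1)" "gm A x * (1 / u x) = (\<phi> x / u x) powr A"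
proof -
  note p = pos[OF assms]
  have "gm A x * (1 / \<phi> x) = exp (A * ln (\<phi> x)) * exp ((1 - A) * ln (u x)) * exp (- ln (\<phi> x))"
    using p by (simp add: gm_def powr_def exp_minus divide_inverse)
  also have "\<dots> = exp ((A - 1) * (ln (\<phi> x) - ln (u x)))"
    by (simp add: exp_add[symmetric] algebra_simps)
  also have "\<dots> = (\<phi> x / u x) powr (A - 1)"
    using p by (simp add: powr_def ln_div)
  finally show "gm A x * (1 / \<phi> x) = (\<phi> x / u x) powr (A - 1)" .
  have "gm A x * (1 / u x) = exp (A * ln (\<phi> x)) * exp ((1 - A) * ln (u x)) * exp (- ln (u x))"
    using p by (simp add: gm_def powr_def exp_minus divide_inverse)
  also have "\<dots> = exp (A * (ln (\<phi> x) - ln (u x)))"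
    by (simp add: exp_add[symmetric] algebra_simps)
  also have "\<dots> = (\<phi> x / u x) powr A"
    using p by (simp add: powr_def ln_div)
  finally show "gm A x * (1 / u x) = (\<phi> x / u x) powr A" .
qed

lemma gm_deriv:
  assumes "x \<in> \<Omega>"
  shows "GDERIV (gm A) x :> gm_grad A x"
proof -
  note p = pos[OF assms]
  have "GDERIV (\<lambda>x. \<phi> x powr A * u x powr (1 - A)) x :>
      \<phi> x powr A *\<^sub>R (((1 - A) * u x powr (1 - A - 1)) *\<^sub>R Gu x) +
      u x powr (1 - A) *\<^sub>R ((A * \<phi> x powr (A - 1)) *\<^sub>R G\<phi> x)"
    using p by (intro GDERIV_mult GDERIV_DERIV_compose deriv assms has_real_derivative_powr)
  moreover have "\<phi> x powr A *\<^sub>R (((1 - A) * u x powr (1 - A - 1)) *\<^sub>R Gu x) =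
      (1 - A) *\<^sub>R ((\<phi> x / u x) powr A *\<^sub>R Gu x)"
  proof -
    have "(\<phi> x / u x) powr A = \<phi> x powr A * u x powr (1 - A - 1)"
      using gm_div(2)[OF assms, of A] p by (simp add: gm_def powr_diff powr_minus_divide)
    then show ?thesis
      by (simp only: scaleR_scaleR mult.commute mult.left_commute)
  qed
  moreover have "u x powr (1 - A) *\<^sub>R ((A * \<phi> x powr (A - 1)) *\<^sub>R G\<phi> x) =
      A *\<^sub>R ((\<phi> x / u x) powr (A - 1) *\<^sub>R G\<phi> x)"
  proof -
    have "(\<phi> x / u x) powr (A - 1) = u x powr (1 - A) * \<phi> x powr (A - 1)"
      using gm_div(1)[OF assms, of A] p by (simp add: gm_def powr_diff mult.commute)
    then show ?thesis
      by (simp only: scaleR_scaleR mult.commute mult.left_commute)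
  qed
  ultimately show ?thesis
    by (simp only: gm_def[abs_def] gm_grad_def add.commute)
qed

lemma gm_grad_cont: "continuous_on \<Omega> (gm_grad A)"
proof -
  have nz: "\<phi> x \<noteq> 0" "u x \<noteq> 0" if "x \<in> \<Omega>" for x
    using pos[OF that] by auto
  show ?thesis
    unfolding gm_grad_def using cont grad_cont by (auto intro!: continuous_intros simp: nz)
qed

lemma gm_cont: "continuous_on \<Omega> (gm A)"
  using gm_deriv GDERIV_isCont by (blast intro: continuous_at_imp_continuous_on)

text \<open>Both ratio bounds together say that the logarithm of the quotient is at most ln C in
  absolute value.\<close>

lemma ratio_powr_le:
  assumes "x \<in> \<Omega>"
  shows "(\<phi> x / u x) powr a \<le> C powr \<bar>a\<bar>"
proof -
  note p = pos[OF assms]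
  have "ln (\<phi> x) \<le> ln (C * u x)" "ln (u x) \<le> ln (C * \<phi> x)"
    using ratio[OF assms] p C_ge_1 by (auto intro: ln_mono)
  then have "\<bar>ln (\<phi> x / u x)\<bar> \<le> ln C"
    using p C_ge_1 by (simp add: ln_mult ln_div)
  then have "\<bar>a\<bar> * \<bar>ln (\<phi> x / u x)\<bar> \<le> \<bar>a\<bar> * ln C"
    by (intro mult_left_mono) auto
  then have "a * ln (\<phi> x / u x) \<le> \<bar>a\<bar> * ln C"
    using abs_ge_self[of "a * ln (\<phi> x / u x)"] by (simp only: abs_mult)
  then show ?thesis
    using p C_ge_1 by (simp add: powr_def)
qed

lemma gm_pos: "x \<in> \<Omega> \<Longrightarrow> 0 < gm A x"
  using pos[of x] by (simp add: gm_def)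

lemma gm_le:
  assumes "x \<in> \<Omega>"
  shows "gm A x \<le> K * C powr \<bar>A - 1\<bar>"
proof -
  have "gm A x = \<phi> x * (\<phi> x / u x) powr (A - 1)"
    using gm_div(1)[OF assms, of A] pos[OF assms] by (simp add: field_simps)
  also have "\<dots> \<le> K * C powr \<bar>A - 1\<bar>"
    using bnd[OF assms] pos[OF assms] K_pos by (intro mult_mono ratio_powr_le assms) auto
  finally show ?thesis .
qed

lemma gm_grad_le:
  assumes "x \<in> \<Omega>"
  shows "norm (gm_grad A x) \<le> \<bar>A\<bar> * (C powr \<bar>A - 1\<bar> * K) + \<bar>1 - A\<bar> * (C powr \<bar>A\<bar> * K)"
proof -
  have "norm (gm_grad A x) \<le> \<bar>A\<bar> * ((\<phi> x / u x) powr (A - 1) * norm (G\<phi> x)) + \<bar>1 - A\<bar> * ((\<phi> x / u x) powr A * norm (Gu x))"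
    unfolding gm_grad_def by (rule order_trans[OF norm_triangle_ineq]) (simp add: abs_mult mult.assoc)
  also have "\<dots> \<le> \<bar>A\<bar> * (C powr \<bar>A - 1\<bar> * K) + \<bar>1 - A\<bar> * (C powr \<bar>A\<bar> * K)"
    using grad_bnd[OF assms] K_pos
    by (intro add_mono mult_left_mono mult_mono ratio_powr_le assms) auto
  finally show ?thesis .
qed

text \<open>For fixed k the function \<open>E k\<close> minus \<open>e k\<close> is obtained from
  \<phi> and u by smooth compositions and so inherits approximation by test functions. As k grows,
  these functions and their gradients converge pointwise to \<open>gm A\<close> and
  \<open>gm_grad A\<close> under bounds independent of k, and the diagonal lemma concludes.\<close>

lemma gm_W01p:
  assumes "0 < p" and \<phi>: "\<phi> \<in> W01p p \<Omega>" and u: "u \<in> W01p p \<Omega>"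
  shows "gm A \<in> W01p p \<Omega>"
proof -
  define e where "e k = inverse (real (Suc k))" for k
  have e: "0 < e k" "e k \<le> 1" "e \<longlonglongrightarrow> 0" for k
    using LIMSEQ_inverse_real_of_nat by (auto simp: e_def[abs_def] field_simps)
  define X where "X k x = A * reg_ln (e k) (\<phi> x) + (1 - A) * reg_ln (e k) (u x)" for k x
  define GX where "GX k x = A *\<^sub>R (reg_inverse (e k) (\<phi> x) *\<^sub>R G\<phi> x) + (1 - A) *\<^sub>R (reg_inverse (e k) (u x) *\<^sub>R Gu x)" for k x
  define E where "E k x = e k * exp (X k x)" for k x
  have conts: "continuous_on \<Omega> (\<lambda>x. reg_ln (e k) (w x))" "continuous_on \<Omega> (\<lambda>x. reg_inverse (e k) (w x))"
    if "continuous_on \<Omega> w" for k w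
    by (rule continuous_on_compose2[OF _ that subset_UNIV],
        intro continuous_at_imp_continuous_on ballI DERIV_isCont[OF reg_ln_deriv[OF e(1)]] DERIV_isCont[OF reg_inverse_has_deriv[OF e(1)]])+
  have X_cont: "continuous_on \<Omega> (X k)" and GX_cont: "continuous_on \<Omega> (GX k)" for k
    unfolding X_def[abs_def] GX_def[abs_def] by (intro continuous_intros conts cont grad_cont)+
  have E_cont: "continuous_on \<Omega> (E k)" for k
    unfolding E_def[abs_def] by (intro continuous_intros X_cont)
  note meas = borel_measurable_lebesgue_on_continuous[OF open_dom]
  \<comment> \<open>The outer function \<open>e k * (exp s - 1)\<close> vanishes at 0. Its
    derivatives are bounded only on bounded sets, hence the interval with endpoint
    \<open>M k\<close>, taken from \<open>reg_ln_range\<close>.\<close>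
  have approx: "test_approx p \<Omega> ((\<lambda>s. e k * (exp s - 1)) ` {- M k..M k}) (\<lambda>x. e k * (exp (X k x) - 1)) (\<lambda>x. (e k * exp (X k x)) *\<^sub>R GX k x)"
    if M: "M k = (\<bar>A\<bar> + \<bar>1 - A\<bar>) * (- 2 * ln (e k))" for k M
  proof -
    obtain B where B: "\<And>s. \<bar>reg_inverse (e k) s\<bar> \<le> B" "\<And>s. \<bar>reg_inverse_deriv (e k) s\<bar> \<le> B"
      using reg_bounded[OF e(1)] by metis
    have ap\<phi>: "test_approx p \<Omega> UNIV \<phi> G\<phi>"
      using bnd pos grad_bnd
      by (intro W01p_imp_test_approx[OF open_dom bounded_dom \<open>0 < p\<close> \<phi> deriv(1) grad_cont(1), of K]) (auto simp: abs_of_pos)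
    have apu: "test_approx p \<Omega> UNIV u Gu"
      using bnd pos grad_bnd
      by (intro W01p_imp_test_approx[OF open_dom bounded_dom \<open>0 < p\<close> u deriv(2) grad_cont(2), of K]) (auto simp: abs_of_pos)
    have 1: "test_approx p \<Omega> (range (reg_ln (e k))) (\<lambda>x. reg_ln (e k) (\<phi> x)) (\<lambda>x. reg_inverse (e k) (\<phi> x) *\<^sub>R G\<phi> x)"
      by (rule test_approx_compose[OF open_dom \<open>0 < p\<close> ap\<phi> _ convex_UNIV reg_ln_deriv[OF e(1)]
            reg_inverse_has_deriv[OF e(1)] B reg_ln_0[OF e(1)] smooth_on_reg_ln[OF e(1)]
            meas[OF cont(1)] meas[OF grad_cont(1)] grad_bnd(1)]) auto
    have 2: "test_approx p \<Omega> (range (reg_ln (e k))) (\<lambda>x. reg_ln (e k) (u x)) (\<lambda>x. reg_inverse (e k) (u x) *\<^sub>R Gu x)"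
      by (rule test_approx_compose[OF open_dom \<open>0 < p\<close> apu _ convex_UNIV reg_ln_deriv[OF e(1)]
            reg_inverse_has_deriv[OF e(1)] B reg_ln_0[OF e(1)] smooth_on_reg_ln[OF e(1)]
            meas[OF cont(2)] meas[OF grad_cont(2)] grad_bnd(2)]) auto
    have range: "A * reg_ln (e k) s + (1 - A) * reg_ln (e k) t \<in> {- M k..M k}" for s t
    proof -
      have "\<bar>A * reg_ln (e k) s + (1 - A) * reg_ln (e k) t\<bar> \<le> \<bar>A\<bar> * \<bar>reg_ln (e k) s\<bar> + \<bar>1 - A\<bar> * \<bar>reg_ln (e k) t\<bar>"
        by (rule order_trans[OF abs_triangle_ineq]) (simp add: abs_mult)
      also have "\<dots> \<le> \<bar>A\<bar> * (- 2 * ln (e k)) + \<bar>1 - A\<bar> * (- 2 * ln (e k))"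
        using reg_ln_range[OF e(1,2), of k] by (intro add_mono mult_left_mono) auto
      also have "\<dots> = M k"
        by (simp add: M algebra_simps)
      finally show ?thesis
        by (simp add: abs_le_iff)
    qed
    have 3: "test_approx p \<Omega> {- M k..M k} (X k) (GX k)"
      unfolding X_def[abs_def] GX_def[abs_def]
      using range
      by (intro test_approx_add[OF \<open>0 < p\<close> 1 2] meas conts cont grad_cont continuous_on_scaleR) auto
    show ?thesis
    proof (rule test_approx_compose[OF open_dom \<open>0 < p\<close> 3 _ convex_real_interval(5)])
      show "X k x \<in> {- M k..M k}" for x
        unfolding X_def by (rule range)
      show "((\<lambda>s. e k * (exp s - 1)) has_real_derivative e k * exp s) (at s)"
        "((\<lambda>s. e k * exp s) has_real_derivative e k * exp s) (at s)" for s
        by (auto intro!: derivative_eq_intros)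
      show "\<bar>e k * exp s\<bar> \<le> e k * exp (M k)" "\<bar>e k * exp s\<bar> \<le> e k * exp (M k)" if "s \<in> {- M k..M k}" for s
        using that e(1)[of k] by (auto simp: abs_mult)
      show "smooth_on UNIV (\<lambda>x. e k * (exp (\<eta> x) - 1))" if "smooth_on UNIV \<eta>" for \<eta> :: "'a \<Rightarrow> real"
      proof -
        have "smooth_on UNIV (\<lambda>x. e k * (exp (\<eta> x) + (- 1)))"
          by (intro smooth_on_mult smooth_on_add smooth_on_const smooth_on_exp that)
        then show ?thesis by simp
      qed
      show "X k \<in> borel_measurable (lebesgue_on \<Omega>)" "GX k \<in> borel_measurable (lebesgue_on \<Omega>)"
        by (rule meas[OF X_cont], rule meas[OF GX_cont])
      show "norm (GX k x) \<le> \<bar>A\<bar> * (B * K) + \<bar>1 - A\<bar> * (B * K)" if "x \<in> \<Omega>" for x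
      proof -
        have "B \<ge> 0"
          using B(1)[of 0] by linarith
        have "norm (GX k x) \<le> \<bar>A\<bar> * (\<bar>reg_inverse (e k) (\<phi> x)\<bar> * norm (G\<phi> x)) + \<bar>1 - A\<bar> * (\<bar>reg_inverse (e k) (u x)\<bar> * norm (Gu x))"
          unfolding GX_def by (rule order_trans[OF norm_triangle_ineq]) (simp add: abs_mult mult.assoc)
        also have "\<dots> \<le> \<bar>A\<bar> * (B * K) + \<bar>1 - A\<bar> * (B * K)"
          using grad_bnd[OF that] \<open>B \<ge> 0\<close>
          by (intro add_mono mult_left_mono mult_mono B) auto
        finally show ?thesis .
      qed
    qed simp
  qed
  \<comment> \<open>\<open>E k\<close> differs from either regularized function by the exponential
    of a multiple of d, the difference of the two regularized logarithms. By comparability |d| \<le>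
    2 ln C, so Q bounds both factors for every k.\<close>
  define Q where "Q = exp ((\<bar>A\<bar> + \<bar>1 - A\<bar>) * (2 * ln C))"
  have E_le: "E k x \<le> e k * exp (reg_ln (e k) (\<phi> x)) * Q" "E k x \<le> e k * exp (reg_ln (e k) (u x)) * Q"
    if x: "x \<in> \<Omega>" for k x
  proof -
    define d where "d = reg_ln (e k) (u x) - reg_ln (e k) (\<phi> x)"
    have "\<bar>d\<bar> \<le> 2 * ln C"
      using reg_ln_diff_le[OF e(1) pos[OF x] C_ge_1 ratio(2,1)[OF x], of k]
        reg_ln_diff_le[OF e(1) pos(2,1)[OF x] C_ge_1 ratio[OF x], of k]
      by (simp add: d_def abs_le_iff)
    moreover have "ln C \<ge> 0"
      using C_ge_1 by simp
    ultimately have d: "\<bar>a * d\<bar> \<le> (\<bar>A\<bar> + \<bar>1 - A\<bar>) * (2 * ln C)" if "\<bar>a\<bar> \<le> \<bar>A\<bar> + \<bar>1 - A\<bar>" for a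
      unfolding abs_mult using that by (intro mult_mono) auto
    have "E k x = e k * exp (reg_ln (e k) (\<phi> x)) * exp ((1 - A) * d)"
      "E k x = e k * exp (reg_ln (e k) (u x)) * exp (- A * d)"
      by (simp_all add: E_def X_def d_def exp_add[symmetric] mult.assoc) (simp_all add: algebra_simps)
    moreover have "exp ((1 - A) * d) \<le> Q" "exp (- A * d) \<le> Q"
      unfolding Q_def exp_le_cancel_iff using d[of "1 - A"] d[of "- A"] by linarith+
    ultimately show "E k x \<le> e k * exp (reg_ln (e k) (\<phi> x)) * Q" "E k x \<le> e k * exp (reg_ln (e k) (u x)) * Q"
      using e(1)[of k] by (metis exp_ge_zero less_imp_le mult_left_mono mult_nonneg_nonneg)+
  qed
  have E_nonneg: "0 \<le> E k x" for k x
    using e(1)[of k] by (simp add: E_def)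
  have Q: "Q \<ge> 0"
    by (simp add: Q_def)
  have E_lim: "(\<lambda>k. E k x) \<longlonglongrightarrow> gm A x" if x: "x \<in> \<Omega>" for x
  proof -
    \<comment> \<open>The exponents A and 1 - A add up to 1, so the prefactor \<open>e k\<close> can
      be distributed over the two powers.\<close>
    have "E k x = (e k * exp (reg_ln (e k) (\<phi> x))) powr A * (e k * exp (reg_ln (e k) (u x))) powr (1 - A)" for k
    proof -
      have "e k powr A * e k powr (1 - A) = e k"
        using e(1)[of k] by (simp flip: powr_add)
      then show ?thesis
        using e(1)[of k]
        by (simp add: E_def X_def exp_add powr_mult exp_powr_real mult.commute mult.left_commute)
    qed
    moreover have "(\<lambda>k. (e k * exp (reg_ln (e k) (\<phi> x))) powr A * (e k * exp (reg_ln (e k) (u x))) powr (1 - A)) \<longlonglongrightarrow> gm A x"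
      unfolding gm_def using pos[OF x]
      by (intro tendsto_mult tendsto_powr reg_limits(1) e tendsto_const) auto
    ultimately show ?thesis by simp
  qed
  have "test_approx p \<Omega> UNIV (gm A) (gm_grad A)"
  proof (rule test_approx_diagonal[OF \<open>0 < p\<close> approx[OF refl]])
    show "Lp_null p \<Omega> (\<lambda>k x. e k * (exp (X k x) - 1) - gm A x)"
    proof (rule Lp_null_bounded[OF open_dom bounded_dom \<open>0 < p\<close>])
      show "(\<lambda>x. e k * (exp (X k x) - 1) - gm A x) \<in> borel_measurable (lebesgue_on \<Omega>)" for k
        by (intro meas continuous_intros X_cont gm_cont)
      show "(\<lambda>k. e k * (exp (X k x) - 1) - gm A x) \<longlonglongrightarrow> 0" if "x \<in> \<Omega>" for x
      proof -
        have "(\<lambda>k. E k x - e k - gm A x) \<longlonglongrightarrow> gm A x - 0 - gm A x"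
          by (intro tendsto_intros E_lim that e)
        then show ?thesis
          by (simp add: E_def right_diff_distrib)
      qed
      show "norm (e k * (exp (X k x) - 1) - gm A x) \<le> sqrt (K * K + 1) * Q + 1 + K * C powr \<bar>A - 1\<bar>" if x: "x \<in> \<Omega>" for k x
      proof -
        have "e k * exp (reg_ln (e k) (\<phi> x)) \<le> sqrt (\<phi> x * \<phi> x + (e k)\<^sup>2)"
          by (rule exp_reg_ln_le[OF e(1)])
        also have "\<dots> \<le> sqrt (K * K + 1)"
          using bnd[OF x] pos[OF x] e(1,2)[of k]
          by (intro real_sqrt_le_mono add_mono mult_mono power_le_one) auto
        finally have "e k * exp (reg_ln (e k) (\<phi> x)) * Q \<le> sqrt (K * K + 1) * Q"
          using Q by (rule mult_right_mono)
        then have "E k x \<le> sqrt (K * K + 1) * Q"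
          using E_le(1)[OF x, of k] by linarith
        moreover have "e k * (exp (X k x) - 1) - gm A x = E k x - e k - gm A x"
          by (simp add: E_def right_diff_distrib)
        ultimately show ?thesis
          using E_nonneg[of k x] e(1,2)[of k] gm_le[OF x, of A] gm_pos[OF x, of A]
          unfolding real_norm_def by linarith
      qed
    qed
    show "Lp_null p \<Omega> (\<lambda>k x. (e k * exp (X k x)) *\<^sub>R GX k x - gm_grad A x)"
    proof (rule Lp_null_bounded[OF open_dom bounded_dom \<open>0 < p\<close>])
      show "(\<lambda>x. (e k * exp (X k x)) *\<^sub>R GX k x - gm_grad A x) \<in> borel_measurable (lebesgue_on \<Omega>)" for k
        by (intro meas continuous_intros X_cont GX_cont gm_grad_cont)
      have split: "(e k * exp (X k x)) *\<^sub>R GX k x =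
          A *\<^sub>R ((E k x * reg_inverse (e k) (\<phi> x)) *\<^sub>R G\<phi> x) + (1 - A) *\<^sub>R ((E k x * reg_inverse (e k) (u x)) *\<^sub>R Gu x)" for k x
        by (simp add: E_def GX_def scaleR_add_right mult.commute mult.left_commute)
      show "(\<lambda>k. (e k * exp (X k x)) *\<^sub>R GX k x - gm_grad A x) \<longlonglongrightarrow> 0" if x: "x \<in> \<Omega>" for x
      proof -
        have "(\<lambda>k. A *\<^sub>R ((E k x * reg_inverse (e k) (\<phi> x)) *\<^sub>R G\<phi> x) + (1 - A) *\<^sub>R ((E k x * reg_inverse (e k) (u x)) *\<^sub>R Gu x) - gm_grad A x)
          \<longlonglongrightarrow> A *\<^sub>R ((gm A x * (1 / \<phi> x)) *\<^sub>R G\<phi> x) + (1 - A) *\<^sub>R ((gm A x * (1 / u x)) *\<^sub>R Gu x) - gm_grad A x"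
          by (intro tendsto_diff tendsto_add tendsto_scaleR tendsto_mult tendsto_const E_lim x reg_limits(2) pos e)
        then show ?thesis
          unfolding split gm_div[OF x] by (simp add: gm_grad_def)
      qed
      show "norm ((e k * exp (X k x)) *\<^sub>R GX k x - gm_grad A x) \<le>
          (\<bar>A\<bar> * (Q * K) + \<bar>1 - A\<bar> * (Q * K)) + (\<bar>A\<bar> * (C powr \<bar>A - 1\<bar> * K) + \<bar>1 - A\<bar> * (C powr \<bar>A\<bar> * K))" if x: "x \<in> \<Omega>" for k x
      proof -
        \<comment> \<open>\<open>E k\<close> is at most Q times the regularized value of either
          function, and that value times its regularized inverse is at most 1. Each of the two
          gradient terms uses the bound for its own function.\<close>
        have b: "E k x * \<bar>reg_inverse (e k) (w x)\<bar> \<le> Q" if w: "E k x \<le> e k * exp (reg_ln (e k) (w x)) * Q" "0 \<le> w x" for w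
        proof -
          have "E k x * \<bar>reg_inverse (e k) (w x)\<bar> \<le> (e k * exp (reg_ln (e k) (w x)) * Q) * \<bar>reg_inverse (e k) (w x)\<bar>"
            using w(1) by (rule mult_right_mono) simp
          also have "\<dots> = (e k * exp (reg_ln (e k) (w x)) * \<bar>reg_inverse (e k) (w x)\<bar>) * Q"
            by (simp only: ac_simps)
          also have "\<dots> \<le> 1 * Q"
            using Q by (intro mult_right_mono exp_reg_ln_mult_reg_inverse_le e w)
          finally show ?thesis by simp
        qed
        have "norm ((e k * exp (X k x)) *\<^sub>R GX k x) \<le>
            \<bar>A\<bar> * ((E k x * \<bar>reg_inverse (e k) (\<phi> x)\<bar>) * norm (G\<phi> x)) + \<bar>1 - A\<bar> * ((E k x * \<bar>reg_inverse (e k) (u x)\<bar>) * norm (Gu x))"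
          unfolding split using E_nonneg[of k x]
          by (intro order_trans[OF norm_triangle_ineq]) (simp add: abs_mult)
        also have "\<dots> \<le> \<bar>A\<bar> * (Q * K) + \<bar>1 - A\<bar> * (Q * K)"
          using E_nonneg[of k x] Q grad_bnd[OF x] pos[OF x] E_le[OF x, of k]
          by (intro add_mono mult_left_mono mult_mono b) auto
        finally show ?thesis
          using norm_triangle_ineq4[of "(e k * exp (X k x)) *\<^sub>R GX k x" "gm_grad A x"] gm_grad_le[OF x, of A]
          by linarith
      qed
    qed
  qed (intro meas gm_cont gm_grad_cont)+
  then show ?thesis
  proof (rule test_approx_imp_W01p[OF open_dom bounded_dom \<open>0 < p\<close> _ gm_deriv gm_grad_cont])
    fix x assume x: "x \<in> \<Omega>"
    let ?B = "max (K * C powr \<bar>A - 1\<bar>) (\<bar>A\<bar> * (C powr \<bar>A - 1\<bar> * K) + \<bar>1 - A\<bar> * (C powr \<bar>A\<bar> * K))"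
    show "\<bar>gm A x\<bar> \<le> ?B"
      using gm_le[OF x, of A] gm_pos[OF x, of A] by linarith
    show "norm (gm_grad A x) \<le> ?B"
      using gm_grad_le[OF x, of A] by linarith
  qed
qed

end

section \<open>Nonexistence of solutions\<close>

lemma flux_measurable: "flux r \<in> borel_measurable borel"
  unfolding flux_def[abs_def] by measurable

text \<open>The norm of the flux is the power r - 1 > 0 of the norm of its argument, hence bounded
  for the representatives \<open>g\<close> and \<open>h\<close>; integrability passes to functions
  that agree with them almost everywhere.\<close>

lemma integrable_flux_inner:
  fixes G H :: "'a::euclidean_space \<Rightarrow> 'a"
  assumes "open \<Omega>" "bounded \<Omega>" "1 < r"
    and m: "G \<in> borel_measurable (lebesgue_on \<Omega>)" "H \<in> borel_measurable (lebesgue_on \<Omega>)"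
      "g \<in> borel_measurable (lebesgue_on \<Omega>)" "h \<in> borel_measurable (lebesgue_on \<Omega>)"
    and ae: "AE x in lebesgue_on \<Omega>. G x = g x" "AE x in lebesgue_on \<Omega>. H x = h x"
    and B: "\<And>x. x \<in> \<Omega> \<Longrightarrow> norm (g x) \<le> B" "\<And>x. x \<in> \<Omega> \<Longrightarrow> norm (h x) \<le> D"
  shows "integrable (lebesgue_on \<Omega>) (\<lambda>x. flux r (G x) \<bullet> H x)"
proof -
  have meas: "(\<lambda>x. flux r (F x) \<bullet> F' x) \<in> borel_measurable (lebesgue_on \<Omega>)"
    if "F \<in> borel_measurable (lebesgue_on \<Omega>)" "F' \<in> borel_measurable (lebesgue_on \<Omega>)" for F F' :: "'a \<Rightarrow> 'a"
    using measurable_compose[OF that(1) flux_measurable] that(2) by (rule borel_measurable_inner)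
  have "norm (flux r (g x) \<bullet> h x) \<le> B powr (r - 1) * D" if x: "x \<in> \<Omega>" for x
  proof -
    have "norm (g x) powr (r - 2) * norm (g x) = norm (g x) powr (r - 1)"
      using powr_add[of "norm (g x)" "r - 2" 1] \<open>1 < r\<close> by (cases "g x = 0") auto
    then have "norm (flux r (g x)) = norm (g x) powr (r - 1)"
      by (simp add: flux_def)
    then have "norm (flux r (g x) \<bullet> h x) \<le> norm (g x) powr (r - 1) * norm (h x)"
      using Cauchy_Schwarz_ineq2[of "flux r (g x)" "h x"] by simp
    also have "\<dots> \<le> B powr (r - 1) * D"
      using B[OF x] \<open>1 < r\<close> by (intro mult_mono powr_mono2) auto
    finally show ?thesis .
  qed
  then have "integrable (lebesgue_on \<Omega>) (\<lambda>x. flux r (g x) \<bullet> h x)"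
    by (rule integrable_lebesgue_on_bounded[OF assms(1,2) meas[OF m(3,4)]])
  moreover have "AE x in lebesgue_on \<Omega>. flux r (g x) \<bullet> h x = flux r (G x) \<bullet> H x"
    using ae by eventually_elim simp
  ultimately show ?thesis
    using integrable_cong_AE[OF meas[OF m(3,4)] meas[OF m(1,2)]] by blast
qed

text \<open>Positive measure is what turns a strict inequality almost everywhere into a strict
  inequality of integrals.\<close>

lemma emeasure_lebesgue_on_open_nonzero:
  fixes \<Omega> :: "'a::euclidean_space set"
  assumes "open \<Omega>" "\<Omega> \<noteq> {}"
  shows "emeasure (lebesgue_on \<Omega>) (space (lebesgue_on \<Omega>)) \<noteq> 0"
proof
  assume "emeasure (lebesgue_on \<Omega>) (space (lebesgue_on \<Omega>)) = 0"
  then have "\<Omega> \<in> null_sets lebesgue"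
    using assms(1) by (auto simp: emeasure_restrict_space borel_open)
  then have null: "negligible \<Omega>"
    by (simp add: negligible_iff_null_sets)
  obtain x e where "x \<in> \<Omega>" "e > 0" "ball x e \<subseteq> \<Omega>"
    using assms by (meson ex_in_conv open_contains_ball)
  moreover obtain a b where "x \<in> box a b" "box a b \<subseteq> ball x e"
    using rational_boxes[OF \<open>e > 0\<close>, of x] by blast
  ultimately have "negligible (box a b)" "box a b \<noteq> {}"
    using null negligible_subset by blast+
  then show False
    by (simp add: negligible_interval)
qed

theorem theorem3p1:
  fixes \<Omega> :: "(real ^ 'n) set"
    and p q :: real
    and f :: "real \<Rightarrow> real ^ 'n \<Rightarrow> real \<Rightarrow> real ^ 'n \<Rightarrow> real"
    and \<phi>p m :: "real ^ 'n \<Rightarrow> real"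
    and M :: "real set"
  assumes "CARD('n) \<ge> 2"
    and "smooth_bounded_domain \<Omega>"
    and "1 < q" and "q < p"
    and "p \<in> I_set q"
    and "normalized_first_eigenfunction p \<Omega> \<phi>p"
    and "integrable (lebesgue_on \<Omega>) m"
    and "(\<integral>x. m x * \<phi>p x powr q \<partial>lebesgue_on \<Omega>) > 0"
    and "\<forall>\<mu>\<in>M. AE x in lebesgue_on \<Omega>. \<forall>s>0. \<forall>\<xi>.
           f \<mu> x s \<xi> > lambda1 p \<Omega> * s powr (p - 1) + beta_star q \<Omega> \<phi>p m * m x * s powr (q - 1)"
    and "\<mu> \<in> M"
  shows "\<not> (\<exists>u \<in> int_C10_plus \<Omega>. is_solution p q \<Omega> (f \<mu>) u)"
proof
  assume "\<exists>u \<in> int_C10_plus \<Omega>. is_solution p q \<Omega> (f \<mu>) u"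
  then obtain u where u: "u \<in> int_C10_plus \<Omega>" and sol: "is_solution p q \<Omega> (f \<mu>) u"
    by blast
  note dom = assms(2) and q = assms(3) and qp = assms(4) and pI = assms(5) and m_pos = assms(8)
  have eig: "p_eigenfunction p \<Omega> (lambda1 p \<Omega>) \<phi>p" and \<phi>: "\<phi>p \<in> int_C10_plus \<Omega>"
    using assms(6) by (auto simp: normalized_first_eigenfunction_def)
  have o: "open \<Omega>" "bounded \<Omega>" "\<Omega> \<noteq> {}"
    using dom by (auto simp: smooth_bounded_domain_def)
  obtain G\<phi> Gu where G: "C1_closure_grad \<Omega> \<phi>p G\<phi>" "C1_closure_grad \<Omega> u Gu"
    using u \<phi> by (auto simp: int_C10_plus_def C10_def)
  have pos: "\<And>x. x \<in> \<Omega> \<Longrightarrow> 0 < \<phi>p x" "\<And>x. x \<in> \<Omega> \<Longrightarrow> 0 < u x"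
    using u \<phi> by (auto simp: int_C10_plus_def)
  obtain K1 where K1: "K1 > 0" "\<And>x. x \<in> closure \<Omega> \<Longrightarrow> \<bar>\<phi>p x\<bar> \<le> K1" "\<And>x. x \<in> closure \<Omega> \<Longrightarrow> norm (G\<phi> x) \<le> K1"
    using C1_closure_grad_bounded[OF o(2) G(1)] by metis
  obtain K2 where K2: "K2 > 0" "\<And>x. x \<in> closure \<Omega> \<Longrightarrow> \<bar>u x\<bar> \<le> K2" "\<And>x. x \<in> closure \<Omega> \<Longrightarrow> norm (Gu x) \<le> K2"
    using C1_closure_grad_bounded[OF o(2) G(2)] by metis
  obtain C1 where C1: "C1 \<ge> 1" "\<And>x. x \<in> \<Omega> \<Longrightarrow> \<phi>p x \<le> C1 * u x"
    using int_C10_plus_ratio_bounded[OF dom u \<phi>] by metis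
  obtain C2 where C2: "C2 \<ge> 1" "\<And>x. x \<in> \<Omega> \<Longrightarrow> u x \<le> C2 * \<phi>p x"
    using int_C10_plus_ratio_bounded[OF dom \<phi> u] by metis
  define K where "K = max K1 K2"
  define C where "C = max C1 C2"
  interpret comparable_pair \<Omega> \<phi>p u G\<phi> Gu K C
  proof
    fix x assume x: "x \<in> \<Omega>"
    then have cl: "x \<in> closure \<Omega>"
      using closure_subset by blast
    show "GDERIV \<phi>p x :> G\<phi> x" "GDERIV u x :> Gu x"
      using G x by (auto simp: C1_closure_grad_def)
    show "0 < \<phi>p x" "0 < u x"
      using pos x by auto
    show "\<phi>p x \<le> K" "u x \<le> K" "norm (G\<phi> x) \<le> K" "norm (Gu x) \<le> K"
      using K1(2,3)[OF cl] K2(2,3)[OF cl] by (auto simp: K_def)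
    have "C1 * u x \<le> C * u x" "C2 * \<phi>p x \<le> C * \<phi>p x"
      using pos[OF x] by (auto simp: C_def intro!: mult_right_mono)
    then show "\<phi>p x \<le> C * u x" "u x \<le> C * \<phi>p x"
      using C1(2)[OF x] C2(2)[OF x] by linarith+
  next
    show "continuous_on \<Omega> G\<phi>" "continuous_on \<Omega> Gu"
      using G by (auto simp: C1_closure_grad_def intro: continuous_on_subset[OF _ closure_subset])
  qed (use o K1(1) C1(1) in \<open>auto simp: K_def C_def\<close>)
  \<comment> \<open>The weight of the second test function: \<open>gm r\<close> is \<phi>^(q-p+1)
    u^(p-q).\<close>
  define r where "r = q - p + 1"
  let ?M = "lebesgue_on \<Omega>"
  let ?w\<phi> = "weak_grad \<Omega> \<phi>p" and ?wu = "weak_grad \<Omega> u"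
  let ?w1 = "weak_grad \<Omega> (gm q)" and ?w2 = "weak_grad \<Omega> (gm r)"
  define lam where "lam = lambda1 p \<Omega>"
  define \<beta> where "\<beta> = beta_star q \<Omega> \<phi>p m"
  have \<phi>W: "\<phi>p \<in> W01p p \<Omega>" and uW: "u \<in> W01p p \<Omega>"
    using eig sol by (auto simp: p_eigenfunction_def is_solution_def)
  have gmW: "gm A \<in> W01p p \<Omega>" for A
    using q qp by (intro gm_W01p \<phi>W uW) auto
  note meas = borel_measurable_lebesgue_on_continuous[OF o(1)]
  have wm: "?w\<phi> \<in> borel_measurable ?M" "?wu \<in> borel_measurable ?M" "weak_grad \<Omega> (gm A) \<in> borel_measurable ?M" for A
    using weak_grad_classical_measurable[OF o(1) deriv(1) grad_cont(1)]
      weak_grad_classical_measurable[OF o(1) deriv(2) grad_cont(2)]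
      weak_grad_classical_measurable[OF o(1) gm_deriv gm_grad_cont] by simp_all
  have ae: "AE x in ?M. ?w\<phi> x = G\<phi> x" "AE x in ?M. ?wu x = Gu x" "AE x in ?M. weak_grad \<Omega> (gm A) x = gm_grad A x" for A
    using weak_grad_classical(2)[OF o(1) deriv(1) grad_cont(1)]
      weak_grad_classical(2)[OF o(1) deriv(2) grad_cont(2)]
      weak_grad_classical(2)[OF o(1) gm_deriv gm_grad_cont] by simp_all
  have in_\<Omega>: "AE x in ?M. x \<in> \<Omega>"
    by (rule AE_I2) simp
  have sol1: "integrable ?M (\<lambda>x. flux p (?wu x) \<bullet> ?w1 x)" "integrable ?M (\<lambda>x. flux q (?wu x) \<bullet> ?w1 x)"
    "integrable ?M (\<lambda>x. f \<mu> x (u x) (?wu x) * gm q x)"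
    and sol2: "(LINT x|?M. flux p (?wu x) \<bullet> ?w1 x) + (LINT x|?M. flux q (?wu x) \<bullet> ?w1 x) =
      (LINT x|?M. f \<mu> x (u x) (?wu x) * gm q x)"
    using sol gmW[of q] by (auto simp: is_solution_def)
  \<comment> \<open>The inequality holds pointwise by \<open>picone\<close> with z = \<phi> / u: the
    vectors there become the gradients of \<open>gm q\<close> and \<open>gm r\<close>.\<close>
  have "(LINT x|?M. flux p (?wu x) \<bullet> ?w1 x) \<le> (LINT x|?M. flux p (?w\<phi> x) \<bullet> ?w2 x)"
  proof (rule integral_mono_AE[OF sol1(1)])
    show "integrable ?M (\<lambda>x. flux p (?w\<phi> x) \<bullet> ?w2 x)"
      using q qp
      by (intro integrable_flux_inner[OF o(1,2) _ wm(1,3) meas[OF grad_cont(1)] meas[OF gm_grad_cont] ae(1,3) grad_bnd(1) gm_grad_le]) auto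
    show "AE x in ?M. flux p (?wu x) \<bullet> ?w1 x \<le> flux p (?w\<phi> x) \<bullet> ?w2 x"
      using ae(1) ae(2) ae(3)[of q] ae(3)[of r] in_\<Omega>
    proof eventually_elim
      case (elim x)
      have z: "\<phi>p x / u x > 0"
        using pos[OF elim(5)] by simp
      show ?case
        using picone[OF q less_imp_le[OF qp] pI z, of "Gu x" "G\<phi> x"]
        unfolding elim(1-4) by (simp add: gm_grad_def r_def)
    qed
  qed
  also have "\<dots> = lam * (LINT x|?M. \<bar>\<phi>p x\<bar> powr (p - 2) * \<phi>p x * gm r x)"
    using eig gmW[of r] unfolding p_eigenfunction_def lam_def by blast
  \<comment> \<open>Both integrands are \<phi>^q u^(p-q).\<close>
  also have "(LINT x|?M. \<bar>\<phi>p x\<bar> powr (p - 2) * \<phi>p x * gm r x) = (LINT x|?M. u x powr (p - 1) * gm q x)"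
  proof (rule Bochner_Integration.integral_cong[OF refl])
    fix x assume "x \<in> space ?M"
    then have x: "0 < \<phi>p x" "0 < u x"
      using pos by auto
    have "\<bar>\<phi>p x\<bar> powr (p - 2) * \<phi>p x * gm r x = \<phi>p x powr (p - 2) * \<phi>p x powr 1 * \<phi>p x powr r * u x powr (1 - r)"
      using x by (simp add: gm_def)
    also have "\<dots> = \<phi>p x powr q * u x powr (p - q)"
      by (simp only: powr_add[symmetric]) (simp add: r_def)
    also have "\<dots> = u x powr (p - 1) * gm q x"
      by (simp add: gm_def mult.left_commute flip: powr_add)
    finally show "\<bar>\<phi>p x\<bar> powr (p - 2) * \<phi>p x * gm r x = u x powr (p - 1) * gm q x" .
  qed
  finally have p_part: "(LINT x|?M. flux p (?wu x) \<bullet> ?w1 x) \<le> lam * (LINT x|?M. u x powr (p - 1) * gm q x)" .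
  \<comment> \<open>Here \<open>picone\<close> is applied with p = q, where the test function on the
    right reduces to \<phi> itself.\<close>
  have "(LINT x|?M. flux q (?wu x) \<bullet> ?w1 x) \<le> (LINT x|?M. norm (?w\<phi> x) powr q)"
  proof (rule integral_mono_AE[OF sol1(2)])
    have "integrable ?M (\<lambda>x. flux q (?w\<phi> x) \<bullet> ?w\<phi> x)"
      by (rule integrable_flux_inner[OF o(1,2) q wm(1,1) meas[OF grad_cont(1)] meas[OF grad_cont(1)] ae(1,1) grad_bnd(1,1)])
    then show "integrable ?M (\<lambda>x. norm (?w\<phi> x) powr q)"
      by (simp add: flux_inner_self)
    show "AE x in ?M. flux q (?wu x) \<bullet> ?w1 x \<le> norm (?w\<phi> x) powr q"
      using ae(1) ae(2) ae(3)[of q] in_\<Omega>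
    proof eventually_elim
      case (elim x)
      have z: "\<phi>p x / u x > 0"
        using pos[OF elim(4)] by simp
      show ?case
        using picone[OF q order_refl self_in_I_set[OF q] z, of "Gu x" "G\<phi> x"] pos[OF elim(4)]
        unfolding elim(1-3) by (simp add: gm_grad_def flux_inner_self)
    qed
  qed
  also have "\<dots> = \<beta> * (LINT x|?M. m x * \<phi>p x powr q)"
    using m_pos by (simp add: \<beta>_def beta_star_def)
  finally have q_part: "(LINT x|?M. flux q (?wu x) \<bullet> ?w1 x) \<le> \<beta> * (LINT x|?M. m x * \<phi>p x powr q)" .
  have int1: "integrable ?M (\<lambda>x. u x powr (p - 1) * gm q x)"
  proof (rule integrable_lebesgue_on_bounded[OF o(1,2)])
    have nz: "u x \<noteq> 0" if "x \<in> \<Omega>" for x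
      using pos(2)[OF that] by simp
    show "(\<lambda>x. u x powr (p - 1) * gm q x) \<in> borel_measurable ?M"
      using nz by (intro meas continuous_intros cont gm_cont) auto
    show "norm (u x powr (p - 1) * gm q x) \<le> K powr (p - 1) * (K * C powr \<bar>q - 1\<bar>)" if x: "x \<in> \<Omega>" for x
    proof -
      have "u x powr (p - 1) * gm q x \<le> K powr (p - 1) * (K * C powr \<bar>q - 1\<bar>)"
        using pos[OF x] bnd[OF x] q qp K_pos gm_pos[OF x, of q]
        by (intro mult_mono powr_mono2 gm_le x) auto
      then show ?thesis
        using gm_pos[OF x, of q] by simp
    qed
  qed
  \<comment> \<open>A nonintegrable function would have integral 0 by default, contrary to
    positivity.\<close>
  have int2: "integrable ?M (\<lambda>x. m x * \<phi>p x powr q)"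
    using m_pos not_integrable_integral_eq by fastforce
  have "lam * (LINT x|?M. u x powr (p - 1) * gm q x) + \<beta> * (LINT x|?M. m x * \<phi>p x powr q) =
      (LINT x|?M. lam * (u x powr (p - 1) * gm q x) + \<beta> * (m x * \<phi>p x powr q))"
    using int1 int2 by simp
  \<comment> \<open>The only strict step of the proof: the strict lower bound on \<open>f\<close> is
    multiplied by the positive function \<open>gm q\<close> and integrated over a set of positive
    finite measure.\<close>
  also have "\<dots> < (LINT x|?M. f \<mu> x (u x) (?wu x) * gm q x)"
  proof (rule finite_measure.integral_less_AE_space[OF finite_measure_lebesgue_on_open[OF o(1,2)] _ sol1(3) _
        emeasure_lebesgue_on_open_nonzero[OF o(1,3)]])
    show "integrable ?M (\<lambda>x. lam * (u x powr (p - 1) * gm q x) + \<beta> * (m x * \<phi>p x powr q))"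
      using int1 int2 by simp
    have "AE x in ?M. \<forall>s>0. \<forall>\<xi>. f \<mu> x s \<xi> > lam * s powr (p - 1) + \<beta> * m x * s powr (q - 1)"
      using assms(9,10) unfolding lam_def \<beta>_def by blast
    then show "AE x in ?M. lam * (u x powr (p - 1) * gm q x) + \<beta> * (m x * \<phi>p x powr q) < f \<mu> x (u x) (?wu x) * gm q x"
      using in_\<Omega>
    proof eventually_elim
      case (elim x)
      note x = pos[OF elim(2)]
      \<comment> \<open>The powers of u cancel, which turns the term with \<open>m\<close> into the
        integrand from the denominator of \<open>beta_star\<close>.\<close>
      have "u x powr (q - 1) * gm q x = \<phi>p x powr q * (u x powr (q - 1) * u x powr (1 - q))"
        by (simp add: gm_def)
      also have "\<dots> = \<phi>p x powr q"
        using x by (simp flip: powr_add)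
      finally have "lam * (u x powr (p - 1) * gm q x) + \<beta> * (m x * \<phi>p x powr q) =
          (lam * u x powr (p - 1) + \<beta> * m x * u x powr (q - 1)) * gm q x"
        by (simp add: distrib_right mult.assoc)
      also have "\<dots> < f \<mu> x (u x) (?wu x) * gm q x"
        using elim(1) x gm_pos[OF elim(2), of q] by (intro mult_strict_right_mono) auto
      finally show ?case .
    qed
  qed
  finally show False
    using p_part q_part sol2 by linarith
qed

end
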